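(* Let $t>0$, let $X$ be a Fréchet space (the intersection of a decreasing family of Banach spaces $X_{(M)}$, $M\in\mathbb{N}$, with increasing norms $\|\cdot\|_{(M)}$), and let $\Phi\in\mathcal{S}(\mathbb{R}^n;X)'$ be an $X'$-valued tempered distribution. Suppose that $\exp(t\pi|\cdot|^2)\Phi\in\mathcal{S}(\mathbb{R}^n;X)'$ and $\exp(\tfrac{\pi}{t}|\cdot|^2)\hat\Phi\in\mathcal{S}(\mathbb{R}^n;X)'$, in the sense that there exist $\Psi_1,\Psi_2\in\mathcal{S}(\mathbb{R}^n;X)'$ with $\Phi(g)=\Psi_1(\exp(-t\pi|\cdot|^2)g)$ and $\hat\Phi(g)=\Psi_2(\exp(-\tfrac{\pi}{t}|\cdot|^2)g)$ for all $g\in\mathcal{S}(\mathbb{R}^n;X)$. Then there exist $N\in\mathbb{N}$ and elements $C_\alpha\in X'$ ($|\alpha|\le N$) such that $$\Phi(y)=\sum_{|\alpha|\le N}C_\alpha\,y^\alpha\exp(-t\pi|y|^2)\qquad\forall y\in\mathbb{R}^n,$$ meaning $\Phi(g)=\sum_{|\alpha|\le N}\int_{\mathbb{R}^n}C_\alpha(g(y))\,y^\alpha\exp(-t\pi|y|^2)\,dy$ for all $g\in\mathcal{S}(\mathbb{R}^n;X)$. In particular this applies to $X=\mathcal{S}(\mathbb{R}^n)$.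
   Context: Multi-index notation: $x^\alpha=x_1^{\alpha_1}\cdots x_n^{\alpha_n}$, $D^\beta=\partial^{\beta_1}_{x_1}\cdots\partial^{\beta_n}_{x_n}$. The space $\mathcal{S}(\mathbb{R}^n;X)$ consists of smooth $X$-valued functions $f$ with $\|f\|_{(M,N)}<\infty$ for all $M,N\in\mathbb{N}$, where $\|f\|_{(M,N)}=\big(\sum_{|\alpha|,|\beta|\le N}\big\|\,\|x^\alpha D^\beta f(x)\|_{(M)}\big\|_{L^2(dx)}^2\big)^{1/2}$; $\mathcal{S}(\mathbb{R}^n;X)'$ is its continuous dual, so each $\Phi$ in it satisfies $|\Phi(f)|\le c\|f\|_{(M,N)}$ for some $M,N,c$. The Fourier transform of $f\in\mathcal{S}(\mathbb{R}^n;X)$ is $\hat f(\xi)=\int f(x)e^{-2\pi i\xi\cdot x}dx$, and for $\Phi\in\mathcal{S}(\mathbb{R}^n;X)'$ one sets $\hat\Phi(f)=\Phi(\hat f)$. $X'$ denotes the continuous dual of $X$. *)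

theory Defs
  imports "HOL-Analysis.Analysis"
begin

definition cscale :: "('b::real_normed_vector \<Rightarrow> 'b) \<Rightarrow> complex \<Rightarrow> 'b \<Rightarrow> 'b" where
  "cscale J c x = Re c *\<^sub>R x + Im c *\<^sub>R J x"

definition complex_banach_structure :: "('b::{real_normed_vector,banach} \<Rightarrow> 'b) \<Rightarrow> bool" where
  "complex_banach_structure J \<longleftrightarrow> linear J \<and> (\<forall>x. J (J x) = - x) \<and>
     (\<forall>c x. norm (cscale J c x) = norm c * norm x)"

text \<open>
  The Frechet space X is modelled as the intersection of a decreasing family
  Xs M (M :: nat) of complex subspaces of a complex Banach space 'b, where
  Xs 0 is the whole of 'b with nrm 0 = norm, each Xs M is a Banach space
  for the norm nrm M, and the norms increase.
\<close>

definition frechet_family :: "(nat \<Rightarrow> 'b::{real_normed_vector,banach} set) \<Rightarrow> (nat \<Rightarrow> 'b \<Rightarrow> real) \<Rightarrow> ('b \<Rightarrow> 'b) \<Rightarrow> bool" where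
  "frechet_family Xs nrm J \<longleftrightarrow>
     complex_banach_structure J \<and> Xs 0 = UNIV \<and> nrm 0 = norm \<and>
     (\<forall>M. Xs (Suc M) \<subseteq> Xs M) \<and>
     (\<forall>M. 0 \<in> Xs M \<and> (\<forall>x\<in>Xs M. \<forall>y\<in>Xs M. x + y \<in> Xs M) \<and> (\<forall>c. \<forall>x\<in>Xs M. cscale J c x \<in> Xs M)) \<and>
     (\<forall>M. \<forall>x\<in>Xs M. 0 \<le> nrm M x \<and> (nrm M x = 0 \<longleftrightarrow> x = 0)) \<and>
     (\<forall>M. \<forall>x\<in>Xs M. \<forall>y\<in>Xs M. nrm M (x + y) \<le> nrm M x + nrm M y) \<and>
     (\<forall>M c. \<forall>x\<in>Xs M. nrm M (cscale J c x) = norm c * nrm M x) \<and>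
     (\<forall>M. \<forall>s. (\<forall>k. s k \<in> Xs M) \<longrightarrow>
          (\<forall>e>0. \<exists>K. \<forall>k\<ge>K. \<forall>l\<ge>K. nrm M (s k - s l) < e) \<longrightarrow>
          (\<exists>L\<in>Xs M. (\<lambda>k. nrm M (s k - L)) \<longlonglongrightarrow> 0)) \<and>
     (\<forall>M. \<forall>x\<in>Xs (Suc M). nrm M x \<le> nrm (Suc M) x)"

definition Xint :: "(nat \<Rightarrow> 'b set) \<Rightarrow> 'b set" where
  "Xint Xs = (\<Inter>M. Xs M)"

definition multi_idx :: "nat \<Rightarrow> ('n::finite \<Rightarrow> nat) set" where
  "multi_idx N = {\<alpha>. sum \<alpha> UNIV \<le> N}"

definition xpow :: "real^'n \<Rightarrow> ('n::finite \<Rightarrow> nat) \<Rightarrow> real" where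
  "xpow x \<alpha> = (\<Prod>i\<in>UNIV. (x $ i) ^ (\<alpha> i))"

definition has_pderivX :: "(nat \<Rightarrow> 'b::real_normed_vector \<Rightarrow> real) \<Rightarrow> 'n::finite \<Rightarrow>
    (real^'n \<Rightarrow> 'b) \<Rightarrow> (real^'n \<Rightarrow> 'b) \<Rightarrow> bool" where
  "has_pderivX nrm i F G \<longleftrightarrow>
     (\<forall>M x. ((\<lambda>h. nrm M (scaleR (1 / h) (F (x + h *\<^sub>R axis i 1) - F x) - G x)) \<longlongrightarrow> 0) (at 0))"

definition derivs_ok :: "(nat \<Rightarrow> 'b::real_normed_vector set) \<Rightarrow> (nat \<Rightarrow> 'b \<Rightarrow> real) \<Rightarrow>
    (real^'n::finite \<Rightarrow> 'b) \<Rightarrow> (('n \<Rightarrow> nat) \<Rightarrow> real^'n \<Rightarrow> 'b) \<Rightarrow> bool" where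
  "derivs_ok Xs nrm f D \<longleftrightarrow>
     D (\<lambda>_. 0) = f \<and> (\<forall>\<beta> x. D \<beta> x \<in> Xint Xs) \<and>
     (\<forall>\<beta> i. has_pderivX nrm i (D \<beta>) (D (\<beta>(i := Suc (\<beta> i)))))"

definition DX :: "(nat \<Rightarrow> 'b::real_normed_vector set) \<Rightarrow> (nat \<Rightarrow> 'b \<Rightarrow> real) \<Rightarrow>
    (real^'n::finite \<Rightarrow> 'b) \<Rightarrow> ('n \<Rightarrow> nat) \<Rightarrow> real^'n \<Rightarrow> 'b" where
  "DX Xs nrm f = (SOME D. derivs_ok Xs nrm f D)"

definition schwartzX :: "(nat \<Rightarrow> 'b::real_normed_vector set) \<Rightarrow> (nat \<Rightarrow> 'b \<Rightarrow> real) \<Rightarrow>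
    (real^'n::finite \<Rightarrow> 'b) \<Rightarrow> bool" where
  "schwartzX Xs nrm f \<longleftrightarrow>
     (\<exists>D. derivs_ok Xs nrm f D) \<and>
     (\<forall>M \<alpha> \<beta>. integrable lborel (\<lambda>x. (nrm M (xpow x \<alpha> *\<^sub>R DX Xs nrm f \<beta> x))\<^sup>2))"

definition snormX :: "(nat \<Rightarrow> 'b::real_normed_vector set) \<Rightarrow> (nat \<Rightarrow> 'b \<Rightarrow> real) \<Rightarrow>
    nat \<Rightarrow> nat \<Rightarrow> (real^'n::finite \<Rightarrow> 'b) \<Rightarrow> real" where
  "snormX Xs nrm M N f =
     sqrt (\<Sum>\<alpha>\<in>multi_idx N. \<Sum>\<beta>\<in>multi_idx N.
             \<integral>x. (nrm M (xpow x \<alpha> *\<^sub>R DX Xs nrm f \<beta> x))\<^sup>2 \<partial>lborel)"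

definition tdistX :: "(nat \<Rightarrow> 'b::real_normed_vector set) \<Rightarrow> (nat \<Rightarrow> 'b \<Rightarrow> real) \<Rightarrow> ('b \<Rightarrow> 'b) \<Rightarrow>
    ((real^'n::finite \<Rightarrow> 'b) \<Rightarrow> complex) \<Rightarrow> bool" where
  "tdistX Xs nrm J \<Phi> \<longleftrightarrow>
     (\<forall>f g. schwartzX Xs nrm f \<longrightarrow> schwartzX Xs nrm g \<longrightarrow> \<Phi> (\<lambda>x. f x + g x) = \<Phi> f + \<Phi> g) \<and>
     (\<forall>c f. schwartzX Xs nrm f \<longrightarrow> \<Phi> (\<lambda>x. cscale J c (f x)) = c * \<Phi> f) \<and>
     (\<exists>M N c. \<forall>f. schwartzX Xs nrm f \<longrightarrow> norm (\<Phi> f) \<le> c * snormX Xs nrm M N f)"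

definition dualX :: "(nat \<Rightarrow> 'b::real_normed_vector set) \<Rightarrow> (nat \<Rightarrow> 'b \<Rightarrow> real) \<Rightarrow> ('b \<Rightarrow> 'b) \<Rightarrow>
    ('b \<Rightarrow> complex) \<Rightarrow> bool" where
  "dualX Xs nrm J C \<longleftrightarrow>
     (\<forall>x\<in>Xint Xs. \<forall>y\<in>Xint Xs. C (x + y) = C x + C y) \<and>
     (\<forall>c. \<forall>x\<in>Xint Xs. C (cscale J c x) = c * C x) \<and>
     (\<exists>M c. \<forall>x\<in>Xint Xs. norm (C x) \<le> c * nrm M x)"

text \<open>Fourier transform of an X-valued function (integral taken in the ambient Banach space).\<close>
definition fourierX :: "('b::real_normed_vector \<Rightarrow> 'b) \<Rightarrow> (real^'n::finite \<Rightarrow> 'b) \<Rightarrow> real^'n \<Rightarrow> 'b" where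
  "fourierX J f = (\<lambda>\<xi>. integral UNIV (\<lambda>x. cscale J (cis (- 2 * pi * (\<xi> \<bullet> x))) (f x)))"

end

theory Submission
  imports Defs "HOL-Probability.Probability" "HOL-Complex_Analysis.Conformal_Mappings"
begin

text \<open>
  For fixed \<open>v\<close> the function \<open>F z = \<Phi> (exp (z \<bullet> x - \<pi> t |x|\<^sup>2) v)\<close> is entire in each
  variable. Representing it once through \<open>\<Psi>1\<close> and once, by Fourier duality, through \<open>\<Psi>2\<close> shows
  that \<open>G z = F z * exp (- z\<^sup>2 / (8 \<pi> t))\<close> is bounded by a polynomial times the exponential of
  \<open>min ((Re z)\<^sup>2) ((Im z)\<^sup>2) / (8 \<pi> t)\<close>; by Phragmen-Lindelof and Liouville it is a polynomial
  whose degree does not depend on \<open>v\<close>. Lagrange interpolation expresses its coefficients as linear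
  combinations of values of \<open>F\<close>, hence as elements of \<open>X'\<close>, and these define the \<open>C \<alpha>\<close>. The
  difference of the two sides then annihilates all Gaussians of one fixed width, by analyticity in the
  width all Gaussians, and finally every Schwartz function, because vector-valued Schwartz functions
  are approximated by sums of narrow Gaussians with vector coefficients, one coordinate at a time.
\<close>

section \<open>Calculus for the norms of a Frechet family\<close>

text \<open>Pairing with Gaussians of parameter \<open>pi * t\<close> is a transform of Bargmann
  type: its behaviour along real directions reflects the decay of \<open>\<Phi>\<close>, and along
  imaginary directions that of the Fourier transform. Both hypotheses lead to the same constant
  \<open>1 / (8 * pi * t)\<close>. The minimum of the two quadratic exponents vanishes on the axes
  but has order 2 inside each quadrant, whose opening is exactly critical for order 2; this
  borderline case shapes the Phragmen-Lindelof argument. The degree is uniform in \<open>v\<close>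
  because it comes from the orders of continuity of \<open>\<Psi>1\<close> and
  \<open>\<Psi>2\<close>, while \<open>v\<close> enters only through a norm. Estimates are made in
  each variable separately, so the degree is at most \<open>P\<close> in each variable and the total
  degree at most \<open>P\<close> times the dimension. The norms \<open>nrm M\<close> live on
  subspaces of one Banach space; calculus in \<open>X\<close> is therefore done for each norm by
  difference quotients, and convolution with a narrow Gaussian is replaced by finite Riemann sums,
  on which a functional is evaluated term by term.\<close>

locale frechet =
  fixes Xs :: "nat \<Rightarrow> 'b::{real_normed_vector,banach} set"
    and nrm :: "nat \<Rightarrow> 'b \<Rightarrow> real"
    and J :: "'b \<Rightarrow> 'b"
  assumes family: "frechet_family Xs nrm J"
begin

abbreviation X :: "'b set" where "X \<equiv> Xint Xs"

abbreviation cs :: "complex \<Rightarrow> 'b \<Rightarrow> 'b" where "cs \<equiv> cscale J"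

lemma linear_J: "linear J" and J_J: "J (J x) = - x"
  using family by (auto simp: frechet_family_def complex_banach_structure_def)

lemma cs_add_left: "cs (c + d) x = cs c x + cs d x"
  by (simp add: cscale_def algebra_simps)

lemma cs_add_right: "cs c (x + y) = cs c x + cs c y"
  by (simp add: cscale_def linear_add[OF linear_J] algebra_simps)

lemma cs_mult: "cs (c * d) x = cs c (cs d x)"
proof -
  have "J (cs d x) = Re d *\<^sub>R J x - Im d *\<^sub>R x"
    by (simp add: cscale_def linear_add[OF linear_J] linear_cmul[OF linear_J] J_J)
  then show ?thesis
    by (simp add: cscale_def[of J c] cscale_def[of J "c * d"])
       (simp add: cscale_def algebra_simps)
qed

lemma cs_of_real: "cs (complex_of_real r) x = r *\<^sub>R x"
  by (simp add: cscale_def)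

lemma cs_scaleR: "cs c (r *\<^sub>R x) = r *\<^sub>R cs c x" and cs_scaleR_left: "cs (r *\<^sub>R c) x = r *\<^sub>R cs c x"
  by (simp_all add: cscale_def linear_cmul[OF linear_J] algebra_simps)

lemma cs_of_real_mult: "cs (complex_of_real r * c) x = r *\<^sub>R cs c x"
  by (simp add: cs_mult cs_of_real)

lemma cs_one [simp]: "cs 1 x = x" and cs_zero_left [simp]: "cs 0 x = 0"
  and cs_zero_right [simp]: "cs c 0 = 0"
  by (simp_all add: cscale_def linear_0[OF linear_J])

lemma cs_minus_left: "cs (- c) x = - cs c x"
  by (simp add: cscale_def)

lemma cs_diff_left: "cs (c - d) x = cs c x - cs d x"
  by (simp add: cscale_def algebra_simps)

lemma cs_diff_right: "cs c (x - y) = cs c x - cs c y"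
  by (simp add: cscale_def linear_diff[OF linear_J] algebra_simps)

lemma Xs_zero: "0 \<in> Xs M" and Xs_add: "x \<in> Xs M \<Longrightarrow> y \<in> Xs M \<Longrightarrow> x + y \<in> Xs M"
  and Xs_cs: "x \<in> Xs M \<Longrightarrow> cs c x \<in> Xs M"
  using family by (auto simp: frechet_family_def)

lemma X_zero [simp, intro]: "0 \<in> X"
  by (simp add: Xint_def Xs_zero)

lemma X_add [intro]: "x \<in> X \<Longrightarrow> y \<in> X \<Longrightarrow> x + y \<in> X"
  by (simp add: Xint_def Xs_add)

lemma X_cs [intro]: "x \<in> X \<Longrightarrow> cs c x \<in> X"
  by (simp add: Xint_def Xs_cs)

lemma X_scaleR [intro]: "x \<in> X \<Longrightarrow> r *\<^sub>R x \<in> X"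
  using X_cs[of x "complex_of_real r"] by (simp add: cs_of_real)

lemma X_minus [intro]: "x \<in> X \<Longrightarrow> - x \<in> X"
  using X_scaleR[of x "-1"] by simp

lemma X_diff [intro]: "x \<in> X \<Longrightarrow> y \<in> X \<Longrightarrow> x - y \<in> X"
  using X_add[of x "- y"] by auto

lemma X_sum [intro]: "(\<And>i. i \<in> A \<Longrightarrow> f i \<in> X) \<Longrightarrow> sum f A \<in> X"
  by (induction A rule: infinite_finite_induct) auto

lemma X_Xs: "x \<in> X \<Longrightarrow> x \<in> Xs M"
  by (simp add: Xint_def)

lemma nrm_nonneg [simp]: "x \<in> X \<Longrightarrow> 0 \<le> nrm M x"
  using family by (auto simp: frechet_family_def dest: X_Xs[of x M])

lemma nrm_eq_0 [simp]: "x \<in> X \<Longrightarrow> nrm M x = 0 \<longleftrightarrow> x = 0"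
  using family by (auto simp: frechet_family_def dest: X_Xs[of x M])

lemma nrm_zero [simp]: "nrm M 0 = 0"
  using nrm_eq_0 by blast

lemma nrm_add: "x \<in> X \<Longrightarrow> y \<in> X \<Longrightarrow> nrm M (x + y) \<le> nrm M x + nrm M y"
  using family X_Xs[of x M] X_Xs[of y M] unfolding frechet_family_def by blast

lemma nrm_cs: "x \<in> X \<Longrightarrow> nrm M (cs c x) = norm c * nrm M x"
  using family X_Xs[of x M] unfolding frechet_family_def by blast

lemma nrm_scaleR: "x \<in> X \<Longrightarrow> nrm M (r *\<^sub>R x) = \<bar>r\<bar> * nrm M x"
  using nrm_cs[of x M "complex_of_real r"] by (simp add: cs_of_real)

lemma nrm_minus: "x \<in> X \<Longrightarrow> nrm M (- x) = nrm M x"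
  using nrm_scaleR[of x M "-1"] by simp

lemma nrm_minus_commute: "x \<in> X \<Longrightarrow> y \<in> X \<Longrightarrow> nrm M (x - y) = nrm M (y - x)"
  using nrm_minus[of "x - y" M] by (simp add: X_diff)

lemma nrm_diff: "x \<in> X \<Longrightarrow> y \<in> X \<Longrightarrow> nrm M (x - y) \<le> nrm M x + nrm M y"
  using nrm_add[of x "- y" M] by (simp add: X_minus nrm_minus)

lemma nrm_triangle: "x \<in> X \<Longrightarrow> y \<in> X \<Longrightarrow> z \<in> X \<Longrightarrow> nrm M (x - z) \<le> nrm M (x - y) + nrm M (y - z)"
  using nrm_add[of "x - y" "y - z" M] by (simp add: X_diff)

lemma nrm_diff_abs: "x \<in> X \<Longrightarrow> y \<in> X \<Longrightarrow> \<bar>nrm M x - nrm M y\<bar> \<le> nrm M (x - y)"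
  using nrm_triangle[of x y 0 M] nrm_triangle[of y x 0 M] nrm_minus_commute[of x y M] by auto

lemma nrm_sum: "(\<And>i. i \<in> A \<Longrightarrow> f i \<in> X) \<Longrightarrow> nrm M (sum f A) \<le> (\<Sum>i\<in>A. nrm M (f i))"
proof (induction A rule: infinite_finite_induct)
  case (insert a A)
  then have "nrm M (f a + sum f A) \<le> nrm M (f a) + nrm M (sum f A)"
    by (intro nrm_add) auto
  also have "\<dots> \<le> nrm M (f a) + (\<Sum>i\<in>A. nrm M (f i))"
    using insert by auto
  finally show ?case using insert by simp
qed auto

text \<open>Differentiability is tied to a single norm \<open>nrm M\<close>: every later estimate
  uses one level of the family, and the derivative is an element prescribed in advance rather than a
  limit to be found.\<close>

definition vderiv :: "nat \<Rightarrow> (real \<Rightarrow> 'b) \<Rightarrow> 'b \<Rightarrow> real \<Rightarrow> bool" where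
  "vderiv M f d s \<longleftrightarrow> ((\<lambda>h. nrm M ((1 / h) *\<^sub>R (f (s + h) - f s) - d)) \<longlongrightarrow> 0) (at 0)"

text \<open>The quotient is multiplied out so that \<open>h = 0\<close> is included and increments
  to the left and to the right of \<open>s\<close> can be subtracted from each other, as the
  bisection argument requires.\<close>

lemma vderiv_straddle:
  assumes X: "\<And>s. f s \<in> X" "d \<in> X" and d: "vderiv M f d s" and e: "e > 0"
  shows "\<exists>\<delta>>0. \<forall>h. \<bar>h\<bar> < \<delta> \<longrightarrow> nrm M (f (s + h) - f s - h *\<^sub>R d) \<le> e * \<bar>h\<bar>"
proof -
  have "\<forall>\<^sub>F h in at 0. nrm M ((1 / h) *\<^sub>R (f (s + h) - f s) - d) < e"
    using d e unfolding vderiv_def by (rule order_tendstoD(2))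
  then obtain \<delta> where \<delta>: "\<delta> > 0"
    "\<And>h. h \<noteq> 0 \<Longrightarrow> \<bar>h\<bar> < \<delta> \<Longrightarrow> nrm M ((1 / h) *\<^sub>R (f (s + h) - f s) - d) < e"
    by (auto simp: eventually_at dist_real_def)
  show ?thesis
  proof (intro exI conjI allI impI)
    fix h :: real assume h: "\<bar>h\<bar> < \<delta>"
    show "nrm M (f (s + h) - f s - h *\<^sub>R d) \<le> e * \<bar>h\<bar>"
    proof (cases "h = 0")
      case False
      have "nrm M (f (s + h) - f s - h *\<^sub>R d) = nrm M (h *\<^sub>R ((1 / h) *\<^sub>R (f (s + h) - f s) - d))"
        using False by (simp add: algebra_simps)
      also have "\<dots> = \<bar>h\<bar> * nrm M ((1 / h) *\<^sub>R (f (s + h) - f s) - d)"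
        by (intro nrm_scaleR X_diff X_scaleR X)
      also have "\<dots> \<le> \<bar>h\<bar> * e"
        using \<delta>(2)[OF False h] by (intro mult_left_mono) auto
      finally show ?thesis by (simp add: mult.commute)
    qed simp
  qed fact
qed

lemma vderiv_cont:
  assumes X: "\<And>s. f s \<in> X" "d \<in> X" and d: "vderiv M f d s"
  shows "((\<lambda>h. nrm M (f (s + h) - f s)) \<longlongrightarrow> 0) (at 0)"
proof -
  obtain \<delta> where \<delta>: "\<delta> > 0" "\<And>h. \<bar>h\<bar> < \<delta> \<Longrightarrow> nrm M (f (s + h) - f s - h *\<^sub>R d) \<le> 1 * \<bar>h\<bar>"
    using vderiv_straddle[OF X d, of 1] by auto
  show ?thesis
  proof (rule Lim_null_comparison)
    show "\<forall>\<^sub>F h in at 0. norm (nrm M (f (s + h) - f s)) \<le> \<bar>h\<bar> * (1 + nrm M d)"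
      unfolding eventually_at
    proof (intro exI[of _ \<delta>] conjI ballI impI \<delta>)
      fix h :: real assume "h \<noteq> 0 \<and> dist h 0 < \<delta>"
      then have "nrm M (f (s + h) - f s - h *\<^sub>R d) \<le> \<bar>h\<bar>" using \<delta>(2)[of h] by simp
      moreover have "nrm M (f (s + h) - f s) \<le> nrm M (f (s + h) - f s - h *\<^sub>R d) + nrm M (h *\<^sub>R d)"
        using nrm_add[of "f (s + h) - f s - h *\<^sub>R d" "h *\<^sub>R d" M] by (simp add: X X_diff X_scaleR)
      ultimately show "norm (nrm M (f (s + h) - f s)) \<le> \<bar>h\<bar> * (1 + nrm M d)"
        using X by (simp add: nrm_scaleR algebra_simps X_diff)
    qed
    show "((\<lambda>h. \<bar>h\<bar> * (1 + nrm M d)) \<longlongrightarrow> 0) (at 0)"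
      by (rule tendsto_eq_intros refl | simp)+
  qed
qed

lemma vderiv_nrm_cont:
  assumes "\<And>s. f s \<in> X" "d \<in> X" "vderiv M f d s"
  shows "isCont (\<lambda>s. nrm M (f s)) s"
  unfolding isCont_iff
proof (rule LIM_zero_cancel, rule Lim_null_comparison)
  show "\<forall>\<^sub>F h in at 0. norm (nrm M (f (s + h)) - nrm M (f s)) \<le> nrm M (f (s + h) - f s)"
    using assms by (auto intro!: always_eventually nrm_diff_abs)
  show "((\<lambda>h. nrm M (f (s + h) - f s)) \<longlongrightarrow> 0) (at 0)"
    by (rule vderiv_cont) (use assms in auto)
qed

lemma vderiv_cs:
  assumes X: "\<And>s. f s \<in> X" "d \<in> X" and d: "vderiv M f d s"
    and \<phi>: "(\<phi> has_vector_derivative \<phi>') (at s)"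
  shows "vderiv M (\<lambda>s. cs (\<phi> s) (f s)) (cs \<phi>' (f s) + cs (\<phi> s) d) s"
  unfolding vderiv_def
proof (rule Lim_null_comparison)
  let ?Q = "\<lambda>h::real. (1 / h) *\<^sub>R (f (s + h) - f s) - d"
  let ?P = "\<lambda>h::real. (1 / h) *\<^sub>R (\<phi> (s + h) - \<phi> s) - \<phi>'"
  let ?R = "\<lambda>h::real. norm (\<phi> (s + h)) * nrm M (?Q h) + norm (?P h) * nrm M (f s) + norm (\<phi> (s + h) - \<phi> s) * nrm M d"
  have "norm (nrm M ((1 / h) *\<^sub>R (cs (\<phi> (s + h)) (f (s + h)) - cs (\<phi> s) (f s)) - (cs \<phi>' (f s) + cs (\<phi> s) d))) \<le> ?R h" for h
  proof -
    \<comment> \<open>The remainder of \<open>f\<close> gets the factor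
      \<open>\<phi> (s + h)\<close>, the remainder of \<open>\<phi>\<close> gets the fixed value
      \<open>f s\<close>, and the last term repairs the mismatch in front of \<open>d\<close>. Each
      piece is a bounded quantity times one that tends to 0.\<close>
    have eq: "(1 / h) *\<^sub>R (cs (\<phi> (s + h)) (f (s + h)) - cs (\<phi> s) (f s)) - (cs \<phi>' (f s) + cs (\<phi> s) d)
       = (cs (\<phi> (s + h)) (?Q h) + cs (?P h) (f s)) + cs (\<phi> (s + h) - \<phi> s) d"
    proof -
      have "r *\<^sub>R (cs a x - cs b y) - (cs c y + cs b d) = (cs a (r *\<^sub>R (x - y) - d) + cs (r *\<^sub>R (a - b) - c) y) + cs (a - b) d"
        for r a b c and x y d :: 'b
        by (simp add: cs_diff_left cs_diff_right cs_scaleR cs_scaleR_left scaleR_diff_right)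
      then show ?thesis .
    qed
    have Q: "?Q h \<in> X" using X by auto
    have 1: "nrm M (cs (\<phi> (s + h)) (?Q h) + cs (?P h) (f s)) \<le> nrm M (cs (\<phi> (s + h)) (?Q h)) + nrm M (cs (?P h) (f s))"
      by (rule nrm_add) (use Q X in auto)
    have 2: "nrm M ((cs (\<phi> (s + h)) (?Q h) + cs (?P h) (f s)) + cs (\<phi> (s + h) - \<phi> s) d)
      \<le> nrm M (cs (\<phi> (s + h)) (?Q h) + cs (?P h) (f s)) + nrm M (cs (\<phi> (s + h) - \<phi> s) d)"
      by (rule nrm_add) (use Q X in auto)
    have 3: "0 \<le> nrm M ((cs (\<phi> (s + h)) (?Q h) + cs (?P h) (f s)) + cs (\<phi> (s + h) - \<phi> s) d)"
      by (rule nrm_nonneg) (use Q X in auto)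
    show ?thesis unfolding eq real_norm_def abs_of_nonneg[OF 3]
      using 1 2 nrm_cs[OF Q] nrm_cs[OF X(1)] nrm_cs[OF X(2)] by simp
  qed
  then show "\<forall>\<^sub>F h in at 0. norm (nrm M ((1 / h) *\<^sub>R (cs (\<phi> (s + h)) (f (s + h)) - cs (\<phi> s) (f s)) - (cs \<phi>' (f s) + cs (\<phi> s) d))) \<le> ?R h"
    by (simp add: always_eventually)
  have c: "((\<lambda>h. \<phi> (s + h)) \<longlongrightarrow> \<phi> s) (at 0)"
    using has_vector_derivative_continuous[OF \<phi>] by (simp add: isCont_iff)
  have P: "(?P \<longlongrightarrow> 0) (at 0)"
  proof (rule tendsto_norm_zero_cancel)
    have "((\<lambda>h::real. norm (\<phi> (s + h) - \<phi> s - h *\<^sub>R \<phi>') / norm h) \<longlongrightarrow> 0) (at 0)"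
      using \<phi> unfolding has_vector_derivative_def has_derivative_at by blast
    then show "((\<lambda>h::real. norm (?P h)) \<longlongrightarrow> 0) (at 0)"
    proof (rule Lim_transform_eventually)
      have "norm (\<phi> (s + h) - \<phi> s - h *\<^sub>R \<phi>') / norm h = norm (?P h)" if "h \<noteq> 0" for h :: real
      proof -
        have "?P h = (1 / h) *\<^sub>R (\<phi> (s + h) - \<phi> s - h *\<^sub>R \<phi>')"
          using that by (simp add: algebra_simps)
        then show ?thesis by simp
      qed
      then show "\<forall>\<^sub>F h in at 0. norm (\<phi> (s + h) - \<phi> s - h *\<^sub>R \<phi>') / norm h = norm (?P h)"
        by (auto simp: eventually_at_filter)
    qed
  qed
  have "(?R \<longlongrightarrow> norm (\<phi> s) * 0 + 0 * nrm M (f s) + 0 * nrm M d) (at 0)"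
    using d[unfolded vderiv_def] tendsto_norm_zero[OF P] tendsto_norm_zero[OF LIM_zero[OF c]]
    by (intro tendsto_intros c) auto
  then show "(?R \<longlongrightarrow> 0) (at 0)" by simp
qed

lemma vderiv_add:
  assumes X: "\<And>s. f s \<in> X" "d \<in> X" "\<And>s. g s \<in> X" "e \<in> X" and d: "vderiv M f d s" "vderiv M g e s"
  shows "vderiv M (\<lambda>s. f s + g s) (d + e) s"
  unfolding vderiv_def
proof (rule Lim_null_comparison)
  let ?Q = "\<lambda>h::real. (1 / h) *\<^sub>R (f (s + h) - f s) - d"
  let ?P = "\<lambda>h::real. (1 / h) *\<^sub>R (g (s + h) - g s) - e"
  show "\<forall>\<^sub>F h in at 0. norm (nrm M ((1 / h) *\<^sub>R (f (s + h) + g (s + h) - (f s + g s)) - (d + e))) \<le> nrm M (?Q h) + nrm M (?P h)"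
  proof (rule always_eventually, rule allI)
    fix h
    have eq: "(1 / h) *\<^sub>R (f (s + h) + g (s + h) - (f s + g s)) - (d + e) = ?Q h + ?P h"
      by (simp add: algebra_simps)
    have "?Q h \<in> X" "?P h \<in> X" by (intro X_diff X_scaleR X)+
    then show "norm (nrm M ((1 / h) *\<^sub>R (f (s + h) + g (s + h) - (f s + g s)) - (d + e))) \<le> nrm M (?Q h) + nrm M (?P h)"
      unfolding eq using nrm_add nrm_nonneg[of "?Q h + ?P h" M] by (simp add: X_add)
  qed
  show "((\<lambda>h. nrm M (?Q h) + nrm M (?P h)) \<longlongrightarrow> 0) (at 0)"
    using tendsto_add[OF d[unfolded vderiv_def]] by simp
qed

lemma vderiv_const: "vderiv M (\<lambda>s. v) 0 s"
  by (simp add: vderiv_def)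

lemma vderiv_cs_const:
  assumes "v \<in> X" "(\<phi> has_vector_derivative \<phi>') (at s)"
  shows "vderiv M (\<lambda>s. cs (\<phi> s) v) (cs \<phi>' v) s"
  using vderiv_cs[OF _ _ vderiv_const assms(2), of v M] assms(1) by simp

text \<open>Bolzano's bisection replaces the mean value theorem, since the norms live on a
  subspace and not on a type.\<close>

lemma vderiv_mvt_integral:
  assumes X: "\<And>s. f s \<in> X" "\<And>s. g s \<in> X" and d: "\<And>s. vderiv M f (g s) s"
    and q: "continuous_on UNIV q" "\<And>s. u \<le> s \<Longrightarrow> s \<le> v \<Longrightarrow> nrm M (g s) \<le> q s" and uv: "u \<le> v"
  shows "nrm M (f v - f u) \<le> integral {u..v} q"
proof (rule field_le_epsilon)
  fix e :: real assume "e > 0"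
  \<comment> \<open>The summand 1 keeps the denominator positive when \<open>u = v\<close>.\<close>
  define e' where "e' = e / (v - u + 1)"
  have e': "e' > 0" using \<open>e > 0\<close> uv by (simp add: e'_def)
  have qi: "q integrable_on {a..b}" for a b
    by (intro integrable_continuous_interval continuous_on_subset[OF q(1)]) simp
  \<comment> \<open>The premise inside the bisected property confines the subintervals to
    \<open>{u..v}\<close>, where the bound by \<open>q\<close> is available.\<close>
  have "u \<le> u \<and> v \<le> v \<longrightarrow> nrm M (f v - f u) \<le> integral {u..v} q + e' * (v - u)"
    using uv
  proof (induction rule: Bolzano[where P = "\<lambda>a b. u \<le> a \<and> b \<le> v \<longrightarrow> nrm M (f b - f a) \<le> integral {a..b} q + e' * (b - a)"])
    case (trans a b c)
    show ?case
    proof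
      assume uv: "u \<le> a \<and> c \<le> v"
      have "nrm M (f c - f a) \<le> nrm M (f c - f b) + nrm M (f b - f a)"
        by (rule nrm_triangle) (auto intro: X)
      also have "integral {a..c} q = integral {a..b} q + integral {b..c} q"
        using trans by (intro Henstock_Kurzweil_Integration.integral_combine[symmetric] qi) auto
      ultimately show "nrm M (f c - f a) \<le> integral {a..c} q + e' * (c - a)"
        using trans uv by (auto simp: algebra_simps)
    qed
  next
    case (local x)
    obtain \<delta> where \<delta>: "\<delta> > 0" "\<And>h. \<bar>h\<bar> < \<delta> \<Longrightarrow> nrm M (f (x + h) - f x - h *\<^sub>R g x) \<le> (e'/2) * \<bar>h\<bar>"
      proof -
      have "e' / 2 > 0" using e' by simp
      from vderiv_straddle[OF X(1) X(2) d this, of x] show thesis using that by blast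
    qed
    have "isCont q x" using q(1) by (simp add: continuous_on_eq_continuous_at)
    then obtain \<delta>' where \<delta>': "\<delta>' > 0" "\<And>y. dist y x < \<delta>' \<Longrightarrow> dist (q y) (q x) < e'/2"
      using e' unfolding continuous_at_eps_delta by (metis half_gt_zero)
    show ?case
    proof (intro exI[of _ "min \<delta> \<delta>'"] conjI allI impI)
      fix a b assume ab: "a \<le> x \<and> x \<le> b \<and> b - a < min \<delta> \<delta>'" and uab: "u \<le> a \<and> b \<le> v"
      have 1: "nrm M (f b - f x - (b - x) *\<^sub>R g x) \<le> (e'/2) * (b - x)"
        using \<delta>(2)[of "b - x"] ab by simp
      have 2: "nrm M (f a - f x - (a - x) *\<^sub>R g x) \<le> (e'/2) * (x - a)"
        using \<delta>(2)[of "a - x"] ab by simp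
      \<comment> \<open>Both endpoints are compared with the linear approximation at the common
        point \<open>x\<close>: the two remainders together cost \<open>(e'/2) * (b - a)\<close>,
        and replacing \<open>q x\<close> by the mean of \<open>q\<close> costs the same
        again.\<close>
      have "nrm M (f b - f a) = nrm M (((f b - f x - (b - x) *\<^sub>R g x) - (f a - f x - (a - x) *\<^sub>R g x)) + (b - a) *\<^sub>R g x)"
        by (simp add: algebra_simps)
      also have "\<dots> \<le> nrm M ((f b - f x - (b - x) *\<^sub>R g x) - (f a - f x - (a - x) *\<^sub>R g x)) + nrm M ((b - a) *\<^sub>R g x)"
        by (intro nrm_add X_diff X_scaleR X)
      also have "nrm M ((f b - f x - (b - x) *\<^sub>R g x) - (f a - f x - (a - x) *\<^sub>R g x))
          \<le> nrm M (f b - f x - (b - x) *\<^sub>R g x) + nrm M (f a - f x - (a - x) *\<^sub>R g x)"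
        by (intro nrm_diff X_diff X_scaleR X)
      also have "nrm M ((b - a) *\<^sub>R g x) = (b - a) * nrm M (g x)"
        using ab by (simp add: nrm_scaleR X)
      also have "\<dots> \<le> (b - a) * q x"
        using ab uab by (intro mult_left_mono q(2)) auto
      also have "(b - a) * q x \<le> integral {a..b} q + (e'/2) * (b - a)"
      proof -
        have "integral {a..b} (\<lambda>_. q x - e'/2) \<le> integral {a..b} q"
        proof (rule integral_le[OF _ qi])
          show "q x - e'/2 \<le> q y" if "y \<in> {a..b}" for y
          proof -
            have "\<bar>q y - q x\<bar> < e'/2" using \<delta>'(2)[of y] that ab by (auto simp: dist_real_def)
            then show ?thesis by linarith
          qed
        qed (rule integrable_const_ivl)
        then show ?thesis using ab by (simp add: algebra_simps)
      qed
      finally have "nrm M (f b - f a) \<le> nrm M (f b - f x - (b - x) *\<^sub>R g x)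
          + nrm M (f a - f x - (a - x) *\<^sub>R g x) + (integral {a..b} q + (e'/2) * (b - a))" by simp
      moreover have "(e'/2) * (b - x) + (e'/2) * (x - a) + (e'/2) * (b - a) = e' * (b - a)"
        by (simp add: field_simps)
      ultimately show "nrm M (f b - f a) \<le> integral {a..b} q + e' * (b - a)"
        using 1 2 by linarith
    qed (use \<delta> \<delta>' in auto)
  qed
  then have "nrm M (f v - f u) \<le> integral {u..v} q + e' * (v - u)" by simp
  also have "e' * (v - u) \<le> e"
    using \<open>e > 0\<close> uv by (simp add: e'_def divide_simps mult_left_mono)
  finally show "nrm M (f v - f u) \<le> integral {u..v} q + e" by simp
qed

lemma vderiv_mvt:
  assumes X: "\<And>s. f s \<in> X" "\<And>s. g s \<in> X" and d: "\<And>s. vderiv M f (g s) s"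
    and q: "\<And>s. s \<in> closed_segment u v \<Longrightarrow> nrm M (g s) \<le> C"
  shows "nrm M (f v - f u) \<le> C * \<bar>v - u\<bar>"
proof (cases "u \<le> v")
  case True
  then have "nrm M (f v - f u) \<le> integral {u..v} (\<lambda>_. C)"
    using q by (intro vderiv_mvt_integral[OF X d]) (auto simp: closed_segment_eq_real_ivl)
  then show ?thesis using True by (simp add: mult.commute)
next
  case False
  then have "nrm M (f u - f v) \<le> integral {v..u} (\<lambda>_. C)"
    using q by (intro vderiv_mvt_integral[OF X d]) (auto simp: closed_segment_eq_real_ivl)
  then show ?thesis using False nrm_minus_commute[OF X(1) X(1), of M u v] by (simp add: mult.commute)
qed

text \<open>The mean value estimate is used twice: on \<open>f\<close> with its linear part at
  \<open>u\<close> removed, whose derivative is \<open>g s - g u\<close>, and on \<open>g\<close> to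
  bound that difference.\<close>

lemma vderiv_taylor2:
  assumes X: "\<And>s. f s \<in> X" "\<And>s. g s \<in> X" "\<And>s. g' s \<in> X"
    and d: "\<And>s. vderiv M f (g s) s" "\<And>s. vderiv M g (g' s) s"
    and q: "\<And>s. s \<in> closed_segment u v \<Longrightarrow> nrm M (g' s) \<le> C"
  shows "nrm M (f v - f u - (v - u) *\<^sub>R g u) \<le> C * (v - u)\<^sup>2"
proof -
  have C: "C \<ge> 0" using q[of u] nrm_nonneg[OF X(3), of M u] by fastforce
  let ?F = "\<lambda>s. f s + cs (complex_of_real (u - s)) (g u)"
  have F: "vderiv M ?F (g s - g u) s" for s
  proof -
    have "vderiv M ?F (g s + cs (- 1) (g u)) s"
      by (intro vderiv_add vderiv_cs_const X X_cs d)
         (auto intro!: derivative_eq_intros simp: has_vector_derivative_def fun_eq_iff scaleR_conv_of_real)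
    then show ?thesis by (simp add: cs_minus_left)
  qed
  have "nrm M (?F v - ?F u) \<le> (C * \<bar>v - u\<bar>) * \<bar>v - u\<bar>"
  proof (rule vderiv_mvt[OF _ _ F])
    fix s assume s: "s \<in> closed_segment u v"
    have "nrm M (g s - g u) \<le> C * \<bar>s - u\<bar>"
      by (rule vderiv_mvt[OF X(2,3) d(2)], rule q)
         (use s in \<open>auto simp: closed_segment_eq_real_ivl split: if_splits\<close>)
    also have "\<dots> \<le> C * \<bar>v - u\<bar>"
      using s C by (intro mult_left_mono) (auto simp: closed_segment_eq_real_ivl split: if_splits)
    finally show "nrm M (g s - g u) \<le> C * \<bar>v - u\<bar>" .
  qed (auto intro: X)
  also have "?F v - ?F u = f v - f u - (v - u) *\<^sub>R g u"
    unfolding cs_of_real by (simp add: algebra_simps)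
  finally show ?thesis by (simp add: power2_eq_square abs_mult[symmetric] mult.assoc)
qed

end

section \<open>Schwartz functions and weighted sup norms\<close>

lemma Basis_vec_real: "(Basis :: (real^'n::finite) set) = range (\<lambda>i. axis i 1)"
  by (auto simp: Basis_vec_def)

lemma borel_measurable_vecI:
  fixes f :: "'a \<Rightarrow> real^'n::finite"
  assumes "\<And>i. (\<lambda>x. f x $ i) \<in> borel_measurable M"
  shows "f \<in> borel_measurable M"
  using assms by (subst borel_measurable_euclidean_space) (auto simp: Basis_vec_real inner_axis)

text \<open>The measure is determined by its values on boxes, and a box pulls back to a product of
  intervals. This makes integrals of products of one-variable functions factor and lets estimates be
  iterated coordinate by coordinate.\<close>

lemma lborel_vec:
  "(lborel :: (real^'n::finite) measure) = distr (Pi\<^sub>M UNIV (\<lambda>_. lborel)) borel (\<lambda>f. \<chi> i. f i)"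
proof (rule lborel_eqI)
  interpret product_sigma_finite "\<lambda>_::'n. lborel :: real measure" by standard
  fix l u :: "real^'n" assume le: "\<And>b. b \<in> Basis \<Longrightarrow> l \<bullet> b \<le> u \<bullet> b"
  then have le': "l $ i \<le> u $ i" for i
    using le[of "axis i 1"] by (simp add: Basis_vec_real inner_axis)
  have m: "(\<lambda>f. \<chi> i. f i) \<in> measurable (Pi\<^sub>M UNIV (\<lambda>_::'n. lborel :: real measure)) borel"
    by (rule borel_measurable_vecI) simp
  have eq: "(\<lambda>f. \<chi> i. f i) -` box l u \<inter> space (Pi\<^sub>M UNIV (\<lambda>_::'n. lborel :: real measure))
      = Pi\<^sub>E UNIV (\<lambda>i. {l $ i <..< u $ i})"
    by (auto simp: mem_box Basis_vec_real inner_axis space_PiM PiE_def Pi_iff)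
  have inj: "inj_on (\<lambda>i. axis i (1::real) :: real^'n) UNIV"
    by (auto simp: inj_on_def axis_eq_axis)
  have "emeasure (distr (Pi\<^sub>M UNIV (\<lambda>_::'n. lborel :: real measure)) borel (\<lambda>f. \<chi> i. f i)) (box l u)
     = (\<Prod>i\<in>UNIV. ennreal (u $ i - l $ i))"
    using le' by (subst emeasure_distr[OF m]) (simp_all add: eq emeasure_PiM)
  also have "\<dots> = ennreal (\<Prod>i\<in>UNIV. u $ i - l $ i)"
    using le' by (intro prod_ennreal) (auto simp: less_imp_le)
  also have "(\<Prod>i\<in>UNIV. u $ i - l $ i) = (\<Prod>b\<in>Basis. (u - l) \<bullet> b)"
    unfolding Basis_vec_real by (subst prod.reindex[OF inj]) (simp add: inner_axis o_def)
  finally show "emeasure (distr (Pi\<^sub>M UNIV (\<lambda>_::'n. lborel :: real measure)) borel (\<lambda>f. \<chi> i. f i)) (box l u)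
     = ennreal (\<Prod>b\<in>Basis. (u - l) \<bullet> b)" by simp
qed simp

lemma measurable_vec_PiM [measurable]:
  "(\<lambda>f. \<chi> i. f i) \<in> measurable (Pi\<^sub>M UNIV (\<lambda>_::'n::finite. lborel :: real measure)) borel"
  by (rule borel_measurable_vecI) simp

lemma has_bochner_integral_prod_vec:
  fixes f :: "'n::finite \<Rightarrow> real \<Rightarrow> 'c::{real_normed_field,banach,second_countable_topology}"
  assumes "\<And>i. integrable lborel (f i)"
  shows "integrable lborel (\<lambda>x::real^'n. \<Prod>i\<in>UNIV. f i (x $ i))"
    and "(\<integral>x. (\<Prod>i\<in>UNIV. f i (x $ i)) \<partial>lborel) = (\<Prod>i\<in>UNIV. integral\<^sup>L lborel (f i))"
proof -
  interpret product_sigma_finite "\<lambda>_::'n. lborel :: real measure" by standard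
  have [measurable]: "f i \<in> borel_measurable borel" for i using assms[of i] by auto
  have m: "(\<lambda>x::real^'n. \<Prod>i\<in>UNIV. f i (x $ i)) \<in> borel_measurable borel" by measurable
  show "integrable lborel (\<lambda>x::real^'n. \<Prod>i\<in>UNIV. f i (x $ i))"
    unfolding lborel_vec using product_integrable_prod[of UNIV f] assms
    by (subst integrable_distr_eq[OF measurable_vec_PiM m]) simp
  show "(\<integral>x. (\<Prod>i\<in>UNIV. f i (x $ i)) \<partial>lborel) = (\<Prod>i\<in>UNIV. integral\<^sup>L lborel (f i))"
    unfolding lborel_vec using product_integral_prod[of UNIV f] assms
    by (subst integral_distr[OF measurable_vec_PiM m]) simp
qed

section \<open>Moving one coordinate, and polynomial weights\<close>

definition vupd :: "real^'n \<Rightarrow> 'n \<Rightarrow> real \<Rightarrow> real^'n::finite" where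
  "vupd x i s = (\<chi> j. if j = i then s else x $ j)"

lemma vupd_nth [simp]: "vupd x i s $ j = (if j = i then s else x $ j)"
  by (simp add: vupd_def)

lemma vupd_vupd [simp]: "vupd (vupd x i s) i r = vupd x i r"
  by (simp add: vec_eq_iff)

lemma vupd_id [simp]: "vupd x i (x $ i) = x"
  by (simp add: vec_eq_iff)

lemma vupd_commute: "i \<noteq> j \<Longrightarrow> vupd (vupd x i s) j r = vupd (vupd x j r) i s"
  by (simp add: vec_eq_iff)

lemma add_axis: "x + h *\<^sub>R axis i 1 = vupd x i (x $ i + h)"
  by (simp add: vec_eq_iff axis_def)

text \<open>The weight is a product over coordinates rather than a power of the norm, so that it
  factors exactly on tensor products and splits off any one distinguished coordinate.\<close>

definition W :: "nat \<Rightarrow> real^'n::finite \<Rightarrow> real" where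
  "W A x = (\<Prod>i\<in>UNIV. (1 + \<bar>x $ i\<bar>) ^ A)"

lemma W_pos [simp]: "0 < W A x" and W_nonneg [simp]: "0 \<le> W A x" and W_ge_1: "1 \<le> W A x"
  by (auto simp: W_def intro!: prod_pos prod_nonneg prod_ge_1 add_pos_nonneg)

lemma W_add: "W (A + B) x = W A x * W B x"
  by (simp add: W_def power_add prod.distrib)

lemma W_mono: "A \<le> B \<Longrightarrow> W A x \<le> W B x"
  using W_add[of A "B - A" x] W_ge_1[of "B - A" x] by simp

lemma one_plus_abs_add_le: "1 + \<bar>a + b\<bar> \<le> (1 + \<bar>a\<bar>) * (1 + \<bar>b\<bar>)" for a b :: real
proof -
  have "0 \<le> \<bar>a\<bar> * \<bar>b\<bar>" by simp
  moreover have "(1 + \<bar>a\<bar>) * (1 + \<bar>b\<bar>) = 1 + \<bar>a\<bar> + \<bar>b\<bar> + \<bar>a\<bar> * \<bar>b\<bar>" by (simp add: algebra_simps)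
  ultimately show ?thesis using abs_triangle_ineq[of a b] by linarith
qed

text \<open>Peetre's inequality, which for this weight reduces to one scalar inequality per
  coordinate.\<close>

lemma W_peetre: "W A (x + y) \<le> W A x * W A y"
  unfolding W_def prod.distrib[symmetric] power_mult_distrib[symmetric]
  by (intro prod_mono conjI power_mono) (auto simp: one_plus_abs_add_le)

lemma W_minus [simp]: "W A (- x) = W A x"
  by (simp add: W_def)

lemma xpow_le_W:
  assumes "\<alpha> \<in> multi_idx N"
  shows "\<bar>xpow x \<alpha>\<bar> \<le> W N x"
  unfolding xpow_def W_def abs_prod
proof (intro prod_mono conjI)
  fix i
  have "\<alpha> i \<le> N" using assms member_le_sum[of i UNIV \<alpha>] by (simp add: multi_idx_def)
  have "\<bar>(x $ i) ^ \<alpha> i\<bar> \<le> (1 + \<bar>x $ i\<bar>) ^ \<alpha> i"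
    unfolding power_abs by (intro power_mono) auto
  also have "\<dots> \<le> (1 + \<bar>x $ i\<bar>) ^ N"
    using \<open>\<alpha> i \<le> N\<close> by (intro power_increasing) auto
  finally show "\<bar>(x $ i) ^ \<alpha> i\<bar> \<le> (1 + \<bar>x $ i\<bar>) ^ N" .
qed auto

lemma finite_multi_idx [simp]: "finite (multi_idx N :: ('n::finite \<Rightarrow> nat) set)"
proof (rule finite_subset)
  show "multi_idx N \<subseteq> (PiE UNIV (\<lambda>_. {..N}) :: ('n \<Rightarrow> nat) set)"
  proof
    fix \<alpha> :: "'n \<Rightarrow> nat" assume "\<alpha> \<in> multi_idx N"
    then have "\<alpha> i \<le> N" for i
      using member_le_sum[of i UNIV \<alpha>] by (simp add: multi_idx_def)
    then show "\<alpha> \<in> PiE UNIV (\<lambda>_. {..N})" by auto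
  qed
qed (intro finite_PiE, auto)

lemma integrable_inverse_one_plus_abs_sq: "integrable lborel (\<lambda>x::real. inverse ((1 + \<bar>x\<bar>)\<^sup>2))"
proof (rule Bochner_Integration.integrable_bound)
  show "integrable lborel (\<lambda>x::real. inverse (1 + x\<^sup>2))"
    using integrable_inverse_1_plus_square by (simp add: set_integrable_def)
  show "AE x in lborel. norm (inverse ((1 + \<bar>x::real\<bar>)\<^sup>2)) \<le> norm (inverse (1 + x\<^sup>2))"
  proof (intro AE_I2)
    fix x :: real
    have "inverse ((1 + \<bar>x\<bar>)\<^sup>2) \<le> inverse (1 + x\<^sup>2)"
      by (rule le_imp_inverse_le) (simp_all add: power2_sum add_pos_nonneg)
    then show "norm (inverse ((1 + \<bar>x\<bar>)\<^sup>2)) \<le> norm (inverse (1 + x\<^sup>2))" by simp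
  qed
qed simp

lemma integrable_inverse_W: "integrable lborel (\<lambda>x::real^'n::finite. inverse ((W 1 x)\<^sup>2))"
proof -
  have "(\<lambda>x::real^'n. inverse ((W 1 x)\<^sup>2)) = (\<lambda>x. \<Prod>i\<in>UNIV. inverse ((1 + \<bar>x $ i\<bar>)\<^sup>2))"
    by (simp add: W_def fun_eq_iff prod_power_distrib prod_inversef[symmetric])
  then show ?thesis
    using has_bochner_integral_prod_vec(1)[OF integrable_inverse_one_plus_abs_sq] by metis
qed

lemma W_measurable [measurable]: "W A \<in> borel_measurable borel"
  unfolding W_def[abs_def] by measurable

section \<open>Families of partial derivatives, and quadratic against weighted sup seminorms\<close>

context frechet
begin

text \<open>Replacing the base point \<open>x\<close> by \<open>vupd x i s\<close> turns a partial
  derivative at all points into an ordinary derivative at all parameters along each axis-parallel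
  line.\<close>

lemma has_pderivX_vupd:
  "has_pderivX nrm i F G \<longleftrightarrow> (\<forall>M x s. vderiv M (\<lambda>s. F (vupd x i s)) (G (vupd x i s)) s)"
proof -
  have "has_pderivX nrm i F G \<longleftrightarrow> (\<forall>M x. vderiv M (\<lambda>s. F (vupd x i s)) (G x) (x $ i))"
    by (simp add: has_pderivX_def vderiv_def add_axis)
  also have "\<dots> \<longleftrightarrow> (\<forall>M x s. vderiv M (\<lambda>s. F (vupd x i s)) (G (vupd x i s)) s)"
  proof safe
    fix M x s assume "\<forall>M x. vderiv M (\<lambda>s. F (vupd x i s)) (G x) (x $ i)"
    from this[rule_format, of M "vupd x i s"]
    show "vderiv M (\<lambda>s. F (vupd x i s)) (G (vupd x i s)) s" by simp
  next
    fix M x assume "\<forall>M x s. vderiv M (\<lambda>s. F (vupd x i s)) (G (vupd x i s)) s"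
    from this[rule_format, of M x "x $ i"]
    show "vderiv M (\<lambda>s. F (vupd x i s)) (G x) (x $ i)" by simp
  qed
  finally show ?thesis .
qed

lemma vderiv_unique:
  assumes "\<And>s. f s \<in> X" "d \<in> X" "d' \<in> X" "vderiv M f d s" "vderiv M f d' s"
  shows "d = d'"
proof -
  let ?Q = "\<lambda>h::real. (1 / h) *\<^sub>R (f (s + h) - f s)"
  have "((\<lambda>h. nrm M (?Q h - d) + nrm M (?Q h - d')) \<longlongrightarrow> 0 + 0) (at 0)"
    using assms(4,5) unfolding vderiv_def by (rule tendsto_add)
  moreover have "nrm M (d - d') \<le> nrm M (?Q h - d) + nrm M (?Q h - d')" for h
    using nrm_triangle[of d "?Q h" d' M] nrm_minus_commute[of d "?Q h" M] assms(1-3) by auto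
  ultimately have "nrm M (d - d') \<le> 0 + 0"
    by (intro tendsto_lowerbound[where F = "at (0::real)"]) (auto intro: always_eventually)
  then have "nrm M (d - d') = 0" using nrm_nonneg[OF X_diff[OF assms(2,3)], of M] by simp
  then show ?thesis using X_diff[OF assms(2,3)] by simp
qed

lemma derivs_okD:
  assumes "derivs_ok Xs nrm f D"
  shows "D (\<lambda>_. 0) = f" "D \<beta> x \<in> X" "vderiv M (\<lambda>s. D \<beta> (vupd x i s)) (D (\<beta>(i := Suc (\<beta> i))) (vupd x i s)) s"
  using assms by (auto simp: derivs_ok_def has_pderivX_vupd)

lemma derivs_okI:
  assumes "D (\<lambda>_. 0) = f" "\<And>\<beta> x. D \<beta> x \<in> X"
    "\<And>M \<beta> i x s. vderiv M (\<lambda>s. D \<beta> (vupd x i s)) (D (\<beta>(i := Suc (\<beta> i))) (vupd x i s)) s"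
  shows "derivs_ok Xs nrm f D"
  using assms by (auto simp: derivs_ok_def has_pderivX_vupd)

text \<open>Induction on the order of \<open>\<beta>\<close>: a derivative of positive order is a
  partial derivative of one of lower order, and limits in \<open>nrm 0\<close> are unique. Hence the
  family that \<open>DX\<close> picks by choice agrees with any explicitly constructed one.\<close>

lemma derivs_ok_unique:
  fixes f :: "real^'n::finite \<Rightarrow> 'b"
  assumes D: "derivs_ok Xs nrm f D" and D': "derivs_ok Xs nrm f D'"
  shows "D = D'"
proof
  fix \<beta> :: "'n \<Rightarrow> nat"
  show "D \<beta> = D' \<beta>"
  proof (induction "sum \<beta> UNIV" arbitrary: \<beta>)
    case 0
    then have "\<beta> = (\<lambda>_. 0)" by auto
    then show ?case using derivs_okD(1)[OF D] derivs_okD(1)[OF D'] by simp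
  next
    case (Suc n)
    then have "sum \<beta> UNIV \<noteq> 0" by linarith
    then obtain i where "\<beta> i \<noteq> 0" by (rule sum.not_neutral_contains_not_neutral)
    then have i: "\<beta> i > 0" by simp
    define \<gamma> where "\<gamma> = \<beta>(i := \<beta> i - 1)"
    have \<beta>: "\<beta> = \<gamma>(i := Suc (\<gamma> i))" using i by (auto simp: \<gamma>_def)
    have "sum \<beta> UNIV = Suc (sum \<gamma> UNIV)"
      unfolding \<beta> by (subst (1 2) sum.remove[of _ i]) auto
    then have eq: "D \<gamma> = D' \<gamma>" using Suc by simp
    show ?case
    proof
      fix x
      show "D \<beta> x = D' \<beta> x"
      proof (rule vderiv_unique)
        show "vderiv 0 (\<lambda>s. D \<gamma> (vupd x i s)) (D \<beta> x) (x $ i)"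
          using derivs_okD(3)[OF D, of 0 \<gamma> x i "x $ i"] by (simp add: \<beta>[symmetric])
        show "vderiv 0 (\<lambda>s. D \<gamma> (vupd x i s)) (D' \<beta> x) (x $ i)"
          using derivs_okD(3)[OF D', of 0 \<gamma> x i "x $ i"] by (simp add: \<beta>[symmetric] eq)
      qed (use derivs_okD(2)[OF D] derivs_okD(2)[OF D'] in auto)
    qed
  qed
qed

lemma DX_eq: "derivs_ok Xs nrm f D \<Longrightarrow> DX Xs nrm f = D"
  unfolding DX_def by (metis derivs_ok_unique someI_ex)

definition rapid :: "(('n \<Rightarrow> nat) \<Rightarrow> real^'n::finite \<Rightarrow> 'b) \<Rightarrow> bool" where
  "rapid D \<longleftrightarrow> (\<forall>M A \<beta>. \<exists>C. \<forall>x. W A x * nrm M (D \<beta> x) \<le> C)"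

text \<open>One point is turned into the other by changing one coordinate at a time, with the
  one-variable mean value estimate at each change; the induction runs over a set of coordinates in
  which the points may differ.\<close>

lemma pderiv_lipschitz:
  fixes F :: "real^'n::finite \<Rightarrow> 'b"
  assumes X: "\<And>x. F x \<in> X" "\<And>i x. G i x \<in> X"
    and d: "\<And>i x s. vderiv M (\<lambda>s. F (vupd x i s)) (G i (vupd x i s)) s"
    and C: "\<And>i x. nrm M (G i x) \<le> C"
  shows "nrm M (F x - F y) \<le> C * (\<Sum>i\<in>UNIV. \<bar>x $ i - y $ i\<bar>)"
proof -
  have "nrm M (F x - F y) \<le> C * (\<Sum>i\<in>I. \<bar>x $ i - y $ i\<bar>)"
    if "finite I" "\<And>i. i \<notin> I \<Longrightarrow> x $ i = y $ i" for I x y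
    using that
  proof (induction I arbitrary: y rule: finite_induct)
    case empty
    then have "x = y" by (simp add: vec_eq_iff)
    then show ?case by simp
  next
    case (insert i I)
    define z where "z = vupd y i (x $ i)"
    have 1: "nrm M (F x - F z) \<le> C * (\<Sum>j\<in>I. \<bar>x $ j - z $ j\<bar>)"
      using insert by (intro insert) (auto simp: z_def)
    have "nrm M (F (vupd y i (x $ i)) - F (vupd y i (y $ i))) \<le> C * \<bar>x $ i - y $ i\<bar>"
      by (rule vderiv_mvt[OF _ _ d]) (auto intro: X C)
    then have 2: "nrm M (F z - F y) \<le> C * \<bar>x $ i - y $ i\<bar>" by (simp add: z_def)
    have "(\<Sum>j\<in>I. \<bar>x $ j - z $ j\<bar>) = (\<Sum>j\<in>I. \<bar>x $ j - y $ j\<bar>)"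
      using insert by (intro sum.cong) (auto simp: z_def)
    with 1 2 show ?case
      using nrm_triangle[of "F x" "F z" "F y" M] X insert by (simp add: algebra_simps)
  qed
  from this[of UNIV] show ?thesis by simp
qed

lemma rapid_continuous:
  fixes D :: "('n \<Rightarrow> nat) \<Rightarrow> real^'n::finite \<Rightarrow> 'b"
  assumes D: "derivs_ok Xs nrm f D" and r: "rapid D"
  shows "\<exists>C\<ge>0. \<forall>x y. nrm M (D \<beta> x - D \<beta> y) \<le> C * (\<Sum>i\<in>UNIV. \<bar>x $ i - y $ i\<bar>)"
proof -
  have "\<forall>i. \<exists>C. \<forall>x. W 0 x * nrm M (D (\<beta>(i := Suc (\<beta> i))) x) \<le> C"
    using r by (simp add: rapid_def)
  then obtain C where C: "\<And>i x. nrm M (D (\<beta>(i := Suc (\<beta> i))) x) \<le> C i"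
    by (auto simp: W_def dest!: choice)
  have C0: "C i \<ge> 0" for i
    using C[of i 0] nrm_nonneg[OF derivs_okD(2)[OF D], of M "\<beta>(i := Suc (\<beta> i))" 0] by linarith
  have "nrm M (D (\<beta>(i := Suc (\<beta> i))) x) \<le> sum C UNIV" for i x
  proof -
    have "C i \<le> sum C UNIV" using C0 by (intro member_le_sum) auto
    then show ?thesis using C[of i x] by linarith
  qed
  then have "nrm M (D \<beta> x - D \<beta> y) \<le> sum C UNIV * (\<Sum>i\<in>UNIV. \<bar>x $ i - y $ i\<bar>)" for x y
    by (intro pderiv_lipschitz[where G = "\<lambda>i. D (\<beta>(i := Suc (\<beta> i)))"] derivs_okD[OF D])
  moreover have "sum C UNIV \<ge> 0" using C0 by (simp add: sum_nonneg)
  ultimately show ?thesis by blast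
qed

lemma continuous_of_lipschitz:
  fixes F :: "real^'n::finite \<Rightarrow> 'c::real_normed_vector"
  assumes "\<And>x y. norm (F x - F y) \<le> C * (\<Sum>i\<in>UNIV. \<bar>x $ i - y $ i\<bar>)"
  shows "continuous_on UNIV F"
proof (intro continuous_at_imp_continuous_on ballI)
  fix x :: "real^'n"
  have "((\<lambda>y. F x - F y) \<longlongrightarrow> 0) (at x)"
  proof (rule Lim_null_comparison)
    show "\<forall>\<^sub>F y in at x. norm (F x - F y) \<le> C * (\<Sum>i\<in>UNIV. \<bar>x $ i - y $ i\<bar>)"
      using assms by simp
    show "((\<lambda>y. C * (\<Sum>i\<in>UNIV. \<bar>x $ i - y $ i\<bar>)) \<longlongrightarrow> 0) (at x)"
      by (rule tendsto_eq_intros refl | simp)+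
  qed
  then have "((\<lambda>y. F x - (F x - F y)) \<longlongrightarrow> F x - 0) (at x)" by (intro tendsto_diff tendsto_const)
  then show "isCont F x" by (simp add: isCont_def)
qed

lemma rapid_measurable:
  fixes D :: "('n \<Rightarrow> nat) \<Rightarrow> real^'n::finite \<Rightarrow> 'b"
  assumes D: "derivs_ok Xs nrm f D" and r: "rapid D"
  shows "(\<lambda>x. nrm M (D \<beta> x)) \<in> borel_measurable borel"
proof -
  obtain C where C: "\<And>x y. nrm M (D \<beta> x - D \<beta> y) \<le> C * (\<Sum>i\<in>UNIV. \<bar>x $ i - y $ i\<bar>)"
    using rapid_continuous[OF assms] by blast
  have "continuous_on UNIV (\<lambda>x. nrm M (D \<beta> x))"
    using order_trans[OF nrm_diff_abs C] derivs_okD(2)[OF D] by (intro continuous_of_lipschitz) (simp only: real_norm_def, blast)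
  then show ?thesis by (rule borel_measurable_continuous_onI)
qed

text \<open>One power of the weight beyond \<open>N\<close> makes the square integrable: it leaves
  the factor \<open>inverse ((W 1 x)\<^sup>2)\<close>, a product of integrable one-variable
  functions.\<close>

lemma rapid_integrable:
  fixes D :: "('n \<Rightarrow> nat) \<Rightarrow> real^'n::finite \<Rightarrow> 'b"
  assumes D: "derivs_ok Xs nrm f D" and r: "rapid D" and \<alpha>: "\<alpha> \<in> multi_idx N"
    and C: "\<And>x. W (Suc N) x * nrm M (D \<beta> x) \<le> C"
  shows "integrable lborel (\<lambda>x. (nrm M (xpow x \<alpha> *\<^sub>R D \<beta> x))\<^sup>2)"
    "(\<integral>x. (nrm M (xpow x \<alpha> *\<^sub>R D \<beta> x))\<^sup>2 \<partial>lborel) \<le> C\<^sup>2 * (\<integral>x. inverse ((W 1 (x::real^'n))\<^sup>2) \<partial>lborel)"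
proof -
  have [measurable]: "(\<lambda>x. nrm M (D \<beta> x)) \<in> borel_measurable borel" "(\<lambda>x. xpow x \<alpha>) \<in> borel_measurable borel"
    using rapid_measurable[OF D r] by (auto simp: xpow_def)
  have le: "(nrm M (xpow x \<alpha> *\<^sub>R D \<beta> x))\<^sup>2 \<le> C\<^sup>2 * inverse ((W 1 x)\<^sup>2)" for x
  proof -
    have "W 1 x * nrm M (xpow x \<alpha> *\<^sub>R D \<beta> x) = \<bar>xpow x \<alpha>\<bar> * (W 1 x * nrm M (D \<beta> x))"
      by (simp add: nrm_scaleR derivs_okD(2)[OF D])
    also have "\<dots> \<le> W N x * (W 1 x * nrm M (D \<beta> x))"
      using xpow_le_W[OF \<alpha>, of x] by (intro mult_right_mono) (auto simp: derivs_okD(2)[OF D])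
    also have "\<dots> \<le> C" using C[of x] W_add[of 1 N x] by (simp add: mult_ac)
    finally have "(W 1 x * nrm M (xpow x \<alpha> *\<^sub>R D \<beta> x))\<^sup>2 \<le> C\<^sup>2"
      by (intro power_mono) (auto simp: derivs_okD(2)[OF D] X_scaleR)
    then show ?thesis using zero_less_power[OF W_pos[of 1 x], of 2] by (simp add: power_mult_distrib pos_le_divide_eq divide_inverse[symmetric] mult.commute[of "(W 1 x)\<^sup>2"] del: One_nat_def)
  qed
  show i: "integrable lborel (\<lambda>x. (nrm M (xpow x \<alpha> *\<^sub>R D \<beta> x))\<^sup>2)"
  proof (rule Bochner_Integration.integrable_bound)
    show "integrable lborel (\<lambda>x::real^'n. C\<^sup>2 * inverse ((W 1 x)\<^sup>2))"
      by (intro integrable_mult_right integrable_inverse_W)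
    show "AE x in lborel. norm ((nrm M (xpow x \<alpha> *\<^sub>R D \<beta> x))\<^sup>2) \<le> norm (C\<^sup>2 * inverse ((W 1 x)\<^sup>2))"
      using le by (intro AE_I2) auto
    show "(\<lambda>x. (nrm M (xpow x \<alpha> *\<^sub>R D \<beta> x))\<^sup>2) \<in> borel_measurable lborel"
      by (simp add: nrm_scaleR derivs_okD(2)[OF D])
  qed
  have "(\<integral>x. (nrm M (xpow x \<alpha> *\<^sub>R D \<beta> x))\<^sup>2 \<partial>lborel) \<le> (\<integral>x. C\<^sup>2 * inverse ((W 1 (x::real^'n))\<^sup>2) \<partial>lborel)"
    by (rule integral_mono[OF i _ le]) (intro integrable_mult_right integrable_inverse_W)
  then show "(\<integral>x. (nrm M (xpow x \<alpha> *\<^sub>R D \<beta> x))\<^sup>2 \<partial>lborel) \<le> C\<^sup>2 * (\<integral>x. inverse ((W 1 (x::real^'n))\<^sup>2) \<partial>lborel)"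
    by simp
qed

lemma rapid_schwartz:
  fixes D :: "('n \<Rightarrow> nat) \<Rightarrow> real^'n::finite \<Rightarrow> 'b"
  assumes D: "derivs_ok Xs nrm f D" and r: "rapid D"
  shows "schwartzX Xs nrm f"
  unfolding schwartzX_def DX_eq[OF D]
proof (intro conjI allI)
  fix M and \<alpha> \<beta> :: "'n \<Rightarrow> nat"
  obtain C where "\<And>x. W (Suc (sum \<alpha> UNIV)) x * nrm M (D \<beta> x) \<le> C"
    using r unfolding rapid_def by blast
  then show "integrable lborel (\<lambda>x. (nrm M (xpow x \<alpha> *\<^sub>R D \<beta> x))\<^sup>2)"
    by (intro rapid_integrable(1)[OF D r, of \<alpha> "sum \<alpha> UNIV"]) (auto simp: multi_idx_def)
qed (use D in blast)

text \<open>The constant is chosen before the function, so a functional bounded by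
  \<open>snormX\<close> becomes one bounded by weighted sup norms.\<close>

lemma snormX_le:
  fixes D :: "('n \<Rightarrow> nat) \<Rightarrow> real^'n::finite \<Rightarrow> 'b"
  shows "\<exists>K\<ge>0. \<forall>f D C. derivs_ok Xs nrm f D \<longrightarrow> rapid D \<longrightarrow> 0 \<le> C \<longrightarrow>
    (\<forall>\<beta>\<in>multi_idx N. \<forall>x::real^'n. W (Suc N) x * nrm M (D \<beta> x) \<le> C) \<longrightarrow> snormX Xs nrm M N f \<le> K * C"
proof -
  let ?I = "\<integral>x. inverse ((W 1 (x::real^'n))\<^sup>2) \<partial>lborel"
  let ?c = "real (card (multi_idx N :: ('n \<Rightarrow> nat) set))"
  have I0: "?I \<ge> 0" by simp
  show ?thesis
  proof (intro exI[of _ "sqrt (?c * ?c * ?I)"] conjI allI impI)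
    fix f C and D :: "('n \<Rightarrow> nat) \<Rightarrow> real^'n::finite \<Rightarrow> 'b"
    assume D: "derivs_ok Xs nrm f D" and r: "rapid D" and C0: "0 \<le> C"
      and C: "\<forall>\<beta>\<in>multi_idx N. \<forall>x. W (Suc N) x * nrm M (D \<beta> x) \<le> C"
    have "(\<Sum>\<alpha>\<in>(multi_idx N :: ('n \<Rightarrow> nat) set). \<Sum>\<beta>\<in>(multi_idx N :: ('n \<Rightarrow> nat) set).
             \<integral>x. (nrm M (xpow x \<alpha> *\<^sub>R D \<beta> x))\<^sup>2 \<partial>lborel)
        \<le> (\<Sum>\<alpha>\<in>(multi_idx N :: ('n \<Rightarrow> nat) set). \<Sum>\<beta>\<in>(multi_idx N :: ('n \<Rightarrow> nat) set). C\<^sup>2 * ?I)"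
      using C by (intro sum_mono rapid_integrable(2)[OF D r]) auto
    also have "\<dots> = (?c * ?c * ?I) * C\<^sup>2" by (simp add: mult_ac)
    finally have "snormX Xs nrm M N f \<le> sqrt ((?c * ?c * ?I) * C\<^sup>2)"
      unfolding snormX_def DX_eq[OF D] by simp
    then show "snormX Xs nrm M N f \<le> sqrt (?c * ?c * ?I) * C"
      using C0 by (simp add: real_sqrt_mult)
  qed (use I0 in simp)
qed


text \<open>One-dimensional Sobolev inequality: the values at \<open>u\<close> and
  \<open>u + s\<close> differ by at most the integral of the norm of the derivative over a unit
  interval, and averaging over \<open>s\<close> in \<open>{0..1}\<close> removes \<open>s\<close>.
  The second derivative makes the norm of \<open>g\<close> continuous.\<close>

lemma nrm_le_nn_integral_segment:
  assumes X: "\<And>s. f s \<in> X" "\<And>s. g s \<in> X" "\<And>s. g' s \<in> X"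
    and d: "\<And>s. vderiv M f (g s) s" "\<And>s. vderiv M g (g' s) s"
  shows "ennreal (nrm M (f u)) \<le> (\<integral>\<^sup>+s. ennreal (nrm M (f (u + s)) + nrm M (g (u + s))) * indicator {0..1} s \<partial>lborel)"
proof -
  let ?p = "\<lambda>s. nrm M (f s)" and ?q = "\<lambda>s. nrm M (g s)"
  have p: "continuous_on UNIV ?p" and q: "continuous_on UNIV ?q"
    using vderiv_nrm_cont[OF X(1) X(2) d(1)] vderiv_nrm_cont[OF X(2) X(3) d(2)]
    by (auto intro!: continuous_at_imp_continuous_on)
  have ps: "continuous_on S (\<lambda>s. ?p (u + s))" and qs: "continuous_on S (\<lambda>s. ?q (u + s))" for S
    by (auto intro!: continuous_on_compose2[OF p] continuous_on_compose2[OF q] continuous_intros)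
  let ?h = "\<lambda>s. ?p (u + s) + ?q (u + s)"
  define K where "K = integral {u..u+1} ?q"
  have K: "K = integral {0..1} (\<lambda>s. ?q (u + s))"
    using integral_shift_Icc_real[of 0 1 ?q u] by (simp add: K_def o_def add.commute)
  have qi: "?q integrable_on {a..b}" for a b
    by (intro integrable_continuous_interval continuous_on_subset[OF q]) simp
  have "nrm M (f u) \<le> ?p (u + s) + K" if "s \<in> {0..1}" for s
  proof -
    have "nrm M (f u) \<le> nrm M (f (u + s)) + nrm M (f (u + s) - f u)"
      using nrm_triangle[OF X(1) X(1) X_zero, of M u "u + s"] nrm_minus_commute[OF X(1) X(1), of M u "u + s"] by simp
    also have "nrm M (f (u + s) - f u) \<le> integral {u..u+s} ?q"
      using that by (intro vderiv_mvt_integral[OF X(1,2) d(1) q]) auto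
    also have "integral {u..u+s} ?q \<le> K"
      unfolding K_def using that X by (intro integral_subset_le qi) auto
    finally show ?thesis by simp
  qed
  then have "integral {0..1} (\<lambda>_::real. nrm M (f u)) \<le> integral {0..1} (\<lambda>s. ?p (u + s) + K)"
    by (intro integral_le integrable_const_ivl integrable_add integrable_continuous_interval ps) auto
  also have "\<dots> = integral {0..1} (\<lambda>s. ?p (u + s)) + K"
    by (subst integral_add) (auto intro: integrable_continuous_interval ps)
  also have "\<dots> = integral {0..1} ?h"
    unfolding K by (subst integral_add) (auto intro: integrable_continuous_interval ps qs)
  finally have le: "nrm M (f u) \<le> integral {0..1} ?h" by simp
  have "(?h has_integral integral {0..1} ?h) {0..1}"
    by (intro integrable_integral integrable_add integrable_continuous_interval ps qs)
  then have "(\<integral>\<^sup>+s. ennreal (?h s) * indicator {0..1} s \<partial>lborel) = ennreal (integral {0..1} ?h)"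
    by (intro nn_integral_has_integral_lebesgue') (auto intro!: X add_nonneg_nonneg nrm_nonneg)
  then show ?thesis using le by (simp add: ennreal_leI)
qed

definition mshift :: "('n \<Rightarrow> nat) \<Rightarrow> 'n set \<Rightarrow> 'n \<Rightarrow> nat" where
  "mshift \<beta> B = (\<lambda>j. \<beta> j + (if j \<in> B then 1 else 0))"

definition addv :: "'n set \<Rightarrow> real^'n \<Rightarrow> ('n \<Rightarrow> real) \<Rightarrow> real^'n::finite" where
  "addv I x y = (\<chi> j. if j \<in> I then x $ j + y j else x $ j)"

text \<open>Each new coordinate applies the one-dimensional inequality along its axis, contributing
  either the value or one derivative in that direction. The set \<open>B\<close> records the
  differentiated directions, so orders rise by at most one per coordinate.\<close>

lemma sobolev_box:
  fixes D :: "('n \<Rightarrow> nat) \<Rightarrow> real^'n::finite \<Rightarrow> 'b"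
  assumes D: "derivs_ok Xs nrm f D" and fin: "finite I"
    and meas [measurable]: "\<And>\<beta>. (\<lambda>x. nrm M (D \<beta> x)) \<in> borel_measurable borel"
  shows "ennreal (nrm M (D \<beta> x)) \<le>
    (\<integral>\<^sup>+y. (\<Sum>B\<in>Pow I. ennreal (nrm M (D (mshift \<beta> B) (addv I x y)))) * (\<Prod>i\<in>I. indicator {0..1} (y i)) \<partial>Pi\<^sub>M I (\<lambda>_. lborel :: real measure))"
  using fin
proof (induction I rule: finite_induct)
  case empty
  interpret product_sigma_finite "\<lambda>_::'n. lborel :: real measure" by standard
  have "addv {} x y = x" for y by (simp add: addv_def vec_eq_iff)
  then show ?case by (simp add: PiM_empty nn_integral_count_space_finite mshift_def)
next
  case (insert i I)
  interpret product_sigma_finite "\<lambda>_::'n. lborel :: real measure" by standard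
  let ?N = "\<lambda>\<beta> x. ennreal (nrm M (D \<beta> x))"
  let ?f = "\<lambda>y. (\<Sum>B\<in>Pow (insert i I). ?N (mshift \<beta> B) (addv (insert i I) x y)) * (\<Prod>i\<in>insert i I. indicator {0..1} (y i))"
  have ad: "addv J x \<in> measurable (Pi\<^sub>M J (\<lambda>_. lborel :: real measure)) borel" for J
  proof (rule borel_measurable_vecI)
    fix j show "(\<lambda>y. addv J x y $ j) \<in> borel_measurable (Pi\<^sub>M J (\<lambda>_. lborel :: real measure))"
      by (cases "j \<in> J") (auto simp: addv_def)
  qed
  have f: "?f \<in> borel_measurable (Pi\<^sub>M (insert i I) (\<lambda>_. lborel :: real measure))"
    using insert ad by measurable
  have step: "(\<Sum>B\<in>Pow I. ?N (mshift \<beta> B) (addv I x y)) * (\<Prod>i\<in>I. indicator {0..1} (y i)) \<le> (\<integral>\<^sup>+s. ?f (y(i := s)) \<partial>lborel)" for y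
  proof -
    define x' where "x' = addv I x y"
    have x': "addv (insert i I) x (y(i := s)) = vupd x' i (x $ i + s)" for s
      using insert by (auto simp: vec_eq_iff addv_def x'_def)
    have x'i: "x' $ i = x $ i" using insert by (simp add: x'_def addv_def)
    have [measurable]: "(\<lambda>s. vupd x' i (x $ i + s)) \<in> borel_measurable borel"
      by (rule borel_measurable_vecI) simp
    have B: "?N (mshift \<beta> B) x' \<le> (\<integral>\<^sup>+s. (?N (mshift \<beta> B) (vupd x' i (x $ i + s)) + ?N (mshift \<beta> (insert i B)) (vupd x' i (x $ i + s))) * indicator {0..1} s \<partial>lborel)"
      if "B \<in> Pow I" for B
    proof -
      have "(mshift \<beta> B)(i := Suc (mshift \<beta> B i)) = mshift \<beta> (insert i B)"
        using that insert by (auto simp: mshift_def fun_eq_iff)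
      note d = derivs_okD(3)[OF D, of M "mshift \<beta> B" x' i, unfolded this]
      note d' = derivs_okD(3)[OF D, of M "mshift \<beta> (insert i B)" x' i]
      have "?N (mshift \<beta> B) (vupd x' i (x $ i)) \<le> (\<integral>\<^sup>+s. ennreal (nrm M (D (mshift \<beta> B) (vupd x' i (x $ i + s))) + nrm M (D (mshift \<beta> (insert i B)) (vupd x' i (x $ i + s)))) * indicator {0..1} s \<partial>lborel)"
        by (rule nrm_le_nn_integral_segment[OF _ _ _ d d']) (rule derivs_okD(2)[OF D])+
      moreover have "vupd x' i (x $ i) = x'" using x'i vupd_id[of x' i] by simp
      ultimately show ?thesis by (simp add: ennreal_plus derivs_okD(2)[OF D])
    qed
    have fin: "finite (Pow I)" using insert by simp
    have "(\<Sum>B\<in>Pow I. ?N (mshift \<beta> B) x') \<le> (\<Sum>B\<in>Pow I. \<integral>\<^sup>+s. (?N (mshift \<beta> B) (vupd x' i (x $ i + s)) + ?N (mshift \<beta> (insert i B)) (vupd x' i (x $ i + s))) * indicator {0..1} s \<partial>lborel)"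
      by (intro sum_mono B)
    also have "\<dots> = (\<integral>\<^sup>+s. (\<Sum>B\<in>Pow I. (?N (mshift \<beta> B) (vupd x' i (x $ i + s)) + ?N (mshift \<beta> (insert i B)) (vupd x' i (x $ i + s))) * indicator {0..1} s) \<partial>lborel)"
      by (intro nn_integral_sum[symmetric]) measurable
    also have "\<dots> = (\<integral>\<^sup>+s. (\<Sum>B\<in>Pow (insert i I). ?N (mshift \<beta> B) (vupd x' i (x $ i + s))) * indicator {0..1} s \<partial>lborel)"
    proof (intro nn_integral_cong)
      fix s
      have inj: "inj_on (insert i) (Pow I)" using insert by (auto simp: inj_on_def)
      \<comment> \<open>Subsets of \<open>insert i I\<close> without and with \<open>i\<close>
        correspond to the two terms of the one-dimensional inequality.\<close>
      have "(\<Sum>B\<in>Pow (insert i I). ?N (mshift \<beta> B) (vupd x' i (x $ i + s))) =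
         (\<Sum>B\<in>Pow I. ?N (mshift \<beta> B) (vupd x' i (x $ i + s))) + (\<Sum>B\<in>insert i ` Pow I. ?N (mshift \<beta> B) (vupd x' i (x $ i + s)))"
        unfolding Pow_insert using insert by (intro sum.union_disjoint) auto
      then show "(\<Sum>B\<in>Pow I. (?N (mshift \<beta> B) (vupd x' i (x $ i + s)) + ?N (mshift \<beta> (insert i B)) (vupd x' i (x $ i + s))) * indicator {0..1} s)
          = (\<Sum>B\<in>Pow (insert i I). ?N (mshift \<beta> B) (vupd x' i (x $ i + s))) * indicator {0..1} s"
        by (simp add: sum.reindex[OF inj] sum.distrib sum_distrib_right[symmetric])
    qed
    finally have "(\<Sum>B\<in>Pow I. ?N (mshift \<beta> B) x') * (\<Prod>i\<in>I. indicator {0..1} (y i)) \<le>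
      (\<integral>\<^sup>+s. (\<Sum>B\<in>Pow (insert i I). ?N (mshift \<beta> B) (vupd x' i (x $ i + s))) * indicator {0..1} s \<partial>lborel) * (\<Prod>i\<in>I. indicator {0..1} (y i))"
      by (intro mult_right_mono) auto
    also have "\<dots> = (\<integral>\<^sup>+s. (\<Sum>B\<in>Pow (insert i I). ?N (mshift \<beta> B) (vupd x' i (x $ i + s))) * indicator {0..1} s * (\<Prod>i\<in>I. indicator {0..1} (y i)) \<partial>lborel)"
      by (intro nn_integral_multc[symmetric]) measurable
    also have "\<dots> = (\<integral>\<^sup>+s. ?f (y(i := s)) \<partial>lborel)"
    proof (intro nn_integral_cong)
      fix s
      have "(\<Prod>j\<in>I. indicator {0..1::real} ((y(i := s)) j) :: ennreal) = (\<Prod>j\<in>I. indicator {0..1} (y j))"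
        using insert by (intro prod.cong) auto
      then show "(\<Sum>B\<in>Pow (insert i I). ?N (mshift \<beta> B) (vupd x' i (x $ i + s))) * indicator {0..1} s * (\<Prod>i\<in>I. indicator {0..1} (y i)) = ?f (y(i := s))"
        unfolding x' using insert by (simp add: mult_ac)
    qed
    finally show ?thesis by (simp add: x'_def)
  qed
  have "?N \<beta> x \<le> (\<integral>\<^sup>+y. (\<Sum>B\<in>Pow I. ?N (mshift \<beta> B) (addv I x y)) * (\<Prod>i\<in>I. indicator {0..1} (y i)) \<partial>Pi\<^sub>M I (\<lambda>_. lborel))"
    by (rule insert)
  also have "\<dots> \<le> (\<integral>\<^sup>+y. (\<integral>\<^sup>+s. ?f (y(i := s)) \<partial>lborel) \<partial>Pi\<^sub>M I (\<lambda>_. lborel))"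
    by (intro nn_integral_mono step)
  also have "\<dots> = (\<integral>\<^sup>+y. ?f y \<partial>Pi\<^sub>M (insert i I) (\<lambda>_. lborel))"
    using insert f by (intro product_nn_integral_insert[symmetric]) auto
  finally show ?case .
qed

text \<open>A coordinate of absolute value at least 1 satisfies
  \<open>1 + \<bar>x $ i\<bar> \<le> 2 * \<bar>x $ i\<bar>\<close>, and any other one contributes a
  factor of at most \<open>2 ^ A\<close>. The monomial depends on \<open>x\<close> only through a
  set of coordinates, so finitely many monomials dominate the weight everywhere.\<close>

lemma W_le_xpow:
  "W A x \<le> 2 ^ (A * CARD('n)) * \<bar>xpow x (\<lambda>i. if i \<in> {i. 1 \<le> \<bar>x $ i\<bar>} then A else 0)\<bar>" for x :: "real^'n::finite"
proof -
  have "W A x \<le> (\<Prod>i\<in>UNIV. 2 ^ A * \<bar>(x $ i) ^ (if i \<in> {i. 1 \<le> \<bar>x $ i\<bar>} then A else 0)\<bar>)"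
    unfolding W_def
  proof (intro prod_mono conjI)
    fix i
    show "(1 + \<bar>x $ i\<bar>) ^ A \<le> 2 ^ A * \<bar>(x $ i) ^ (if i \<in> {i. 1 \<le> \<bar>x $ i\<bar>} then A else 0)\<bar>"
    proof (cases "1 \<le> \<bar>x $ i\<bar>")
      case True
      then have "(1 + \<bar>x $ i\<bar>) ^ A \<le> (2 * \<bar>x $ i\<bar>) ^ A" by (intro power_mono) auto
      then show ?thesis using True by (simp add: power_mult_distrib power_abs)
    next
      case False
      then have "(1 + \<bar>x $ i\<bar>) ^ A \<le> 2 ^ A" by (intro power_mono) auto
      then show ?thesis using False by simp
    qed
  qed auto
  also have "\<dots> = 2 ^ (A * CARD('n)) * \<bar>xpow x (\<lambda>i. if i \<in> {i. 1 \<le> \<bar>x $ i\<bar>} then A else 0)\<bar>"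
    by (simp add: prod.distrib xpow_def abs_prod power_mult)
  finally show ?thesis .
qed

text \<open>Sobolev's inequality on the unit box at \<open>x\<close>, combined with Peetre's
  inequality to move the weight from \<open>x\<close> to the point of integration. With nonnegative
  extended integrals, finiteness enters only through the quadratic seminorms.\<close>

lemma schwartz_rapid:
  fixes D :: "('n \<Rightarrow> nat) \<Rightarrow> real^'n::finite \<Rightarrow> 'b"
  assumes s: "schwartzX Xs nrm f" and D: "derivs_ok Xs nrm f D"
  shows "rapid D"
  unfolding rapid_def
proof (intro allI)
  fix M A \<beta>
  have int: "integrable lborel (\<lambda>x. (nrm M (xpow x \<alpha> *\<^sub>R D \<beta> x))\<^sup>2)" for \<alpha> \<beta>
    using s unfolding schwartzX_def DX_eq[OF D] by blast
  have meas [measurable]: "(\<lambda>x. nrm M (D \<beta> x)) \<in> borel_measurable borel" for \<beta>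
  proof -
    \<comment> \<open>Integrability is given for squares, so the measurable norm is recovered by a
      square root at exponent 0.\<close>
    have "(\<lambda>x. sqrt ((nrm M (xpow x (\<lambda>_. 0) *\<^sub>R D \<beta> x))\<^sup>2)) \<in> borel_measurable borel"
      by (rule measurable_compose[OF _ borel_measurable_sqrt])
         (use borel_measurable_integrable[OF int[of "\<lambda>_. 0" \<beta>]] in simp)
    then show ?thesis by (simp add: xpow_def derivs_okD(2)[OF D])
  qed
  let ?N = "\<lambda>\<beta> x. nrm M (D \<beta> x)"
  let ?c = "2 ^ (A * CARD('n)) :: real"
  have sq: "(\<integral>\<^sup>+x. ennreal ((W A x * ?N \<beta> x)\<^sup>2) \<partial>lborel) < \<top>" for \<beta>
  proof -
    define ai where "ai = (\<lambda>C (i::'n). if i \<in> C then A else 0)"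
    let ?g = "\<lambda>x. ?c\<^sup>2 * (\<Sum>C\<in>Pow UNIV. (nrm M (xpow x (ai C) *\<^sub>R D \<beta> x))\<^sup>2)"
    have "(\<integral>\<^sup>+x. ennreal ((W A x * ?N \<beta> x)\<^sup>2) \<partial>lborel) \<le> (\<integral>\<^sup>+x. ennreal (?g x) \<partial>lborel)"
    proof (intro nn_integral_mono ennreal_leI)
      fix x :: "real^'n"
      define C where "C = {i. 1 \<le> \<bar>x $ i\<bar>}"
      have "W A x * ?N \<beta> x \<le> (?c * \<bar>xpow x (ai C)\<bar>) * ?N \<beta> x"
        using W_le_xpow[of A x] unfolding ai_def C_def[symmetric]
        by (intro mult_right_mono) (auto simp: derivs_okD(2)[OF D])
      also have "\<dots> = ?c * nrm M (xpow x (ai C) *\<^sub>R D \<beta> x)"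
        by (simp add: nrm_scaleR derivs_okD(2)[OF D])
      finally have "(W A x * ?N \<beta> x)\<^sup>2 \<le> ?c\<^sup>2 * (nrm M (xpow x (ai C) *\<^sub>R D \<beta> x))\<^sup>2"
        unfolding power_mult_distrib[symmetric]
        by (intro power_mono) (auto simp: derivs_okD(2)[OF D])
      also have "\<dots> \<le> ?g x"
        by (intro mult_left_mono member_le_sum) auto
      finally show "(W A x * ?N \<beta> x)\<^sup>2 \<le> ?g x" .
    qed
    also have "\<dots> < \<top>"
    proof -
      have "integrable lborel ?g" by (intro integrable_mult_right Bochner_Integration.integrable_sum int)
      moreover have "AE x in lborel. 0 \<le> ?g x" by (intro AE_I2 mult_nonneg_nonneg sum_nonneg) auto
      ultimately show ?thesis by (simp add: nn_integral_eq_integral)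
    qed
    finally show ?thesis .
  qed
  interpret product_sigma_finite "\<lambda>_::'n. lborel :: real measure" by standard
  let ?P = "Pi\<^sub>M UNIV (\<lambda>_::'n. lborel :: real measure)"
  let ?chi = "\<lambda>y. (\<Prod>i\<in>(UNIV::'n set). indicator {0..1::real} (y i)) :: ennreal"
  define K where "K = (\<Sum>B\<in>Pow (UNIV :: 'n set). ennreal ?c * (1 + (\<integral>\<^sup>+x. ennreal ((W A x * ?N (mshift \<beta> B) x)\<^sup>2) \<partial>lborel)))"
  have K: "K < \<top>"
    unfolding K_def using sq by (simp add: ennreal_mult_less_top)
  have chi: "(\<integral>\<^sup>+y. ?chi y \<partial>?P) = 1"
    by (subst product_nn_integral_prod) auto
  have "ennreal (W A x * ?N \<beta> x) \<le> K" for x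
  proof -
    have ad: "addv UNIV x y = x + (\<chi> i. y i)" for y by (simp add: addv_def vec_eq_iff)
    have "ennreal (W A x * ?N \<beta> x) = ennreal (W A x) * ennreal (?N \<beta> x)"
      by (rule ennreal_mult) (auto simp: derivs_okD(2)[OF D])
    also have "\<dots> \<le> ennreal (W A x) * (\<integral>\<^sup>+y. (\<Sum>B\<in>Pow UNIV. ennreal (?N (mshift \<beta> B) (x + (\<chi> i. y i)))) * ?chi y \<partial>?P)"
      using sobolev_box[OF D finite meas, where I = UNIV and \<beta> = \<beta> and x = x] by (intro mult_left_mono) (auto simp: ad)
    also have "\<dots> = (\<integral>\<^sup>+y. ennreal (W A x) * ((\<Sum>B\<in>Pow UNIV. ennreal (?N (mshift \<beta> B) (x + (\<chi> i. y i)))) * ?chi y) \<partial>?P)"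
      by (rule nn_integral_cmult[symmetric]) measurable
    also have "\<dots> \<le> (\<integral>\<^sup>+y. (\<Sum>B\<in>Pow (UNIV :: 'n set). ennreal ?c * (?chi y + ennreal ((W A (x + (\<chi> i. y i)) * ?N (mshift \<beta> B) (x + (\<chi> i. y i)))\<^sup>2))) \<partial>?P)"
    proof (intro nn_integral_mono)
      fix y :: "'n \<Rightarrow> real"
      let ?z = "x + (\<chi> i. y i)"
      show "ennreal (W A x) * ((\<Sum>B\<in>Pow UNIV. ennreal (?N (mshift \<beta> B) ?z)) * ?chi y)
         \<le> (\<Sum>B\<in>Pow UNIV. ennreal ?c * (?chi y + ennreal ((W A ?z * ?N (mshift \<beta> B) ?z)\<^sup>2)))"
      proof (cases "\<forall>i. y i \<in> {0..1}")
        case True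
        then have chi1: "?chi y = 1" by (intro prod.neutral) auto
        have "W A (- (\<chi> i. y i)) \<le> (\<Prod>i\<in>(UNIV::'n set). 2 ^ A)"
          unfolding W_minus unfolding W_def using True by (intro prod_mono conjI power_mono) auto
        also have "\<dots> = ?c" by (simp add: power_mult)
        finally have c: "W A x \<le> W A ?z * ?c"
          using order_trans[OF W_peetre[of A ?z "- (\<chi> i. y i)"] mult_left_mono[of _ ?c "W A ?z"]] by simp
        have "ennreal (W A x) * ennreal (?N (mshift \<beta> B) ?z) \<le> ennreal ?c * (1 + ennreal ((W A ?z * ?N (mshift \<beta> B) ?z)\<^sup>2))" for B
        proof -
          \<comment> \<open>The inequality \<open>r \<le> 1 + r\<^sup>2\<close> takes the place of
            Cauchy-Schwarz: the box has measure 1, so the constant integrates to 1.\<close>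
          define r where "r = W A ?z * ?N (mshift \<beta> B) ?z"
          have "0 \<le> (r - 1)\<^sup>2" by simp
          then have "2 * r \<le> 1 + r\<^sup>2" by (simp add: power2_diff)
          moreover have "0 \<le> r" by (simp add: r_def derivs_okD(2)[OF D])
          ultimately have r: "r \<le> 1 + r\<^sup>2" by simp
          have "W A x * ?N (mshift \<beta> B) ?z \<le> (W A ?z * ?c) * ?N (mshift \<beta> B) ?z"
            using c by (intro mult_right_mono) (auto simp: derivs_okD(2)[OF D])
          also have "\<dots> = ?c * r" by (simp add: r_def)
          also have "\<dots> \<le> ?c * (1 + r\<^sup>2)" using r by (intro mult_left_mono) auto
          finally have "ennreal (W A x * ?N (mshift \<beta> B) ?z) \<le> ennreal (?c * (1 + r\<^sup>2))" by (rule ennreal_leI)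
          then show ?thesis by (simp add: ennreal_mult derivs_okD(2)[OF D] r_def)
        qed
        then show ?thesis unfolding chi1 by (simp add: sum_distrib_left sum_mono del: Pow_UNIV)
      next
        case False
        then obtain i where "y i \<notin> {0..1}" by blast
        then have "indicator {0..1} (y i) = (0 :: ennreal)" by simp
        then have chi0: "?chi y = 0" by (intro prod_zero bexI[of _ i]) auto
        show ?thesis unfolding chi0 by simp
      qed
    qed
    also have "\<dots> = (\<Sum>B\<in>Pow (UNIV :: 'n set). ennreal ?c * ((\<integral>\<^sup>+y. ?chi y \<partial>?P) + (\<integral>\<^sup>+y. ennreal ((W A (x + (\<chi> i. y i)) * ?N (mshift \<beta> B) (x + (\<chi> i. y i)))\<^sup>2) \<partial>?P)))"
      by (simp add: nn_integral_sum nn_integral_cmult nn_integral_add del: Pow_UNIV)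
    also have "\<dots> = K"
    proof -
      have "(\<integral>\<^sup>+y. ennreal ((W A (x + (\<chi> i. y i)) * ?N \<gamma> (x + (\<chi> i. y i)))\<^sup>2) \<partial>?P) = (\<integral>\<^sup>+z. ennreal ((W A z * ?N \<gamma> z)\<^sup>2) \<partial>lborel)" for \<gamma>
      proof -
        have "(\<integral>\<^sup>+z. ennreal ((W A z * ?N \<gamma> z)\<^sup>2) \<partial>lborel) = (\<integral>\<^sup>+z. ennreal ((W A z * ?N \<gamma> z)\<^sup>2) \<partial>distr lborel borel ((+) x))"
          by (simp add: lborel_distr_plus)
        also have "\<dots> = (\<integral>\<^sup>+z. ennreal ((W A (x + z) * ?N \<gamma> (x + z))\<^sup>2) \<partial>lborel)"
          by (subst nn_integral_distr) auto
        also have "\<dots> = (\<integral>\<^sup>+y. ennreal ((W A (x + (\<chi> i. y i)) * ?N \<gamma> (x + (\<chi> i. y i)))\<^sup>2) \<partial>?P)"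
          unfolding lborel_vec by (subst nn_integral_distr) auto
        finally show ?thesis by simp
      qed
      then show ?thesis by (simp add: K_def chi)
    qed
    finally show ?thesis .
  qed
  then have "W A x * ?N \<beta> x \<le> enn2real K" for x
    using enn2real_mono[of "ennreal (W A x * ?N \<beta> x)" K] K by (simp add: derivs_okD(2)[OF D])
  then show "\<exists>C. \<forall>x. W A x * nrm M (D \<beta> x) \<le> C" by blast
qed

lemma schwartzX_iff_rapid: "schwartzX Xs nrm f \<longleftrightarrow> (\<exists>D. derivs_ok Xs nrm f D \<and> rapid D)"
  using schwartz_rapid rapid_schwartz unfolding schwartzX_def by blast

end

section \<open>Schwartz functions of one real variable, given together with all their
  derivatives\<close>

definition rapid1 :: "(nat \<Rightarrow> real \<Rightarrow> complex) \<Rightarrow> bool" where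
  "rapid1 \<phi> \<longleftrightarrow> (\<forall>k s. (\<phi> k has_vector_derivative \<phi> (Suc k) s) (at s)) \<and>
     (\<forall>k A. \<exists>C. \<forall>s. (1 + \<bar>s\<bar>) ^ A * norm (\<phi> k s) \<le> C)"

lemma has_vector_derivative_prod_single:
  fixes \<psi> :: "'n::finite \<Rightarrow> real \<Rightarrow> complex"
  assumes "(\<psi> i has_vector_derivative d) (at s)"
  shows "((\<lambda>s. \<Prod>j\<in>UNIV. \<psi> j (vupd x i s $ j)) has_vector_derivative
     d * (\<Prod>j\<in>UNIV - {i}. \<psi> j (x $ j))) (at s)"
proof -
  have "(\<Prod>j\<in>UNIV. \<psi> j (vupd x i s $ j)) = \<psi> i s * (\<Prod>j\<in>UNIV - {i}. \<psi> j (x $ j))" for s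
    by (subst prod.remove[of _ i]) (auto intro!: prod.cong arg_cong2[where f = "(*)"])
  then show ?thesis
    using has_vector_derivative_mult[OF assms has_vector_derivative_const] by simp
qed

section \<open>The test function space, its functionals, and test functions built from
  products\<close>

context frechet
begin

lemma nrm_mono:
  assumes x: "x \<in> X" and le: "M \<le> M'"
  shows "nrm M x \<le> nrm M' x"
  using le
proof (induction rule: dec_induct)
  case (step m)
  have "nrm m x \<le> nrm (Suc m) x"
    using family X_Xs[OF x, of "Suc m"] by (auto simp: frechet_family_def)
  with step show ?case by simp
qed simp

lemma derivs_ok_add:
  fixes f :: "real^'n::finite \<Rightarrow> 'b"
  assumes "derivs_ok Xs nrm f D" "derivs_ok Xs nrm g E"
  shows "derivs_ok Xs nrm (\<lambda>x. f x + g x) (\<lambda>\<beta> x. D \<beta> x + E \<beta> x)"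
  using derivs_okD[OF assms(1)] derivs_okD[OF assms(2)]
  by (intro derivs_okI vderiv_add X_add) auto

lemma rapid_add:
  fixes D :: "('n \<Rightarrow> nat) \<Rightarrow> real^'n::finite \<Rightarrow> 'b"
  assumes X: "\<And>\<beta> x. D \<beta> x \<in> X" "\<And>\<beta> x. E \<beta> x \<in> X" and "rapid D" "rapid E"
  shows "rapid (\<lambda>\<beta> x. D \<beta> x + E \<beta> x)"
  unfolding rapid_def
proof (intro allI)
  fix M A \<beta>
  obtain C C' where C: "\<And>x. W A x * nrm M (D \<beta> x) \<le> C" "\<And>x. W A x * nrm M (E \<beta> x) \<le> C'"
    using assms unfolding rapid_def by metis
  have "W A x * nrm M (D \<beta> x + E \<beta> x) \<le> C + C'" for x
    using C[of x] mult_left_mono[OF nrm_add[OF X, of M \<beta> x \<beta> x] W_nonneg[of A x]] by (simp add: algebra_simps)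
  then show "\<exists>C. \<forall>x. W A x * nrm M (D \<beta> x + E \<beta> x) \<le> C" by blast
qed

lemma derivs_ok_cs:
  fixes f :: "real^'n::finite \<Rightarrow> 'b"
  assumes "derivs_ok Xs nrm f D"
  shows "derivs_ok Xs nrm (\<lambda>x. cs c (f x)) (\<lambda>\<beta> x. cs c (D \<beta> x))"
proof (intro derivs_okI)
  fix M \<beta> i x s
  have "vderiv M (\<lambda>s. cs c (D \<beta> (vupd x i s))) (cs 0 (D \<beta> (vupd x i s)) + cs c (D (\<beta>(i := Suc (\<beta> i))) (vupd x i s))) s"
    by (rule vderiv_cs[OF _ _ _ has_vector_derivative_const]) (rule derivs_okD[OF assms])+
  then show "vderiv M (\<lambda>s. cs c (D \<beta> (vupd x i s))) (cs c (D (\<beta>(i := Suc (\<beta> i))) (vupd x i s))) s" by simp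
qed (use derivs_okD[OF assms] in auto)

lemma rapid_cs:
  fixes D :: "('n \<Rightarrow> nat) \<Rightarrow> real^'n::finite \<Rightarrow> 'b"
  assumes X: "\<And>\<beta> x. D \<beta> x \<in> X" and "rapid D"
  shows "rapid (\<lambda>\<beta> x. cs c (D \<beta> x))"
  unfolding rapid_def
proof (intro allI)
  fix M A \<beta>
  obtain C where C: "\<And>x. W A x * nrm M (D \<beta> x) \<le> C" using assms unfolding rapid_def by metis
  have "W A x * nrm M (cs c (D \<beta> x)) \<le> norm c * C" for x
    using mult_left_mono[OF C[of x], of "norm c"] by (simp add: nrm_cs X mult_ac)
  then show "\<exists>C. \<forall>x. W A x * nrm M (cs c (D \<beta> x)) \<le> C" by blast
qed

lemma schwartz_add:
  fixes f g :: "real^'n::finite \<Rightarrow> 'b"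
  assumes "schwartzX Xs nrm f" "schwartzX Xs nrm g"
  shows "schwartzX Xs nrm (\<lambda>x. f x + g x)"
proof -
  obtain D E where D: "derivs_ok Xs nrm f D" "rapid D" and E: "derivs_ok Xs nrm g E" "rapid E"
    using assms unfolding schwartzX_iff_rapid by blast
  show ?thesis
    using derivs_ok_add[OF D(1) E(1)] rapid_add[OF derivs_okD(2)[OF D(1)] derivs_okD(2)[OF E(1)] D(2) E(2)]
    by (rule rapid_schwartz)
qed

lemma schwartz_cs:
  fixes f :: "real^'n::finite \<Rightarrow> 'b"
  assumes "schwartzX Xs nrm f"
  shows "schwartzX Xs nrm (\<lambda>x. cs c (f x))"
proof -
  obtain D where D: "derivs_ok Xs nrm f D" "rapid D"
    using assms unfolding schwartzX_iff_rapid by blast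
  show ?thesis
    using derivs_ok_cs[OF D(1)] rapid_cs[OF derivs_okD(2)[OF D(1)] D(2)] by (rule rapid_schwartz)
qed

lemma schwartz_zero: "schwartzX Xs nrm (\<lambda>x::real^'n::finite. 0)"
  unfolding schwartzX_iff_rapid
  by (intro exI[of _ "\<lambda>_ _. 0"] conjI derivs_okI) (auto simp: rapid_def vderiv_const)

lemma schwartz_sum:
  fixes f :: "'i \<Rightarrow> real^'n::finite \<Rightarrow> 'b"
  assumes "\<And>k. k \<in> S \<Longrightarrow> schwartzX Xs nrm (f k)"
  shows "schwartzX Xs nrm (\<lambda>x. \<Sum>k\<in>S. f k x)"
  using assms by (induction S rule: infinite_finite_induct) (auto simp: schwartz_zero schwartz_add)

lemma schwartz_diff:
  fixes f g :: "real^'n::finite \<Rightarrow> 'b"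
  assumes "schwartzX Xs nrm f" "schwartzX Xs nrm g"
  shows "schwartzX Xs nrm (\<lambda>x. f x - g x)"
  using schwartz_add[OF assms(1) schwartz_cs[OF assms(2), of "-1"]] by (simp add: cs_minus_left)

lemma schwartz_X: "schwartzX Xs nrm f \<Longrightarrow> f x \<in> X" for f :: "real^'n::finite \<Rightarrow> 'b"
  unfolding schwartzX_iff_rapid using derivs_okD(1,2) by metis

text \<open>Sobolev's inequality turns the quadratic seminorms into weighted sup norms, which are what
  all estimates below use.\<close>

definition sdist :: "((real^'n::finite \<Rightarrow> 'b) \<Rightarrow> complex) \<Rightarrow> bool" where
  "sdist \<Theta> \<longleftrightarrow>
     (\<forall>f g. schwartzX Xs nrm f \<longrightarrow> schwartzX Xs nrm g \<longrightarrow> \<Theta> (\<lambda>x. f x + g x) = \<Theta> f + \<Theta> g) \<and>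
     (\<forall>c f. schwartzX Xs nrm f \<longrightarrow> \<Theta> (\<lambda>x. cs c (f x)) = c * \<Theta> f) \<and>
     (\<exists>M N A K. K \<ge> 0 \<and> (\<forall>f D C. derivs_ok Xs nrm f D \<longrightarrow> rapid D \<longrightarrow> 0 \<le> C \<longrightarrow>
        (\<forall>\<beta>\<in>multi_idx N. \<forall>x. W A x * nrm M (D \<beta> x) \<le> C) \<longrightarrow> norm (\<Theta> f) \<le> K * C))"

lemma sdistI:
  assumes "\<And>f g. schwartzX Xs nrm f \<Longrightarrow> schwartzX Xs nrm g \<Longrightarrow> \<Theta> (\<lambda>x. f x + g x) = \<Theta> f + \<Theta> g"
    "\<And>c f. schwartzX Xs nrm f \<Longrightarrow> \<Theta> (\<lambda>x. cs c (f x)) = c * \<Theta> f"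
    and "K \<ge> 0"
    and "\<And>f D C. derivs_ok Xs nrm f D \<Longrightarrow> rapid D \<Longrightarrow> 0 \<le> C \<Longrightarrow>
        \<forall>\<beta>\<in>multi_idx N. \<forall>x. W A x * nrm M (D \<beta> x) \<le> C \<Longrightarrow> norm (\<Theta> f) \<le> K * C"
  shows "sdist \<Theta>"
  unfolding sdist_def
  by (intro conjI allI impI exI[of _ M] exI[of _ N] exI[of _ A] exI[of _ K] assms)

lemma sdist_add: "sdist \<Theta> \<Longrightarrow> schwartzX Xs nrm f \<Longrightarrow> schwartzX Xs nrm g \<Longrightarrow> \<Theta> (\<lambda>x. f x + g x) = \<Theta> f + \<Theta> g"
  and sdist_cs: "sdist \<Theta> \<Longrightarrow> schwartzX Xs nrm f \<Longrightarrow> \<Theta> (\<lambda>x. cs c (f x)) = c * \<Theta> f"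
  and sdist_bound: "sdist \<Theta> \<Longrightarrow> \<exists>M N A K. K \<ge> 0 \<and> (\<forall>f D C. derivs_ok Xs nrm f D \<longrightarrow> rapid D \<longrightarrow> 0 \<le> C \<longrightarrow>
        (\<forall>\<beta>\<in>multi_idx N. \<forall>x. W A x * nrm M (D \<beta> x) \<le> C) \<longrightarrow> norm (\<Theta> f) \<le> K * C)"
  by (auto simp: sdist_def)

lemma sdist_scaleR: "sdist \<Theta> \<Longrightarrow> schwartzX Xs nrm f \<Longrightarrow> \<Theta> (\<lambda>x. r *\<^sub>R f x) = of_real r * \<Theta> f"
  using sdist_cs[of \<Theta> f "of_real r"] by (simp add: cs_of_real)

lemma sdist_zero: "sdist \<Theta> \<Longrightarrow> \<Theta> (\<lambda>x. 0) = 0"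
  using sdist_cs[OF _ schwartz_zero, of \<Theta> 0] by simp

lemma sdist_diff: "sdist \<Theta> \<Longrightarrow> schwartzX Xs nrm f \<Longrightarrow> schwartzX Xs nrm g \<Longrightarrow> \<Theta> (\<lambda>x. f x - g x) = \<Theta> f - \<Theta> g"
  using sdist_add[OF _ _ schwartz_cs[of g "-1"], of \<Theta> f] sdist_cs[of \<Theta> g "-1"] by (simp add: cs_minus_left)

lemma sdist_sum:
  assumes "sdist \<Theta>" "\<And>k. k \<in> S \<Longrightarrow> schwartzX Xs nrm (f k)"
  shows "\<Theta> (\<lambda>x. \<Sum>k\<in>S. f k x) = (\<Sum>k\<in>S. \<Theta> (f k))"
  using assms(2)
  by (induction S rule: infinite_finite_induct)
     (auto simp: sdist_zero[OF assms(1)] sdist_add[OF assms(1)] schwartz_sum)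

lemma tdist_sdist:
  fixes \<Phi> :: "(real^'n::finite \<Rightarrow> 'b) \<Rightarrow> complex"
  assumes "tdistX Xs nrm J \<Phi>"
  shows "sdist \<Phi>"
proof -
  obtain M N c where c: "\<And>f. schwartzX Xs nrm f \<Longrightarrow> norm (\<Phi> f) \<le> c * snormX Xs nrm M N f"
    using assms unfolding tdistX_def by blast
  obtain K where K: "K \<ge> 0" "\<And>f D C. derivs_ok Xs nrm f D \<Longrightarrow> rapid D \<Longrightarrow> 0 \<le> C \<Longrightarrow>
    (\<forall>\<beta>\<in>multi_idx N. \<forall>x::real^'n. W (Suc N) x * nrm M (D \<beta> x) \<le> C) \<Longrightarrow> snormX Xs nrm M N f \<le> K * C"
    using snormX_le[of N M] by blast
  have "norm (\<Phi> f) \<le> (\<bar>c\<bar> * K) * C" if "derivs_ok Xs nrm f D" "rapid D" "0 \<le> C"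
    "\<forall>\<beta>\<in>multi_idx N. \<forall>x::real^'n. W (Suc N) x * nrm M (D \<beta> x) \<le> C" for f D C
  proof -
    have "0 \<le> snormX Xs nrm M N f"
      unfolding snormX_def by (intro real_sqrt_ge_zero sum_nonneg) simp
    \<comment> \<open>The constant in \<open>tdistX\<close> carries no sign, hence the absolute
      value.\<close>
    then have "c * snormX Xs nrm M N f \<le> \<bar>c\<bar> * snormX Xs nrm M N f"
      by (intro mult_right_mono) auto
    with c[OF rapid_schwartz[OF that(1,2)]] have "norm (\<Phi> f) \<le> \<bar>c\<bar> * snormX Xs nrm M N f"
      by (rule order_trans)
    also have "\<dots> \<le> \<bar>c\<bar> * (K * C)" by (intro mult_left_mono K(2)[OF that]) auto
    finally show ?thesis by simp
  qed
  moreover have "\<bar>c\<bar> * K \<ge> 0" using K by simp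
  moreover have "\<Phi> (\<lambda>x. f x + g x) = \<Phi> f + \<Phi> g" if "schwartzX Xs nrm f" "schwartzX Xs nrm g" for f g
    using assms that unfolding tdistX_def by blast
  moreover have "\<Phi> (\<lambda>x. cs c (f x)) = c * \<Phi> f" if "schwartzX Xs nrm f" for c f
    using assms that unfolding tdistX_def by blast
  ultimately show ?thesis by (intro sdistI[of \<Phi> "\<bar>c\<bar> * K" N "Suc N" M])
qed

lemma sdist_minus:
  fixes \<Theta>1 \<Theta>2 :: "(real^'n::finite \<Rightarrow> 'b) \<Rightarrow> complex"
  assumes 1: "sdist \<Theta>1" and 2: "sdist \<Theta>2"
  shows "sdist (\<lambda>f. \<Theta>1 f - \<Theta>2 f)"
proof -
  obtain M1 N1 A1 K1 where K1: "K1 \<ge> 0" "\<And>f D C. derivs_ok Xs nrm f D \<Longrightarrow> rapid D \<Longrightarrow> 0 \<le> C \<Longrightarrow>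
        (\<forall>\<beta>\<in>multi_idx N1. \<forall>x. W A1 x * nrm M1 (D \<beta> x) \<le> C) \<Longrightarrow> norm (\<Theta>1 f) \<le> K1 * C"
    using sdist_bound[OF 1] by blast
  obtain M2 N2 A2 K2 where K2: "K2 \<ge> 0" "\<And>f D C. derivs_ok Xs nrm f D \<Longrightarrow> rapid D \<Longrightarrow> 0 \<le> C \<Longrightarrow>
        (\<forall>\<beta>\<in>multi_idx N2. \<forall>x. W A2 x * nrm M2 (D \<beta> x) \<le> C) \<Longrightarrow> norm (\<Theta>2 f) \<le> K2 * C"
    using sdist_bound[OF 2] by blast
  \<comment> \<open>Norms, weights and index sets all grow with their parameter, so a bound at the
    maxima implies both individual bounds.\<close>
  define M N A where "M = max M1 M2" and "N = max N1 N2" and "A = max A1 A2"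
  have "norm (\<Theta>1 f - \<Theta>2 f) \<le> (K1 + K2) * C" if D: "derivs_ok Xs nrm f D" "rapid D" "0 \<le> C"
    and le: "\<forall>\<beta>\<in>multi_idx N. \<forall>x::real^'n. W A x * nrm M (D \<beta> x) \<le> C" for f D C
  proof -
    have "W A' x * nrm M' (D \<beta> x) \<le> C" if "A' \<le> A" "M' \<le> M" "N' \<le> N" "\<beta> \<in> multi_idx N'" for A' M' N' \<beta> x
    proof -
      have "W A' x * nrm M' (D \<beta> x) \<le> W A x * nrm M (D \<beta> x)"
        by (intro mult_mono W_mono nrm_mono that derivs_okD(2)[OF D(1)]) (simp_all add: derivs_okD(2)[OF D(1)])
      moreover have \<beta>: "\<beta> \<in> multi_idx N" using that by (auto simp: multi_idx_def)
      moreover have "W A x * nrm M (D \<beta> x) \<le> C" by (rule le[rule_format, OF \<beta>])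
      ultimately show ?thesis by linarith
    qed
    note le' = this
    have "norm (\<Theta>1 f) \<le> K1 * C"
      by (intro K1(2)[OF D] ballI allI le'[of _ _ N1]) (simp_all add: M_def N_def A_def)
    moreover have "norm (\<Theta>2 f) \<le> K2 * C"
      by (intro K2(2)[OF D] ballI allI le'[of _ _ N2]) (simp_all add: M_def N_def A_def)
    ultimately show ?thesis using norm_triangle_ineq4[of "\<Theta>1 f" "\<Theta>2 f"] by (simp add: algebra_simps)
  qed
  moreover have "\<Theta>1 (\<lambda>x. f x + g x) - \<Theta>2 (\<lambda>x. f x + g x) = (\<Theta>1 f - \<Theta>2 f) + (\<Theta>1 g - \<Theta>2 g)"
    if "schwartzX Xs nrm f" "schwartzX Xs nrm g" for f g
    using sdist_add[OF 1 that] sdist_add[OF 2 that] by simp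
  moreover have "\<Theta>1 (\<lambda>x. cs c (f x)) - \<Theta>2 (\<lambda>x. cs c (f x)) = c * (\<Theta>1 f - \<Theta>2 f)"
    if "schwartzX Xs nrm f" for c f
    using sdist_cs[OF 1 that] sdist_cs[OF 2 that] by (simp add: algebra_simps)
  ultimately show ?thesis using K1(1) K2(1)
    by (intro sdistI[of "\<lambda>f. \<Theta>1 f - \<Theta>2 f" "K1 + K2" N A M]) auto
qed

lemma sdist_minus_sum:
  fixes \<Theta> :: "(real^'n::finite \<Rightarrow> 'b) \<Rightarrow> complex"
  assumes "sdist \<Theta>" "\<And>k. k \<in> S \<Longrightarrow> sdist (\<Theta>' k)"
  shows "sdist (\<lambda>f. \<Theta> f - (\<Sum>k\<in>S. \<Theta>' k f))"
  using assms(2)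
proof (induction S rule: infinite_finite_induct)
  case (insert a S)
  have "sdist (\<lambda>f. (\<Theta> f - (\<Sum>k\<in>S. \<Theta>' k f)) - \<Theta>' a f)"
    using insert.prems by (intro sdist_minus[OF insert.IH]) auto
  then show ?case using insert by (simp add: algebra_simps)
qed (use assms(1) in auto)

lemma dualXD:
  assumes "dualX Xs nrm J C"
  shows "x \<in> X \<Longrightarrow> y \<in> X \<Longrightarrow> C (x + y) = C x + C y" "x \<in> X \<Longrightarrow> C (cs c x) = c * C x"
    "x \<in> X \<Longrightarrow> y \<in> X \<Longrightarrow> C (x - y) = C x - C y"
proof -
  show 1: "x \<in> X \<Longrightarrow> y \<in> X \<Longrightarrow> C (x + y) = C x + C y" for x y using assms by (auto simp: dualX_def)
  show 2: "x \<in> X \<Longrightarrow> C (cs c x) = c * C x" for c x using assms by (auto simp: dualX_def)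
  show "x \<in> X \<Longrightarrow> y \<in> X \<Longrightarrow> C (x - y) = C x - C y"
    using 1[of x "cs (-1) y"] 2[of y "-1"] X_cs[of y "-1"] by (simp add: cs_minus_left)
qed

text \<open>Applying \<open>C\<close> pointwise turns the vector-valued pairing into a scalar
  Lebesgue integral. Since \<open>C\<close> is bounded by one norm, the integrand is continuous and
  dominated by a multiple of \<open>inverse ((W 1 y)\<^sup>2)\<close>.\<close>

lemma sdist_integral:
  fixes k :: "real^'n::finite \<Rightarrow> complex"
  assumes C: "dualX Xs nrm J C" and k: "continuous_on UNIV k" "\<And>x. norm (k x) \<le> B"
  shows "sdist (\<lambda>g. \<integral>y. C (g y) * k y \<partial>lborel)"
    and "schwartzX Xs nrm g \<Longrightarrow> integrable lborel (\<lambda>y. C (g y) * k y)"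
proof -
  obtain M c' where "\<And>x. x \<in> X \<Longrightarrow> norm (C x) \<le> c' * nrm M x" using C unfolding dualX_def by blast
  then have c: "norm (C x) \<le> \<bar>c'\<bar> * nrm M x" if "x \<in> X" for x
    using that mult_right_mono[OF abs_ge_self nrm_nonneg[OF that], of c' M]
    by (auto intro: order_trans)
  have B: "B \<ge> 0" using k(2)[of 0] norm_ge_zero order_trans by blast
  let ?I = "\<integral>x. inverse ((W 1 (x::real^'n))\<^sup>2) \<partial>lborel"
  have main: "integrable lborel (\<lambda>y. C (f y) * k y) \<and> norm (\<integral>y. C (f y) * k y \<partial>lborel) \<le> (\<bar>c'\<bar> * B * ?I) * K"
    if D: "derivs_ok Xs nrm f D" "rapid D" and K: "\<forall>x. W 2 x * nrm M (D (\<lambda>_. 0) x) \<le> K" for f D K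
  proof -
    have f: "f x \<in> X" for x using derivs_okD(1,2)[OF D(1)] by metis
    obtain L where L: "\<And>x y. nrm M (D (\<lambda>_. 0) x - D (\<lambda>_. 0) y) \<le> L * (\<Sum>i\<in>UNIV. \<bar>x $ i - y $ i\<bar>)"
      using rapid_continuous[OF D] by blast
    have "continuous_on UNIV (\<lambda>y. C (f y))"
    proof (rule continuous_of_lipschitz)
      fix x y
      have "norm (C (f x) - C (f y)) \<le> \<bar>c'\<bar> * nrm M (f x - f y)"
        using c[of "f x - f y"] dualXD(3)[OF C f f] f by auto
      also have "\<dots> \<le> \<bar>c'\<bar> * (L * (\<Sum>i\<in>UNIV. \<bar>x $ i - y $ i\<bar>))"
        using L derivs_okD(1)[OF D(1)] by (intro mult_left_mono) auto
      finally show "norm (C (f x) - C (f y)) \<le> (\<bar>c'\<bar> * L) * (\<Sum>i\<in>UNIV. \<bar>x $ i - y $ i\<bar>)" by simp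
    qed
    then have m: "(\<lambda>y. C (f y) * k y) \<in> borel_measurable borel"
      by (intro borel_measurable_continuous_onI continuous_on_mult k)
    have le: "norm (C (f y) * k y) \<le> (\<bar>c'\<bar> * B * K) * inverse ((W 1 y)\<^sup>2)" for y
    proof -
      have W: "W 2 y = (W 1 y)\<^sup>2" using W_add[of 1 1 y] by (simp add: power2_eq_square numeral_2_eq_2)
      have "nrm M (f y) \<le> K * inverse ((W 1 y)\<^sup>2)"
        using K[rule_format, of y] zero_less_power[OF W_pos[of 1 y], of 2]
        by (simp add: W derivs_okD(1)[OF D(1)] divide_inverse[symmetric] pos_le_divide_eq mult.commute del: One_nat_def)
      then have "(\<bar>c'\<bar> * nrm M (f y)) * B \<le> (\<bar>c'\<bar> * (K * inverse ((W 1 y)\<^sup>2))) * B"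
        using B by (intro mult_right_mono mult_left_mono) auto
      moreover have "norm (C (f y) * k y) \<le> (\<bar>c'\<bar> * nrm M (f y)) * B"
        unfolding norm_mult using c[OF f] k(2) f by (intro mult_mono) auto
      ultimately show ?thesis by (simp add: mult_ac)
    qed
    have i: "integrable lborel (\<lambda>y. (\<bar>c'\<bar> * B * K) * inverse ((W 1 (y::real^'n))\<^sup>2))"
      by (intro integrable_mult_right integrable_inverse_W)
    have int: "integrable lborel (\<lambda>y. C (f y) * k y)"
      by (rule Bochner_Integration.integrable_bound[OF i]) (use m le order_trans[OF le abs_ge_self] in auto)
    have "norm (\<integral>y. C (f y) * k y \<partial>lborel) \<le> (\<integral>y. norm (C (f y) * k y) \<partial>lborel)" by simp
    also have "\<dots> \<le> (\<integral>y. (\<bar>c'\<bar> * B * K) * inverse ((W 1 (y::real^'n))\<^sup>2) \<partial>lborel)"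
      by (intro integral_mono integrable_norm int i le)
    finally show ?thesis using int by (simp add: mult_ac)
  qed
  show int: "integrable lborel (\<lambda>y. C (g y) * k y)" if g: "schwartzX Xs nrm g" for g
  proof -
    obtain D where D: "derivs_ok Xs nrm g D" "rapid D" using g unfolding schwartzX_iff_rapid by blast
    obtain K where "\<forall>x. W 2 x * nrm M (D (\<lambda>_. 0) x) \<le> K" using D(2) unfolding rapid_def by blast
    from main[OF D this] show ?thesis by blast
  qed
  show "sdist (\<lambda>g. \<integral>y. C (g y) * k y \<partial>lborel)"
  proof (rule sdistI[of _ "\<bar>c'\<bar> * B * ?I" 0 2 M])
    show "0 \<le> \<bar>c'\<bar> * B * ?I" using B by simp
  next
    fix f C' and D :: "('n \<Rightarrow> nat) \<Rightarrow> real^'n \<Rightarrow> 'b"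
    assume D: "derivs_ok Xs nrm f D" "rapid D" and "\<forall>\<beta>\<in>multi_idx 0. \<forall>x. W 2 x * nrm M (D \<beta> x) \<le> C'"
    then have "\<forall>x. W 2 x * nrm M (D (\<lambda>_. 0) x) \<le> C'" by (simp add: multi_idx_def)
    from main[OF D this] show "norm (\<integral>y. C (f y) * k y \<partial>lborel) \<le> (\<bar>c'\<bar> * B * ?I) * C'" by blast
  next
    fix f g :: "real^'n \<Rightarrow> 'b" assume fg: "schwartzX Xs nrm f" "schwartzX Xs nrm g"
    have "(\<lambda>y. C (f y + g y) * k y) = (\<lambda>y. C (f y) * k y + C (g y) * k y)"
      using dualXD(1)[OF C schwartz_X[OF fg(1)] schwartz_X[OF fg(2)]] by (auto simp: algebra_simps)
    then show "(\<integral>y. C (f y + g y) * k y \<partial>lborel) = (\<integral>y. C (f y) * k y \<partial>lborel) + (\<integral>y. C (g y) * k y \<partial>lborel)"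
      using int[OF fg(1)] int[OF fg(2)] by simp
  next
    fix c and f :: "real^'n \<Rightarrow> 'b" assume f: "schwartzX Xs nrm f"
    have "(\<lambda>y. C (cs c (f y)) * k y) = (\<lambda>y. c * (C (f y) * k y))"
      using dualXD(2)[OF C schwartz_X[OF f]] by auto
    then show "(\<integral>y. C (cs c (f y)) * k y \<partial>lborel) = c * (\<integral>y. C (f y) * k y \<partial>lborel)"
      by simp
  qed
qed

lemma tensor_derivs_ok:
  fixes \<phi> :: "'n::finite \<Rightarrow> nat \<Rightarrow> real \<Rightarrow> complex"
  assumes \<phi>: "\<And>i. rapid1 (\<phi> i)" and v: "v \<in> X"
  shows "derivs_ok Xs nrm (\<lambda>x::real^'n. cs (\<Prod>i\<in>UNIV. \<phi> i 0 (x $ i)) v) (\<lambda>\<beta> x. cs (\<Prod>i\<in>UNIV. \<phi> i (\<beta> i) (x $ i)) v)"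
proof (intro derivs_okI)
  fix M \<beta> i s and x :: "real^'n"
  have 1: "((\<lambda>s. \<Prod>j\<in>UNIV. \<phi> j (\<beta> j) (vupd x i s $ j)) has_vector_derivative
     \<phi> i (Suc (\<beta> i)) s * (\<Prod>j\<in>UNIV - {i}. \<phi> j (\<beta> j) (x $ j))) (at s)"
    by (rule has_vector_derivative_prod_single) (use \<phi> in \<open>auto simp: rapid1_def\<close>)
  have 2: "\<phi> i (Suc (\<beta> i)) s * (\<Prod>j\<in>UNIV - {i}. \<phi> j (\<beta> j) (x $ j)) =
     (\<Prod>j\<in>UNIV. \<phi> j ((\<beta>(i := Suc (\<beta> i))) j) (vupd x i s $ j))"
    by (subst (2) prod.remove[of _ i]) (auto intro!: prod.cong arg_cong2[where f = "(*)"])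
  show "vderiv M (\<lambda>s. cs (\<Prod>j\<in>UNIV. \<phi> j (\<beta> j) (vupd x i s $ j)) v)
     (cs (\<Prod>j\<in>UNIV. \<phi> j ((\<beta>(i := Suc (\<beta> i))) j) (vupd x i s $ j)) v) s"
    by (rule vderiv_cs_const[OF v 1[unfolded 2]])
qed (use v in auto)

lemma tensor_weight:
  fixes \<phi> :: "'n::finite \<Rightarrow> real \<Rightarrow> complex"
  assumes "v \<in> X"
  shows "W A x * nrm M (cs (\<Prod>i\<in>UNIV. \<phi> i (x $ i)) v) = (\<Prod>i\<in>UNIV. (1 + \<bar>x $ i\<bar>) ^ A * norm (\<phi> i (x $ i))) * nrm M v"
  by (simp add: nrm_cs assms W_def prod.distrib prod_norm mult_ac)

lemma tensor_weight_le:
  fixes \<phi> :: "'n::finite \<Rightarrow> real \<Rightarrow> complex"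
  assumes "v \<in> X" "\<And>i s. (1 + \<bar>s\<bar>) ^ A * norm (\<phi> i s) \<le> C i"
  shows "W A x * nrm M (cs (\<Prod>i\<in>UNIV. \<phi> i (x $ i)) v) \<le> (\<Prod>i\<in>UNIV. C i) * nrm M v"
  unfolding tensor_weight[OF assms(1)]
  using assms by (intro mult_right_mono prod_mono conjI) auto

lemma tensor_rapid:
  fixes \<phi> :: "'n::finite \<Rightarrow> nat \<Rightarrow> real \<Rightarrow> complex"
  assumes \<phi>: "\<And>i. rapid1 (\<phi> i)" and v: "v \<in> X"
  shows "rapid (\<lambda>\<beta> (x::real^'n). cs (\<Prod>i\<in>UNIV. \<phi> i (\<beta> i) (x $ i)) v)"
  unfolding rapid_def
proof (intro allI)
  fix M A \<beta>
  have "\<forall>i. \<exists>C. \<forall>s. (1 + \<bar>s\<bar>) ^ A * norm (\<phi> i (\<beta> i) s) \<le> C"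
    using \<phi> by (auto simp: rapid1_def)
  then obtain C where "\<And>i s. (1 + \<bar>s\<bar>) ^ A * norm (\<phi> i (\<beta> i) s) \<le> C i" by metis
  from tensor_weight_le[where \<phi> = "\<lambda>i. \<phi> i (\<beta> i)", OF v this]
  show "\<exists>C. \<forall>x::real^'n. W A x * nrm M (cs (\<Prod>i\<in>UNIV. \<phi> i (\<beta> i) (x $ i)) v) \<le> C" by blast
qed

text \<open>With the \<open>i\<close>-th variable of \<open>h\<close> frozen at \<open>y\<close>,
  derivatives in direction \<open>i\<close> fall only on \<open>\<phi>\<close> and the remaining
  ones only on \<open>h\<close>. Such slices are the terms of the Riemann sums that approximate
  \<open>h\<close> in coordinate \<open>i\<close>.\<close>

lemma slice_derivs_ok:
  fixes D :: "('n \<Rightarrow> nat) \<Rightarrow> real^'n::finite \<Rightarrow> 'b"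
  assumes \<phi>: "rapid1 \<phi>" and D: "derivs_ok Xs nrm h D"
  shows "derivs_ok Xs nrm (\<lambda>x. cs (\<phi> 0 (x $ i)) (h (vupd x i y))) (\<lambda>\<beta> x. cs (\<phi> (\<beta> i) (x $ i)) (D (\<beta>(i := 0)) (vupd x i y)))"
proof (intro derivs_okI)
  have "(\<lambda>_. 0 :: nat)(i := 0) = (\<lambda>_. 0)" by auto
  then show "(\<lambda>x. cs (\<phi> 0 (x $ i)) (D ((\<lambda>_. 0)(i := 0)) (vupd x i y))) = (\<lambda>x. cs (\<phi> 0 (x $ i)) (h (vupd x i y)))"
    using derivs_okD(1)[OF D] by simp
  fix M \<beta> j x s
  show "vderiv M (\<lambda>s. cs (\<phi> (\<beta> i) (vupd x j s $ i)) (D (\<beta>(i := 0)) (vupd (vupd x j s) i y)))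
     (cs (\<phi> ((\<beta>(j := Suc (\<beta> j))) i) (vupd x j s $ i)) (D ((\<beta>(j := Suc (\<beta> j)))(i := 0)) (vupd (vupd x j s) i y))) s"
  proof (cases "j = i")
    case True
    have "(\<phi> (\<beta> i) has_vector_derivative \<phi> (Suc (\<beta> i)) s) (at s)" using \<phi> by (simp add: rapid1_def)
    then show ?thesis unfolding True using vderiv_cs_const[OF derivs_okD(2)[OF D]] by simp
  next
    case False
    have "vderiv M (\<lambda>s. cs (\<phi> (\<beta> i) (x $ i)) (D (\<beta>(i := 0)) (vupd (vupd x i y) j s)))
      (cs 0 (D (\<beta>(i := 0)) (vupd (vupd x i y) j s)) + cs (\<phi> (\<beta> i) (x $ i)) (D ((\<beta>(i := 0))(j := Suc ((\<beta>(i := 0)) j))) (vupd (vupd x i y) j s))) s"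
      by (rule vderiv_cs[OF _ _ _ has_vector_derivative_const]) (rule derivs_okD[OF D])+
    moreover have "(\<beta>(j := Suc (\<beta> j)))(i := 0) = (\<beta>(i := 0))(j := Suc ((\<beta>(i := 0)) j))"
      using False by auto
    ultimately show ?thesis using False by (simp add: vupd_commute[OF False])
  qed
qed (use derivs_okD(2)[OF D] in auto)

lemma W_vupd: "W A x \<le> (1 + \<bar>x $ i\<bar>) ^ A * W A (vupd x i y)"
proof -
  have "W A x = (1 + \<bar>x $ i\<bar>) ^ A * (\<Prod>j\<in>UNIV - {i}. (1 + \<bar>x $ j\<bar>) ^ A)"
    unfolding W_def by (subst prod.remove[of _ i]) auto
  moreover have "W A (vupd x i y) = (1 + \<bar>y\<bar>) ^ A * (\<Prod>j\<in>UNIV - {i}. (1 + \<bar>x $ j\<bar>) ^ A)"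
    unfolding W_def by (subst prod.remove[of _ i]) auto
  moreover have "(\<Prod>j\<in>UNIV - {i}. (1 + \<bar>x $ j\<bar>) ^ A) \<le> (1 + \<bar>y\<bar>) ^ A * (\<Prod>j\<in>UNIV - {i}. (1 + \<bar>x $ j\<bar>) ^ A)"
  proof -
    have "1 * (\<Prod>j\<in>UNIV - {i}. (1 + \<bar>x $ j\<bar>) ^ A) \<le> (1 + \<bar>y\<bar>) ^ A * (\<Prod>j\<in>UNIV - {i}. (1 + \<bar>x $ j\<bar>) ^ A)"
      by (intro mult_right_mono) (auto intro!: prod_nonneg one_le_power)
    then show ?thesis by simp
  qed
  ultimately show ?thesis by (simp add: mult_left_mono)
qed

lemma slice_rapid:
  fixes D :: "('n \<Rightarrow> nat) \<Rightarrow> real^'n::finite \<Rightarrow> 'b"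
  assumes \<phi>: "rapid1 \<phi>" and D: "derivs_ok Xs nrm h D" and r: "rapid D"
  shows "rapid (\<lambda>\<beta> x. cs (\<phi> (\<beta> i) (x $ i)) (D (\<beta>(i := 0)) (vupd x i y)))"
  unfolding rapid_def
proof (intro allI)
  fix M A \<beta>
  obtain C where C: "\<And>s. (1 + \<bar>s\<bar>) ^ A * norm (\<phi> (\<beta> i) s) \<le> C" using \<phi> unfolding rapid1_def by blast
  obtain C' where C': "\<And>x. W A x * nrm M (D (\<beta>(i := 0)) x) \<le> C'" using r unfolding rapid_def by blast
  have "W A x * nrm M (cs (\<phi> (\<beta> i) (x $ i)) (D (\<beta>(i := 0)) (vupd x i y))) \<le> C * C'" for x
  proof -
    have "W A x * nrm M (cs (\<phi> (\<beta> i) (x $ i)) (D (\<beta>(i := 0)) (vupd x i y)))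
      \<le> ((1 + \<bar>x $ i\<bar>) ^ A * W A (vupd x i y)) * (norm (\<phi> (\<beta> i) (x $ i)) * nrm M (D (\<beta>(i := 0)) (vupd x i y)))"
      unfolding nrm_cs[OF derivs_okD(2)[OF D]]
      by (intro mult_right_mono W_vupd) (simp add: derivs_okD(2)[OF D])
    also have "\<dots> = ((1 + \<bar>x $ i\<bar>) ^ A * norm (\<phi> (\<beta> i) (x $ i))) * (W A (vupd x i y) * nrm M (D (\<beta>(i := 0)) (vupd x i y)))"
      by simp
    also have "\<dots> \<le> C * C'"
    proof (rule mult_mono[OF C C'])
      have "0 \<le> (1 + \<bar>x $ i\<bar>) ^ A * norm (\<phi> (\<beta> i) (x $ i))" by simp
      then show "0 \<le> C" using C[of "x $ i"] by linarith
    qed (simp add: derivs_okD(2)[OF D])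
    finally show ?thesis .
  qed
  then show "\<exists>C. \<forall>x. W A x * nrm M (cs (\<phi> (\<beta> i) (x $ i)) (D (\<beta>(i := 0)) (vupd x i y))) \<le> C" by blast
qed

end

section \<open>Gaussian test functions\<close>

text \<open>\<open>eta k m a z\<close> is the \<open>k\<close>-th derivative of \<open>x ^ m * exp (z * x - a * x\<^sup>2)\<close>.\<close>

primrec eta :: "nat \<Rightarrow> nat \<Rightarrow> complex \<Rightarrow> complex \<Rightarrow> real \<Rightarrow> complex" where
  "eta 0 = (\<lambda>m a z x. of_real x ^ m * exp (z * of_real x - a * (of_real x)\<^sup>2))"
| "eta (Suc k) = (\<lambda>m a z x. of_nat m * eta k (m - 1) a z x - 2 * a * eta k (Suc m) a z x + z * eta k m a z x)"

lemma eta_x: "(eta k m a z has_vector_derivative eta (Suc k) m a z x) (at x)"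
proof (induction k arbitrary: m)
  case 0
  have "((\<lambda>w. w ^ m * exp (z * w - a * w\<^sup>2)) has_field_derivative eta (Suc 0) m a z x) (at (of_real x))"
    by (auto intro!: derivative_eq_intros simp: algebra_simps power2_eq_square)
  from has_vector_derivative_real_field[OF this] show ?case by (simp add: o_def)
next
  case (Suc k)
  have "((\<lambda>x. of_nat m * eta k (m - 1) a z x - 2 * a * eta k (Suc m) a z x + z * eta k m a z x)
    has_vector_derivative eta (Suc (Suc k)) m a z x) (at x)"
    unfolding eta.simps(2)[of "Suc k"]
    by (intro has_vector_derivative_add has_vector_derivative_diff has_vector_derivative_mult_right Suc)
  then show ?case by simp
qed

text \<open>Differentiating in \<open>z\<close> multiplies by \<open>x\<close> before the
  derivatives in \<open>x\<close> are taken, so only the exponent \<open>m\<close> rises. The split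
  on \<open>m\<close> treats the truncated \<open>m - 1\<close>, whose coefficient vanishes at
  0.\<close>

lemma eta_z: "((\<lambda>z. eta k m a z x) has_field_derivative eta k (Suc m) a z x) (at z)"
proof (induction k arbitrary: m)
  case 0
  show ?case by (auto intro!: derivative_eq_intros)
next
  case (Suc k)
  show ?case
    by (auto intro!: derivative_eq_intros Suc simp: algebra_simps) (cases m; simp add: algebra_simps)
qed

lemma eta_a: "((\<lambda>a. eta k m a z x) has_field_derivative - eta k (Suc (Suc m)) a z x) (at a)"
proof (induction k arbitrary: m)
  case 0
  show ?case by (auto intro!: derivative_eq_intros simp: power2_eq_square)
next
  case (Suc k)
  show ?case
    by (auto intro!: derivative_eq_intros Suc simp: algebra_simps) (cases m; simp add: algebra_simps)
qed

text \<open>Each derivative costs at most one power of \<open>1 + \<bar>x\<bar>\<close> and one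
  factor depending on the parameters, while the exponential stays untouched. The dependence on
  \<open>a\<close> and \<open>z\<close> is kept explicit because both are varied later.\<close>

lemma eta_bound:
  "\<exists>c\<ge>0. \<forall>a z x. norm (eta k m a z x) \<le> c * ((1 + norm a) * (1 + norm z)) ^ k * (1 + \<bar>x\<bar>) ^ (m + k) * exp (Re (z * x - a * x\<^sup>2))"
proof (induction k arbitrary: m)
  case 0
  have "norm (eta 0 m a z x) \<le> 1 * ((1 + norm a) * (1 + norm z)) ^ 0 * (1 + \<bar>x\<bar>) ^ (m + 0) * exp (Re (z * x - a * x\<^sup>2))" for a z x
    by (simp add: norm_mult norm_power norm_exp_eq_Re power_mono)
  then show ?case by (intro exI[of _ 1]) simp
next
  case (Suc k)
  obtain c1 where c1: "c1 \<ge> 0" "\<And>a z x. norm (eta k (m - 1) a z x) \<le> c1 * ((1 + norm a) * (1 + norm z)) ^ k * (1 + \<bar>x\<bar>) ^ (m - 1 + k) * exp (Re (z * x - a * x\<^sup>2))"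
    using Suc[of "m - 1"] by blast
  obtain c2 where c2: "c2 \<ge> 0" "\<And>a z x. norm (eta k (Suc m) a z x) \<le> c2 * ((1 + norm a) * (1 + norm z)) ^ k * (1 + \<bar>x\<bar>) ^ (Suc m + k) * exp (Re (z * x - a * x\<^sup>2))"
    using Suc[of "Suc m"] by blast
  obtain c3 where c3: "c3 \<ge> 0" "\<And>a z x. norm (eta k m a z x) \<le> c3 * ((1 + norm a) * (1 + norm z)) ^ k * (1 + \<bar>x\<bar>) ^ (m + k) * exp (Re (z * x - a * x\<^sup>2))"
    using Suc[of m] by blast
  have "norm (eta (Suc k) m a z x) \<le> (real m * c1 + 2 * c2 + c3) * ((1 + norm a) * (1 + norm z)) ^ Suc k * (1 + \<bar>x\<bar>) ^ (m + Suc k) * exp (Re (z * x - a * x\<^sup>2))" for a z x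
  proof -
    define Q where "Q = (1 + norm a) * (1 + norm z)"
    define E where "E = exp (Re (z * x - a * x\<^sup>2))"
    have Qe: "Q = 1 + norm a + norm z + norm a * norm z" by (simp add: Q_def algebra_simps)
    have Q: "1 \<le> Q" "norm a \<le> Q" "norm z \<le> Q" unfolding Qe by auto
    let ?R = "Q ^ Suc k * (1 + \<bar>x\<bar>) ^ (m + Suc k) * E"
    have E: "0 \<le> E" by (simp add: E_def)
    have lift: "q * (c * Q ^ k * (1 + \<bar>x\<bar>) ^ l * E) \<le> c * ?R" if "0 \<le> q" "q \<le> Q" "0 \<le> c" "l \<le> m + Suc k" for q c l
    proof -
      have "(q * Q ^ k) * ((1 + \<bar>x\<bar>) ^ l * (c * E)) \<le> (Q * Q ^ k) * ((1 + \<bar>x\<bar>) ^ (m + Suc k) * (c * E))"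
        using that E Q by (intro mult_mono mult_nonneg_nonneg power_increasing) auto
      then show ?thesis by (simp add: mult_ac)
    qed
    have "norm (eta (Suc k) m a z x) \<le> norm (of_nat m * eta k (m - 1) a z x) + norm (2 * a * eta k (Suc m) a z x) + norm (z * eta k m a z x)"
      unfolding eta.simps by (meson norm_triangle_ineq norm_triangle_ineq4 add_mono order_trans order_refl)
    also have "\<dots> = real m * norm (eta k (m - 1) a z x) + 2 * (norm a * norm (eta k (Suc m) a z x)) + norm z * norm (eta k m a z x)"
      by (simp add: norm_mult)
    also have "\<dots> \<le> real m * (c1 * ?R) + 2 * (c2 * ?R) + c3 * ?R"
    proof (intro add_mono mult_left_mono)
      show "norm (eta k (m - 1) a z x) \<le> c1 * ?R"
        using order_trans[OF mult_left_mono[OF c1(2)[of a z x, folded Q_def E_def], of 1] lift[of 1 c1 "m - 1 + k"]] Q c1 by simp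
      show "norm a * norm (eta k (Suc m) a z x) \<le> c2 * ?R"
        using order_trans[OF mult_left_mono[OF c2(2)[of a z x, folded Q_def E_def], of "norm a"] lift[of "norm a" c2 "Suc m + k"]] Q c2 by simp
      show "norm z * norm (eta k m a z x) \<le> c3 * ?R"
        using order_trans[OF mult_left_mono[OF c3(2)[of a z x, folded Q_def E_def], of "norm z"] lift[of "norm z" c3 "m + k"]] Q c3 by simp
    qed auto
    also have "\<dots> = (real m * c1 + 2 * c2 + c3) * Q ^ Suc k * (1 + \<bar>x\<bar>) ^ (m + Suc k) * E"
      by (simp add: algebra_simps)
    finally show ?thesis by (simp add: Q_def E_def)
  qed
  then show ?case using c1 c2 c3 by (intro exI[of _ "real m * c1 + 2 * c2 + c3"]) auto
qed

text \<open>Since \<open>1 + \<bar>u\<bar> \<le> exp \<bar>u\<bar>\<close>, it suffices to maximise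
  \<open>n * \<bar>u\<bar> - \<alpha> * u\<^sup>2\<close>, which a completed square does.\<close>

lemma poly_gauss_bound:
  fixes u :: real
  assumes "\<alpha> > 0"
  shows "(1 + \<bar>u\<bar>) ^ n * exp (- \<alpha> * u\<^sup>2) \<le> exp ((real n)\<^sup>2 / (4 * \<alpha>))"
proof -
  have "(1 + \<bar>u\<bar>) ^ n \<le> exp \<bar>u\<bar> ^ n" by (intro power_mono) (auto simp: exp_ge_add_one_self)
  also have "\<dots> = exp (real n * \<bar>u\<bar>)" by (simp add: exp_of_nat_mult)
  finally have "(1 + \<bar>u\<bar>) ^ n * exp (- \<alpha> * u\<^sup>2) \<le> exp (real n * \<bar>u\<bar>) * exp (- \<alpha> * u\<^sup>2)"
    by (intro mult_right_mono) auto
  also have "\<dots> = exp (real n * \<bar>u\<bar> - \<alpha> * u\<^sup>2)" by (simp add: exp_add[symmetric])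
  also have "\<dots> \<le> exp ((real n)\<^sup>2 / (4 * \<alpha>))"
  proof -
    have "0 \<le> (real n - 2 * \<alpha> * \<bar>u\<bar>)\<^sup>2" by simp
    then have "4 * \<alpha> * (real n * \<bar>u\<bar> - \<alpha> * u\<^sup>2) \<le> (real n)\<^sup>2"
      by (simp add: power2_diff algebra_simps power2_eq_square)
    then show ?thesis using assms by (simp add: field_simps)
  qed
  finally show ?thesis .
qed

text \<open>Half of the decay \<open>\<alpha> * x\<^sup>2\<close> absorbs the linear exponent at a
  cost of \<open>B\<^sup>2 / (2 * \<alpha>)\<close>, and the other half absorbs the polynomial.
  Uniformity in the parameters is what permits differentiation under a functional.\<close>

lemma eta_local_bound:
  assumes \<alpha>: "\<alpha> > 0"
  shows "\<exists>C. \<forall>a z x. \<alpha> \<le> Re a \<longrightarrow> norm a \<le> B \<longrightarrow> norm z \<le> B \<longrightarrow> (1 + \<bar>x\<bar>) ^ A * norm (eta k m a z x) \<le> C"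
proof -
  obtain c where c: "c \<ge> 0" "\<And>a z x. norm (eta k m a z x) \<le> c * ((1 + norm a) * (1 + norm z)) ^ k * (1 + \<bar>x\<bar>) ^ (m + k) * exp (Re (z * x - a * x\<^sup>2))"
    using eta_bound by blast
  define C where "C = c * ((1 + B) * (1 + B)) ^ k * (exp ((real (A + (m + k)))\<^sup>2 / (4 * (\<alpha> / 2))) * exp (B\<^sup>2 / (2 * \<alpha>)))"
  have "(1 + \<bar>x\<bar>) ^ A * norm (eta k m a z x) \<le> C" if a: "\<alpha> \<le> Re a" "norm a \<le> B" "norm z \<le> B" for a z x
  proof -
    have B: "B \<ge> 0" using a norm_ge_zero order_trans by blast
    have "Re (z * x - a * x\<^sup>2) \<le> (- (\<alpha> / 2) * x\<^sup>2) + B\<^sup>2 / (2 * \<alpha>)"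
    proof -
      have "Re (z * x - a * x\<^sup>2) = Re z * x - Re a * x\<^sup>2" by (simp add: power2_eq_square)
      moreover have "Re z * x \<le> B * \<bar>x\<bar>"
      proof -
        have "Re z * x \<le> \<bar>Re z\<bar> * \<bar>x\<bar>" by (metis abs_ge_self abs_mult)
        also have "\<dots> \<le> B * \<bar>x\<bar>" using abs_Re_le_cmod[of z] a by (intro mult_right_mono) auto
        finally show ?thesis .
      qed
      moreover have "\<alpha> * x\<^sup>2 \<le> Re a * x\<^sup>2" using a by (intro mult_right_mono) auto
      moreover have "B * \<bar>x\<bar> - \<alpha> / 2 * x\<^sup>2 \<le> B\<^sup>2 / (2 * \<alpha>)"
      proof -
        have "0 \<le> (B - \<alpha> * \<bar>x\<bar>)\<^sup>2" by simp
        then have "2 * \<alpha> * (B * \<bar>x\<bar> - \<alpha> / 2 * x\<^sup>2) \<le> B\<^sup>2"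
          by (simp add: power2_diff power_mult_distrib algebra_simps power2_eq_square)
        then show ?thesis using \<alpha> by (simp add: field_simps)
      qed
      ultimately show ?thesis by simp
    qed
    then have e: "exp (Re (z * x - a * x\<^sup>2)) \<le> exp (- (\<alpha> / 2) * x\<^sup>2) * exp (B\<^sup>2 / (2 * \<alpha>))"
      by (simp add: exp_add[symmetric])
    have "(1 + \<bar>x\<bar>) ^ A * norm (eta k m a z x) \<le> (1 + \<bar>x\<bar>) ^ A * (c * ((1 + norm a) * (1 + norm z)) ^ k * (1 + \<bar>x\<bar>) ^ (m + k) * exp (Re (z * x - a * x\<^sup>2)))"
      using c by (intro mult_left_mono) auto
    also have "\<dots> = (c * ((1 + norm a) * (1 + norm z)) ^ k) * ((1 + \<bar>x\<bar>) ^ (A + (m + k)) * exp (Re (z * x - a * x\<^sup>2)))"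
      by (simp add: power_add mult_ac)
    also have "\<dots> \<le> (c * ((1 + B) * (1 + B)) ^ k) * ((1 + \<bar>x\<bar>) ^ (A + (m + k)) * (exp (- (\<alpha> / 2) * x\<^sup>2) * exp (B\<^sup>2 / (2 * \<alpha>))))"
      using c e a B by (intro mult_mono power_mono mult_nonneg_nonneg order_refl) auto
    also have "\<dots> = (c * ((1 + B) * (1 + B)) ^ k) * (((1 + \<bar>x\<bar>) ^ (A + (m + k)) * exp (- (\<alpha> / 2) * x\<^sup>2)) * exp (B\<^sup>2 / (2 * \<alpha>)))"
      by (simp only: mult_ac)
    also have "\<dots> \<le> C"
      unfolding C_def using c \<alpha> B poly_gauss_bound[of "\<alpha> / 2" x "A + (m + k)"]
      by (intro mult_left_mono mult_right_mono) auto
    finally show ?thesis .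
  qed
  then show ?thesis by blast
qed

text \<open>Here the exponent in \<open>Re z\<close> must be sharp, so the Gaussian is centred at
  its peak \<open>Re z / (2 * \<alpha>)\<close> and none of its exponential gain is given away:
  moving the weight to the peak costs only powers of \<open>1 + norm z\<close>.\<close>

lemma eta_growth:
  assumes \<alpha>: "\<alpha> > 0"
  shows "\<exists>C\<ge>0. \<forall>z x. (1 + \<bar>x\<bar>) ^ A * norm (eta k 0 (of_real \<alpha>) z x) \<le> C * (1 + norm z) ^ (2 * k + A) * exp ((Re z)\<^sup>2 / (4 * \<alpha>))"
proof -
  obtain c where c: "c \<ge> 0" "\<And>a z x. norm (eta k 0 a z x) \<le> c * ((1 + norm a) * (1 + norm z)) ^ k * (1 + \<bar>x\<bar>) ^ (0 + k) * exp (Re (z * x - a * x\<^sup>2))"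
    using eta_bound by blast
  define D where "D = exp ((real (A + k))\<^sup>2 / (4 * \<alpha>))"
  define C where "C = c * (1 + \<alpha>) ^ k * ((1 + 1 / (2 * \<alpha>)) ^ (A + k) * D)"
  have D: "D \<ge> 0" by (simp add: D_def)
  have "(1 + \<bar>x\<bar>) ^ A * norm (eta k 0 (of_real \<alpha>) z x) \<le> C * (1 + norm z) ^ (2 * k + A) * exp ((Re z)\<^sup>2 / (4 * \<alpha>))" for z x
  proof -
    define w where "w = Re z / (2 * \<alpha>)"
    let ?E = "exp ((Re z)\<^sup>2 / (4 * \<alpha>))"
    have "Re (z * x - of_real \<alpha> * x\<^sup>2) = - \<alpha> * (x - w)\<^sup>2 + (Re z)\<^sup>2 / (4 * \<alpha>)"
      using \<alpha> by (simp add: w_def power2_eq_square field_simps)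
    then have e: "exp (Re (z * x - of_real \<alpha> * x\<^sup>2)) = exp (- \<alpha> * (x - w)\<^sup>2) * ?E"
      by (simp only: exp_add)
    have "\<bar>w\<bar> \<le> norm z / (2 * \<alpha>)" using abs_Re_le_cmod[of z] \<alpha> by (simp add: w_def divide_right_mono)
    then have "1 + \<bar>w\<bar> \<le> (1 + 1 / (2 * \<alpha>)) * (1 + norm z)"
    proof -
      have "(1 + 1 / (2 * \<alpha>)) * (1 + norm z) = 1 + norm z + 1 / (2 * \<alpha>) + norm z / (2 * \<alpha>)"
        by (simp add: algebra_simps add_divide_distrib)
      moreover have "0 \<le> norm z" "0 \<le> 1 / (2 * \<alpha>)" using \<alpha> by auto
      ultimately show ?thesis using \<open>\<bar>w\<bar> \<le> norm z / (2 * \<alpha>)\<close> by linarith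
    qed
    then have w: "(1 + \<bar>w\<bar>) ^ (A + k) \<le> ((1 + 1 / (2 * \<alpha>)) * (1 + norm z)) ^ (A + k)"
      by (intro power_mono) auto
    have "(1 + \<bar>x\<bar>) ^ (A + k) \<le> ((1 + \<bar>x - w\<bar>) * (1 + \<bar>w\<bar>)) ^ (A + k)"
      using one_plus_abs_add_le[of "x - w" w] by (intro power_mono) auto
    then have "(1 + \<bar>x\<bar>) ^ (A + k) * exp (- \<alpha> * (x - w)\<^sup>2) \<le> ((1 + \<bar>x - w\<bar>) * (1 + \<bar>w\<bar>)) ^ (A + k) * exp (- \<alpha> * (x - w)\<^sup>2)"
      by (intro mult_right_mono) auto
    also have "\<dots> = ((1 + \<bar>x - w\<bar>) ^ (A + k) * exp (- \<alpha> * (x - w)\<^sup>2)) * (1 + \<bar>w\<bar>) ^ (A + k)"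
      by (simp add: power_mult_distrib)
    also have "\<dots> \<le> D * ((1 + 1 / (2 * \<alpha>)) * (1 + norm z)) ^ (A + k)"
      unfolding D_def by (intro mult_mono poly_gauss_bound[OF \<alpha>] w) auto
    finally have p: "(1 + \<bar>x\<bar>) ^ (A + k) * exp (- \<alpha> * (x - w)\<^sup>2) \<le> D * ((1 + 1 / (2 * \<alpha>)) * (1 + norm z)) ^ (A + k)" .
    have "(1 + \<bar>x\<bar>) ^ A * norm (eta k 0 (of_real \<alpha>) z x) \<le> (1 + \<bar>x\<bar>) ^ A * (c * ((1 + norm (complex_of_real \<alpha>)) * (1 + norm z)) ^ k * (1 + \<bar>x\<bar>) ^ (0 + k) * exp (Re (z * x - of_real \<alpha> * x\<^sup>2)))"
      using c(1) c(2)[of "of_real \<alpha>" z x] by (intro mult_left_mono) simp_all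
    also have "\<dots> = (c * ((1 + \<alpha>) * (1 + norm z)) ^ k * ?E) * ((1 + \<bar>x\<bar>) ^ (A + k) * exp (- \<alpha> * (x - w)\<^sup>2))"
      unfolding e using \<alpha> by (simp add: power_add mult_ac)
    also have "\<dots> \<le> (c * ((1 + \<alpha>) * (1 + norm z)) ^ k * ?E) * (D * ((1 + 1 / (2 * \<alpha>)) * (1 + norm z)) ^ (A + k))"
      using c \<alpha> by (intro mult_left_mono p) auto
    also have "\<dots> = C * (1 + norm z) ^ (2 * k + A) * ?E"
    proof -
      \<comment> \<open>\<open>k\<close> powers come from the derivatives and \<open>A + k\<close>
        from the weight transported to the peak.\<close>
      have "2 * k + A = k + (A + k)" by simp
      then have "(1 + norm z) ^ (2 * k + A) = (1 + norm z) ^ k * (1 + norm z) ^ (A + k)"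
        by (simp only: power_add)
      then show ?thesis by (simp add: C_def power_mult_distrib mult_ac)
    qed
    finally show ?thesis .
  qed
  moreover have "C \<ge> 0" unfolding C_def using c \<alpha> D by simp
  ultimately show ?thesis by blast
qed

lemma rapid1_eta:
  assumes "Re a > 0"
  shows "rapid1 (\<lambda>k. eta k m a z)"
  unfolding rapid1_def
proof (intro conjI allI)
  fix k A
  show "\<exists>C. \<forall>s. (1 + \<bar>s\<bar>) ^ A * norm (eta k m a z s) \<le> C"
    using eta_local_bound[OF assms, of "max (norm a) (norm z)" A k m] by (meson max.cobounded1 max.cobounded2 order_refl)
qed (rule eta_x)

lemma rapid1_diff:
  assumes "rapid1 f" "rapid1 g"
  shows "rapid1 (\<lambda>k x. f k x - g k x)"
  unfolding rapid1_def
proof (intro conjI allI)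
  fix k A
  obtain C C' where C: "\<And>s. (1 + \<bar>s\<bar>) ^ A * norm (f k s) \<le> C" "\<And>s. (1 + \<bar>s\<bar>) ^ A * norm (g k s) \<le> C'"
    using assms unfolding rapid1_def by meson
  have "(1 + \<bar>s\<bar>) ^ A * norm (f k s - g k s) \<le> C + C'" for s
  proof -
    have "(1 + \<bar>s\<bar>) ^ A * norm (f k s - g k s) \<le> (1 + \<bar>s\<bar>) ^ A * (norm (f k s) + norm (g k s))"
      by (intro mult_left_mono norm_triangle_ineq4) auto
    then show ?thesis using C[of s] by (simp add: algebra_simps)
  qed
  then show "\<exists>C. \<forall>s. (1 + \<bar>s\<bar>) ^ A * norm (f k s - g k s) \<le> C" by blast
qed (use assms in \<open>auto simp: rapid1_def intro!: has_vector_derivative_diff\<close>)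

lemma rapid1_cmult:
  assumes "rapid1 f"
  shows "rapid1 (\<lambda>k x. c * f k x)"
  unfolding rapid1_def
proof (intro conjI allI)
  fix k A
  obtain C where C: "\<And>s. (1 + \<bar>s\<bar>) ^ A * norm (f k s) \<le> C"
    using assms unfolding rapid1_def by meson
  have "(1 + \<bar>s\<bar>) ^ A * norm (c * f k s) \<le> norm c * C" for s
    using mult_left_mono[OF C[of s], of "norm c"] by (simp add: norm_mult mult_ac)
  then show "\<exists>C. \<forall>s. (1 + \<bar>s\<bar>) ^ A * norm (c * f k s) \<le> C" by blast
qed (use assms in \<open>auto simp: rapid1_def intro!: has_vector_derivative_mult_right\<close>)

lemma rapid1_bound_upto:
  assumes "rapid1 \<phi>"
  shows "\<exists>C\<ge>0. \<forall>k\<le>N. \<forall>s. (1 + \<bar>s\<bar>) ^ A * norm (\<phi> k s) \<le> C"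
proof -
  have "\<forall>k. \<exists>C. \<forall>s. (1 + \<bar>s\<bar>) ^ A * norm (\<phi> k s) \<le> C" using assms by (simp add: rapid1_def)
  then obtain C where C: "\<And>k s. (1 + \<bar>s\<bar>) ^ A * norm (\<phi> k s) \<le> C k" by metis
  have C0: "0 \<le> C k" for k
  proof -
    have "0 \<le> (1 + \<bar>0\<bar>) ^ A * norm (\<phi> k 0)" by simp
    then show ?thesis using C[of 0 k] by linarith
  qed
  have "(1 + \<bar>s\<bar>) ^ A * norm (\<phi> k s) \<le> sum C {..N}" if "k \<le> N" for k s
    using order_trans[OF C[of s k] member_le_sum[of k "{..N}" C]] that C0 by auto
  then show ?thesis using C0 by (intro exI[of _ "sum C {..N}"]) (auto intro: sum_nonneg)
qed

section \<open>Gaussian tensors as analytic functions of their parameters\<close>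

context frechet
begin

definition tens :: "('n \<Rightarrow> nat \<Rightarrow> real \<Rightarrow> complex) \<Rightarrow> 'b \<Rightarrow> real^'n::finite \<Rightarrow> 'b" where
  "tens \<phi> v = (\<lambda>x. cs (\<Prod>i\<in>UNIV. \<phi> i 0 (x $ i)) v)"

lemma schwartz_tens: "(\<And>i. rapid1 (\<phi> i)) \<Longrightarrow> v \<in> X \<Longrightarrow> schwartzX Xs nrm (tens \<phi> v)"
  unfolding tens_def by (rule rapid_schwartz[OF tensor_derivs_ok tensor_rapid])

text \<open>The bound is a product of one-variable bounds, so changing a single factor changes a
  single \<open>C i\<close>. Orders up to \<open>N\<close> in each variable suffice because every
  entry of a multi-index in \<open>multi_idx N\<close> is at most \<open>N\<close>.\<close>

lemma sdist_tens_bound: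
  fixes \<Theta> :: "(real^'n::finite \<Rightarrow> 'b) \<Rightarrow> complex"
  assumes "sdist \<Theta>"
  shows "\<exists>N A M K. K \<ge> 0 \<and> (\<forall>v \<phi> C. v \<in> X \<longrightarrow> (\<forall>i. rapid1 (\<phi> i)) \<longrightarrow>
      (\<forall>i. \<forall>k\<le>N. \<forall>s. (1 + \<bar>s\<bar>) ^ A * norm (\<phi> i k s) \<le> C i) \<longrightarrow>
      norm (\<Theta> (tens \<phi> v)) \<le> K * (\<Prod>i\<in>UNIV. C i) * nrm M v)"
proof -
  obtain M N A K where K: "K \<ge> 0" "\<And>f D C. derivs_ok Xs nrm f D \<Longrightarrow> rapid D \<Longrightarrow> 0 \<le> C \<Longrightarrow>
        (\<forall>\<beta>\<in>multi_idx N. \<forall>x. W A x * nrm M (D \<beta> x) \<le> C) \<Longrightarrow> norm (\<Theta> f) \<le> K * C"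
    using sdist_bound[OF assms] by blast
  have "norm (\<Theta> (tens \<phi> v)) \<le> K * (\<Prod>i\<in>UNIV. C i) * nrm M v"
    if v: "v \<in> X" and \<phi>: "\<And>i. rapid1 (\<phi> i)" and C: "\<And>i k s. k \<le> N \<Longrightarrow> (1 + \<bar>s\<bar>) ^ A * norm (\<phi> i k s) \<le> C i" for v \<phi> C
  proof -
    have C0: "C i \<ge> 0" for i
    proof -
      have "0 \<le> (1 + \<bar>0\<bar>) ^ A * norm (\<phi> i 0 0)" by simp
      then show ?thesis using C[of 0 0 i] by linarith
    qed
    have "norm (\<Theta> (tens \<phi> v)) \<le> K * ((\<Prod>i\<in>UNIV. C i) * nrm M v)"
      unfolding tens_def
    proof (rule K(2)[OF tensor_derivs_ok[OF \<phi> v] tensor_rapid[OF \<phi> v]])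
      show "0 \<le> (\<Prod>i\<in>UNIV. C i) * nrm M v" using C0 v by (intro mult_nonneg_nonneg prod_nonneg) auto
      show "\<forall>\<beta>\<in>multi_idx N. \<forall>x::real^'n. W A x * nrm M (cs (\<Prod>i\<in>UNIV. \<phi> i (\<beta> i) (x $ i)) v) \<le> (\<Prod>i\<in>UNIV. C i) * nrm M v"
      proof (intro ballI allI)
        fix \<beta> :: "'n \<Rightarrow> nat" and x :: "real^'n" assume "\<beta> \<in> multi_idx N"
        then have "\<beta> i \<le> N" for i using member_le_sum[of i UNIV \<beta>] by (simp add: multi_idx_def)
        then show "W A x * nrm M (cs (\<Prod>i\<in>UNIV. \<phi> i (\<beta> i) (x $ i)) v) \<le> (\<Prod>i\<in>UNIV. C i) * nrm M v"
          by (intro tensor_weight_le[where \<phi> = "\<lambda>i. \<phi> i (\<beta> i)"] v C)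
      qed
    qed
    then show ?thesis by (simp add: mult_ac)
  qed
  then have "\<forall>v \<phi> C. v \<in> X \<longrightarrow> (\<forall>i. rapid1 (\<phi> i)) \<longrightarrow>
      (\<forall>i. \<forall>k\<le>N. \<forall>s. (1 + \<bar>s\<bar>) ^ A * norm (\<phi> i k s) \<le> C i) \<longrightarrow>
      norm (\<Theta> (tens \<phi> v)) \<le> K * (\<Prod>i\<in>UNIV. C i) * nrm M v"
    by (intro allI impI) simp
  with K(1) show ?thesis by (intro exI conjI)
qed

lemma tens_upd:
  "tens (\<phi>(i := g)) v = (\<lambda>x. cs (g 0 (x $ i) * (\<Prod>j\<in>UNIV - {i}. \<phi> j 0 (x $ j))) v)"
  unfolding tens_def
  by (rule ext, subst prod.remove[of _ i]) (auto intro!: arg_cong[where f = "\<lambda>c. cs c v"] arg_cong2[where f = "(*)"] prod.cong)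

lemma tens_upd_diff: "tens (\<phi>(i := \<lambda>k x. f k x - g k x)) v = (\<lambda>x. tens (\<phi>(i := f)) v x - tens (\<phi>(i := g)) v x)"
  unfolding tens_upd by (simp add: cs_diff_left[symmetric] left_diff_distrib)

lemma tens_upd_cmult: "tens (\<phi>(i := \<lambda>k x. c * f k x)) v = (\<lambda>x. cs c (tens (\<phi>(i := f)) v x))"
  unfolding tens_upd by (simp add: cs_mult[symmetric] mult.assoc)

text \<open>The first-order Taylor remainder of \<open>f\<close> at \<open>s0\<close> is again an
  admissible one-variable factor, and the uniform weighted bounds on \<open>f''\<close> make it
  quadratically small in the finitely many orders that \<open>\<Theta>\<close> uses. Continuity of
  \<open>\<Theta>\<close> turns this into complex differentiability.\<close>

lemma sdist_tens_derivative:
  fixes \<Theta> :: "(real^'n::finite \<Rightarrow> 'b) \<Rightarrow> complex" and f f' f'' :: "nat \<Rightarrow> complex \<Rightarrow> real \<Rightarrow> complex"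
  assumes \<Theta>: "sdist \<Theta>" and v: "v \<in> X" and \<phi>: "\<And>j. rapid1 (\<phi> j)" and r: "r > 0"
    and f: "\<And>s. s \<in> ball s0 r \<Longrightarrow> rapid1 (\<lambda>k. f k s)" and f': "rapid1 (\<lambda>k. f' k s0)"
    and d: "\<And>k s x. s \<in> ball s0 r \<Longrightarrow> ((\<lambda>s. f k s x) has_field_derivative f' k s x) (at s)"
    and d': "\<And>k s x. s \<in> ball s0 r \<Longrightarrow> ((\<lambda>s. f' k s x) has_field_derivative f'' k s x) (at s)"
    and b: "\<And>k A. \<exists>C. \<forall>s\<in>ball s0 r. \<forall>x. (1 + \<bar>x\<bar>) ^ A * norm (f'' k s x) \<le> C"
  shows "((\<lambda>s. \<Theta> (tens (\<phi>(i := \<lambda>k. f k s)) v)) has_field_derivative \<Theta> (tens (\<phi>(i := \<lambda>k. f' k s0)) v)) (at s0)"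
proof -
  obtain N A M K where K0: "K \<ge> 0" and K1: "\<forall>v \<phi> C. v \<in> X \<longrightarrow> (\<forall>i. rapid1 (\<phi> i)) \<longrightarrow>
      (\<forall>i. \<forall>k\<le>N. \<forall>s. (1 + \<bar>s\<bar>) ^ A * norm (\<phi> i k s) \<le> C i) \<longrightarrow>
      norm (\<Theta> (tens \<phi> v)) \<le> K * (\<Prod>i\<in>UNIV. C i) * nrm M v"
    using sdist_tens_bound[OF \<Theta>] by (elim exE conjE)
  have K: "norm (\<Theta> (tens \<phi> v)) \<le> K * (\<Prod>i\<in>UNIV. C i) * nrm M v"
    if "v \<in> X" "\<And>i. rapid1 (\<phi> i)" "\<And>i k s. k \<le> N \<Longrightarrow> (1 + \<bar>s\<bar>) ^ A * norm (\<phi> i k s) \<le> C i" for v \<phi> C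
    using K1 that by simp
  have "\<forall>j. \<exists>C\<ge>0. \<forall>k\<le>N. \<forall>s. (1 + \<bar>s\<bar>) ^ A * norm (\<phi> j k s) \<le> C" using rapid1_bound_upto[OF \<phi>] by blast
  then obtain C where C: "\<And>j. C j \<ge> 0" "\<And>j k s. k \<le> N \<Longrightarrow> (1 + \<bar>s\<bar>) ^ A * norm (\<phi> j k s) \<le> C j" by metis
  have "\<forall>k. \<exists>C. \<forall>s\<in>ball s0 r. \<forall>x. (1 + \<bar>x\<bar>) ^ A * norm (f'' k s x) \<le> C" using b by simp
  then obtain B0 where "\<forall>k. \<forall>s\<in>ball s0 r. \<forall>x. (1 + \<bar>x\<bar>) ^ A * norm (f'' k s x) \<le> B0 k"
    by (rule choice[THEN exE])
  then have B0: "(1 + \<bar>x\<bar>) ^ A * norm (f'' k s x) \<le> B0 k" if "s \<in> ball s0 r" for k s x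
    using that by simp
  define B where "B = (\<Sum>k\<le>N. \<bar>B0 k\<bar>)"
  have B: "(1 + \<bar>x\<bar>) ^ A * norm (f'' k s x) \<le> B" if "k \<le> N" "s \<in> ball s0 r" for k s x
  proof -
    have "\<bar>B0 k\<bar> \<le> B" unfolding B_def using that by (intro member_le_sum) auto
    then show ?thesis using B0[OF that(2), of x k] by linarith
  qed
  define P where "P = (\<Prod>j\<in>UNIV - {i}. C j)"
  define L where "L = K * (B * P) * nrm M v"
  let ?F = "\<lambda>s. \<Theta> (tens (\<phi>(i := \<lambda>k. f k s)) v)"
  let ?F' = "\<Theta> (tens (\<phi>(i := \<lambda>k. f' k s0)) v)"
  have rem: "norm (?F s - ?F s0 - (s - s0) * ?F') \<le> L * (norm (s - s0))\<^sup>2" if s: "s \<in> ball s0 r" for s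
  proof -
    have s0: "s0 \<in> ball s0 r" using r by simp
    define g where "g = (\<lambda>k x. (f k s x - f k s0 x) - (s - s0) * f' k s0 x)"
    have rg: "rapid1 g" unfolding g_def
      by (intro rapid1_diff rapid1_cmult f f' s s0)
    have r1: "rapid1 ((\<phi>(i := h)) j)" if "rapid1 h" for h j using \<phi> that by simp
    have sch: "schwartzX Xs nrm (tens (\<phi>(i := h)) v)" if "rapid1 h" for h
      by (rule schwartz_tens[OF r1[OF that] v])
    have eq: "\<Theta> (tens (\<phi>(i := g)) v) = ?F s - ?F s0 - (s - s0) * ?F'"
      unfolding g_def tens_upd_diff tens_upd_cmult
      by (simp add: sdist_diff[OF \<Theta>] sdist_cs[OF \<Theta>] schwartz_diff schwartz_cs sch[OF f[OF s]] sch[OF f[OF s0]] sch[OF f'])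
    have "norm (\<Theta> (tens (\<phi>(i := g)) v)) \<le> K * (\<Prod>j\<in>UNIV. (C(i := B * (norm (s - s0))\<^sup>2)) j) * nrm M v"
    proof (rule K[OF v r1[OF rg]])
      fix j k x assume k: "k \<le> N"
      show "(1 + \<bar>x\<bar>) ^ A * norm ((\<phi>(i := g)) j k x) \<le> (C(i := B * (norm (s - s0))\<^sup>2)) j"
      proof (cases "j = i")
        case True
        have "norm (g k x) \<le> B / (1 + \<bar>x\<bar>) ^ A * norm (s - s0) ^ Suc 1 / fact 1"
        proof -
          \<comment> \<open>\<open>complex_Taylor\<close> expects an indexed sequence of
            derivatives; the relevant indices are 0, 1 and 2.\<close>
          define h where "h = (\<lambda>n s. if n = 0 then f k s x else if n = Suc 0 then f' k s x else f'' k s x)"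
          have "norm (h 0 s - (\<Sum>n\<le>1. h n s0 * (s - s0) ^ n / fact n)) \<le> B / (1 + \<bar>x\<bar>) ^ A * norm (s - s0) ^ Suc 1 / fact 1"
          proof (rule complex_Taylor[where S = "ball s0 r"])
            show "(h n has_field_derivative h (Suc n) z) (at z within ball s0 r)" if "z \<in> ball s0 r" "n \<le> 1" for n z
              using d[OF that(1), of k x] d'[OF that(1), of k x] that(2)
              by (cases n) (auto intro: has_field_derivative_at_within simp: h_def)
            show "norm (h (Suc 1) z) \<le> B / (1 + \<bar>x\<bar>) ^ A" if "z \<in> ball s0 r" for z
              using B[OF k that, of x] by (simp add: h_def pos_le_divide_eq add_pos_nonneg mult.commute)
          qed (use s s0 in auto)
          then show ?thesis by (simp add: g_def h_def algebra_simps)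
        qed
        then have "norm (g k x) \<le> B * (norm (s - s0))\<^sup>2 / (1 + \<bar>x\<bar>) ^ A" by (simp add: power2_eq_square)
        moreover have "0 < (1 + \<bar>x\<bar>) ^ A" by (simp add: add_pos_nonneg)
        ultimately show ?thesis using True by (simp add: pos_le_divide_eq mult.commute)
      qed (use C k in auto)
    qed
    also have "(\<Prod>j\<in>UNIV. (C(i := B * (norm (s - s0))\<^sup>2)) j) = B * (norm (s - s0))\<^sup>2 * P"
      unfolding P_def by (subst prod.remove[of _ i]) auto
    finally show ?thesis unfolding eq by (simp add: L_def mult_ac)
  qed
  show ?thesis
    unfolding has_field_derivative_iff
  proof (rule LIM_zero_cancel, rule Lim_null_comparison)
    show "\<forall>\<^sub>F s in at s0. norm ((?F s - ?F s0) / (s - s0) - ?F') \<le> L * norm (s - s0)"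
      unfolding eventually_at
    proof (intro exI[of _ r] conjI ballI impI r)
      fix s assume s: "s \<noteq> s0 \<and> dist s s0 < r"
      then have "norm (?F s - ?F s0 - (s - s0) * ?F') \<le> L * (norm (s - s0))\<^sup>2" by (intro rem) (simp add: dist_commute)
      moreover have "(?F s - ?F s0) / (s - s0) - ?F' = (?F s - ?F s0 - (s - s0) * ?F') / (s - s0)"
        using s by (simp add: field_simps)
      ultimately show "norm ((?F s - ?F s0) / (s - s0) - ?F') \<le> L * norm (s - s0)"
        using s by (simp add: norm_divide pos_divide_le_eq power2_eq_square mult_ac)
    qed
    show "((\<lambda>s. L * norm (s - s0)) \<longlongrightarrow> 0) (at s0)"
      by (rule tendsto_eq_intros refl | simp)+
  qed
qed

text \<open>The product over \<open>i\<close> of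
  \<open>x $ i ^ m i * exp (z i * x $ i - a i * (x $ i)\<^sup>2)\<close>, times the vector
  \<open>v\<close>. The monomial is included so that the family is closed, up to sign, under
  derivatives in \<open>z\<close> and \<open>a\<close>.\<close>

definition gau :: "('n \<Rightarrow> nat) \<Rightarrow> ('n \<Rightarrow> complex) \<Rightarrow> ('n \<Rightarrow> complex) \<Rightarrow> 'b \<Rightarrow> real^'n::finite \<Rightarrow> 'b" where
  "gau m a z v = tens (\<lambda>i k. eta k (m i) (a i) (z i)) v"

abbreviation gau0 :: "real \<Rightarrow> ('n \<Rightarrow> complex) \<Rightarrow> 'b \<Rightarrow> real^'n::finite \<Rightarrow> 'b" where
  "gau0 \<alpha> \<equiv> gau (\<lambda>_. 0) (\<lambda>_. of_real \<alpha>)"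

lemma schwartz_gau: "(\<And>i. Re (a i) > 0) \<Longrightarrow> v \<in> X \<Longrightarrow> schwartzX Xs nrm (gau m a z v)"
  unfolding gau_def by (intro schwartz_tens rapid1_eta)

lemma gau_z_derivative:
  fixes \<Theta> :: "(real^'n::finite \<Rightarrow> 'b) \<Rightarrow> complex"
  assumes \<Theta>: "sdist \<Theta>" and v: "v \<in> X" and a: "\<And>i. Re (a i) > 0"
  shows "((\<lambda>s. \<Theta> (gau m a (z(i := s)) v)) has_field_derivative \<Theta> (gau (m(i := Suc (m i))) a (z(i := s)) v)) (at s)"
proof -
  let ?\<phi> = "\<lambda>i k. eta k (m i) (a i) (z i)"
  have 1: "gau m a (z(i := s)) v = tens (?\<phi>(i := \<lambda>k. eta k (m i) (a i) s)) v" for s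
    unfolding gau_def by (rule arg_cong[where f = "\<lambda>\<phi>. tens \<phi> v"]) auto
  have 2: "gau (m(i := Suc (m i))) a (z(i := s)) v = tens (?\<phi>(i := \<lambda>k. eta k (Suc (m i)) (a i) s)) v" for s
    unfolding gau_def by (rule arg_cong[where f = "\<lambda>\<phi>. tens \<phi> v"]) auto
  show ?thesis unfolding 1 2
  proof (rule sdist_tens_derivative[OF \<Theta> v rapid1_eta[OF a] zero_less_one rapid1_eta[OF a] rapid1_eta[OF a] eta_z eta_z])
    fix k A
    obtain C where C: "\<forall>a' z x. Re (a i) \<le> Re a' \<longrightarrow> norm a' \<le> norm (a i) + norm s + 1 \<longrightarrow> norm z \<le> norm (a i) + norm s + 1 \<longrightarrow> (1 + \<bar>x\<bar>) ^ A * norm (eta k (Suc (Suc (m i))) a' z x) \<le> C"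
      using eta_local_bound[OF a] by blast
    have "norm z \<le> norm (a i) + norm s + 1" if "z \<in> ball s 1" for z
      using norm_triangle_ineq2[of z s] that by (simp add: dist_norm norm_minus_commute add.assoc add_increasing)
    then show "\<exists>C. \<forall>z\<in>ball s 1. \<forall>x. (1 + \<bar>x\<bar>) ^ A * norm (eta k (Suc (Suc (m i))) (a i) z x) \<le> C"
      using C by (intro exI[of _ C]) auto
  qed
qed

lemma gau_a_derivative:
  fixes \<Theta> :: "(real^'n::finite \<Rightarrow> 'b) \<Rightarrow> complex"
  assumes \<Theta>: "sdist \<Theta>" and v: "v \<in> X" and a: "\<And>i. Re (a i) > 0" and s: "Re s > 0"
  shows "((\<lambda>s. \<Theta> (gau m (a(i := s)) z v)) has_field_derivative - \<Theta> (gau (m(i := Suc (Suc (m i)))) (a(i := s)) z v)) (at s)"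
proof -
  let ?\<phi> = "\<lambda>i k. eta k (m i) (a i) (z i)"
  have 1: "gau m (a(i := s)) z v = tens (?\<phi>(i := \<lambda>k. eta k (m i) s (z i))) v" for s
    unfolding gau_def by (rule arg_cong[where f = "\<lambda>\<phi>. tens \<phi> v"]) auto
  have 2: "gau (m(i := Suc (Suc (m i)))) (a(i := s)) z v = tens (?\<phi>(i := \<lambda>k. eta k (Suc (Suc (m i))) s (z i))) v" for s
    unfolding gau_def by (rule arg_cong[where f = "\<lambda>\<phi>. tens \<phi> v"]) auto
  have r1: "rapid1 ((?\<phi>(i := \<lambda>k. eta k (Suc (Suc (m i))) s (z i))) j)" for j
    using rapid1_eta[OF a] rapid1_eta[OF s] by simp
  have m1: "- \<Theta> (tens (?\<phi>(i := \<lambda>k. eta k (Suc (Suc (m i))) s (z i))) v)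
     = \<Theta> (tens (?\<phi>(i := \<lambda>k x. (-1) * eta k (Suc (Suc (m i))) s (z i) x)) v)"
  proof -
    have "schwartzX Xs nrm (tens (?\<phi>(i := \<lambda>k. eta k (Suc (Suc (m i))) s (z i))) v)"
      by (rule schwartz_tens[OF _ v]) (rule r1)
    from sdist_cs[OF \<Theta> this, of "-1"] show ?thesis unfolding tens_upd_cmult by simp
  qed
  \<comment> \<open>Half the distance to the imaginary axis: on the whole ball the real part stays
    at least \<open>r\<close>, which gives uniform decay.\<close>
  define r where "r = Re s / 2"
  have r: "r > 0" using s by (simp add: r_def)
  have Re: "r \<le> Re w" if "w \<in> ball s r" for w
    using that abs_Re_le_cmod[of "s - w"] by (simp add: r_def dist_norm)
  show ?thesis unfolding 1 2 m1
  proof (rule sdist_tens_derivative[OF \<Theta> v rapid1_eta[OF a] r, where f'' = "\<lambda>k s x. eta k (Suc (Suc (Suc (Suc (m i))))) s (z i) x"])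
    show "rapid1 (\<lambda>k. eta k (m i) w (z i))" if "w \<in> ball s r" for w
      using Re[OF that] r by (intro rapid1_eta) simp
    show "rapid1 (\<lambda>k x. - 1 * eta k (Suc (Suc (m i))) s (z i) x)"
      by (intro rapid1_cmult rapid1_eta s)
    show "((\<lambda>s. eta k (m i) s (z i) x) has_field_derivative - 1 * eta k (Suc (Suc (m i))) w (z i) x) (at w)" for k w x
      using eta_a[of k "m i" "z i" x w] by simp
    show "((\<lambda>s. - 1 * eta k (Suc (Suc (m i))) s (z i) x) has_field_derivative eta k (Suc (Suc (Suc (Suc (m i))))) w (z i) x) (at w)" for k w x
      using DERIV_minus[OF eta_a[of k "Suc (Suc (m i))" "z i" x w]] by simp
    fix k A
    define B where "B = norm (z i) + norm s + r"
    obtain C where C: "\<forall>a' z x. r \<le> Re a' \<longrightarrow> norm a' \<le> B \<longrightarrow> norm z \<le> B \<longrightarrow> (1 + \<bar>x\<bar>) ^ A * norm (eta k (Suc (Suc (Suc (Suc (m i))))) a' z x) \<le> C"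
      using eta_local_bound[OF r] by blast
    have "norm w \<le> B" if "w \<in> ball s r" for w
      using norm_triangle_ineq2[of w s] that by (simp add: dist_norm norm_minus_commute B_def add.assoc add_increasing)
    moreover have "norm (z i) \<le> B" using r by (simp add: B_def)
    ultimately show "\<exists>C. \<forall>w\<in>ball s r. \<forall>x. (1 + \<bar>x\<bar>) ^ A * norm (eta k (Suc (Suc (Suc (Suc (m i))))) w (z i) x) \<le> C"
      using C Re by (intro exI[of _ C]) auto
  qed
qed

end

section \<open>A Phragmen-Lindelof theorem\<close>

text \<open>Opening pi/2 is critical for growth of order 2, so boundedness on the two axes alone
  does not carry inside. The factor \<open>exp (\<i> * \<tau> * z\<^sup>2)\<close>, of modulus
  \<open>exp (- 2 * \<tau> * Re z * Im z)\<close>, makes the product bounded on a thin sector along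
  each axis as well. The remaining sector is narrower than pi/2, and there an auxiliary factor of
  order \<open>\<rho> > 2\<close> gives the Phragmen-Lindelof estimate.\<close>

lemma sector_bound:
  fixes f :: "complex \<Rightarrow> complex"
  assumes hol: "f holomorphic_on {z. Re z > -1}"
    and b: "\<And>z. 0 \<le> Re z \<Longrightarrow> 0 \<le> Im z \<Longrightarrow> norm (f z) \<le> C * exp (\<kappa> * min ((Re z)\<^sup>2) ((Im z)\<^sup>2))"
    and C: "C \<ge> 0" and \<kappa>: "\<kappa> > 0" and \<tau>: "\<tau> > 0" and z: "0 \<le> Re z" "0 \<le> Im z"
  shows "norm (f z) * exp (- 2 * \<tau> * Re z * Im z) \<le> C * exp \<kappa>"
proof -
  \<comment> \<open>For angles up to \<open>arctan (2 * \<tau> / \<kappa>)\<close> from an axis, the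
    given exponent is dominated by \<open>2 * \<tau> * Re z * Im z\<close>; the cap
    \<open>pi / 8\<close> keeps the middle sector nondegenerate.\<close>
  define \<eta> where "\<eta> = min (arctan (2 * \<tau> / \<kappa>)) (pi / 8)"
  have \<eta>: "0 < \<eta>" "\<eta> \<le> pi / 8" "\<eta> \<le> arctan (2 * \<tau> / \<kappa>)"
    using \<tau> \<kappa> by (auto simp: \<eta>_def)
  have easy: "norm (f z) * exp (- 2 * \<tau> * Re z * Im z) \<le> C"
    if z: "0 \<le> Re z" "0 \<le> Im z" and le: "\<kappa> * min ((Re z)\<^sup>2) ((Im z)\<^sup>2) \<le> 2 * \<tau> * Re z * Im z" for z
  proof -
    have "norm (f z) \<le> C * exp (2 * \<tau> * Re z * Im z)"
      using le C by (intro order_trans[OF b[OF z]] mult_left_mono) auto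
    then have "norm (f z) * exp (- (2 * \<tau> * Re z * Im z)) \<le> (C * exp (2 * \<tau> * Re z * Im z)) * exp (- (2 * \<tau> * Re z * Im z))"
      by (intro mult_right_mono) auto
    also have "\<dots> = C" by (simp add: exp_minus)
    finally show ?thesis by simp
  qed
  have tan_le: "\<kappa> * (sin \<phi>)\<^sup>2 \<le> 2 * \<tau> * cos \<phi> * sin \<phi>" if "0 \<le> \<phi>" "\<phi> \<le> \<eta>" for \<phi>
  proof -
    have \<phi>: "\<phi> < pi / 2" using that \<eta> pi_gt_zero by linarith
    have "tan \<phi> \<le> tan (arctan (2 * \<tau> / \<kappa>))"
      using that \<eta> arctan_bounded[of "2 * \<tau> / \<kappa>"] by (intro tan_mono_le) auto
    then have "tan \<phi> \<le> 2 * \<tau> / \<kappa>" by (simp add: tan_arctan)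
    moreover have c: "cos \<phi> > 0" using that \<phi> by (intro cos_gt_zero_pi) auto
    ultimately have "\<kappa> * sin \<phi> \<le> 2 * \<tau> * cos \<phi>" using \<kappa> by (simp add: tan_def field_simps)
    then have "(\<kappa> * sin \<phi>) * sin \<phi> \<le> (2 * \<tau> * cos \<phi>) * sin \<phi>"
      using that \<phi> by (intro mult_right_mono sin_ge_zero) auto
    then show ?thesis by (simp add: power2_eq_square)
  qed
  have edge: "norm (f z) * exp (- 2 * \<tau> * Re z * Im z) \<le> C"
    if z: "z = of_real r * cis \<phi>" "0 \<le> r" "0 \<le> \<phi>" "\<phi> \<le> pi / 2" and e: "\<phi> \<le> \<eta> \<or> pi / 2 - \<eta> \<le> \<phi>" for r \<phi> z
  proof -
    have xy: "Re z = r * cos \<phi>" "Im z = r * sin \<phi>" using z by auto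
    have pos: "0 \<le> cos \<phi>" "0 \<le> sin \<phi>" using z by (auto intro!: cos_ge_zero sin_ge_zero)
    show ?thesis
    proof (rule easy)
      show "0 \<le> Re z" "0 \<le> Im z" using xy pos z by auto
      have "\<kappa> * min ((cos \<phi>)\<^sup>2) ((sin \<phi>)\<^sup>2) \<le> 2 * \<tau> * cos \<phi> * sin \<phi>"
      proof (cases "\<phi> \<le> \<eta>")
        case True
        have "\<kappa> * min ((cos \<phi>)\<^sup>2) ((sin \<phi>)\<^sup>2) \<le> \<kappa> * (sin \<phi>)\<^sup>2" using \<kappa> by (intro mult_left_mono) auto
        also have "\<dots> \<le> 2 * \<tau> * cos \<phi> * sin \<phi>" using tan_le[of \<phi>] True z by simp
        finally show ?thesis .
      next
        case False
        then have "\<kappa> * (sin (pi / 2 - \<phi>))\<^sup>2 \<le> 2 * \<tau> * cos (pi / 2 - \<phi>) * sin (pi / 2 - \<phi>)"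
          using e z by (intro tan_le) auto
        then have "\<kappa> * (cos \<phi>)\<^sup>2 \<le> 2 * \<tau> * sin \<phi> * cos \<phi>"
          by (simp add: cos_sin_eq[of \<phi>] sin_cos_eq[of \<phi>])
        moreover have "\<kappa> * min ((cos \<phi>)\<^sup>2) ((sin \<phi>)\<^sup>2) \<le> \<kappa> * (cos \<phi>)\<^sup>2" using \<kappa> by (intro mult_left_mono) auto
        ultimately show ?thesis by (simp add: mult_ac)
      qed
      then have "r\<^sup>2 * (\<kappa> * min ((cos \<phi>)\<^sup>2) ((sin \<phi>)\<^sup>2)) \<le> r\<^sup>2 * (2 * \<tau> * cos \<phi> * sin \<phi>)"
        by (intro mult_left_mono) auto
      moreover have "min ((r * cos \<phi>)\<^sup>2) ((r * sin \<phi>)\<^sup>2) = r\<^sup>2 * min ((cos \<phi>)\<^sup>2) ((sin \<phi>)\<^sup>2)"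
        by (simp add: power_mult_distrib min_mult_distrib_left)
      ultimately show "\<kappa> * min ((Re z)\<^sup>2) ((Im z)\<^sup>2) \<le> 2 * \<tau> * Re z * Im z"
        unfolding xy by (simp add: power2_eq_square mult_ac)
    qed
  qed
  have Ck: "C \<le> C * exp \<kappa>" using C \<kappa> by (simp add: mult_left_mono[of 1 "exp \<kappa>" C, simplified])
  define r where "r = norm z"
  show ?thesis
  proof (cases "r \<le> 1")
    case True
    have "(Re z)\<^sup>2 \<le> 1"
      using True abs_Re_le_cmod[of z] z by (simp add: r_def abs_square_le_1)
    then have "\<kappa> * min ((Re z)\<^sup>2) ((Im z)\<^sup>2) \<le> \<kappa> * 1" using \<kappa> by (intro mult_left_mono) auto
    then have "norm (f z) \<le> C * exp \<kappa>" using C by (intro order_trans[OF b[OF z]] mult_left_mono) auto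
    moreover have "norm (f z) * exp (- 2 * \<tau> * Re z * Im z) \<le> norm (f z) * 1"
      using \<tau> z by (intro mult_left_mono) (auto intro!: mult_nonneg_nonneg)
    ultimately show ?thesis by simp
  next
    case False
    then have r: "r > 1" by simp
    have "(Re z / r)\<^sup>2 + (Im z / r)\<^sup>2 = 1"
    proof -
      have "z \<noteq> 0" using r by (auto simp: r_def)
      then show ?thesis by (simp add: r_def power_divide add_divide_distrib[symmetric] cmod_power2[symmetric])
    qed
    then obtain \<phi> where \<phi>: "0 \<le> \<phi>" "\<phi> \<le> pi / 2" "Re z / r = cos \<phi>" "Im z / r = sin \<phi>"
      using sincos_total_pi_half[of "Re z / r" "Im z / r"] z r by auto
    have zr: "z = of_real r * cis \<phi>"
      using \<phi>(3,4) r by (simp add: complex_eq_iff field_simps)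
    show ?thesis
    proof (cases "\<phi> \<le> \<eta> \<or> pi / 2 - \<eta> \<le> \<phi>")
      case True
      have "0 \<le> r" using r by simp
      from order_trans[OF edge[OF zr this \<phi>(1,2) True] Ck] show ?thesis .
    next
      case mid: False
      \<comment> \<open>The middle sector has half-opening
        \<open>\<omega> = (pi / 4) * (1 - e)\<close>, and \<open>(2 + e) * (1 - e) < 2\<close> gives
        \<open>\<rho> * \<omega> < pi / 2\<close>: the order \<open>\<rho>\<close> exceeds 2, yet
        the real part of the rotated power stays positive throughout the sector.\<close>
      define e where "e = 4 * \<eta> / pi"
      define \<rho> where "\<rho> = 2 + e"
      define \<omega> where "\<omega> = pi / 4 - \<eta>"
      define c where "c = cos (\<rho> * \<omega>)"
      have e: "0 < e" using \<eta> by (simp add: e_def)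
      have \<omega>: "0 \<le> \<omega>" "\<omega> < pi / 4" using \<eta> pi_gt_zero by (auto simp: \<omega>_def)
      have "\<rho> * \<omega> = (pi / 4) * ((2 + e) * (1 - e))"
        by (simp add: \<rho>_def \<omega>_def e_def field_simps)
      also have "\<dots> < (pi / 4) * 2"
        using e by (intro mult_strict_left_mono) (auto simp: algebra_simps add_pos_pos)
      finally have \<rho>\<omega>: "\<rho> * \<omega> < pi / 2" by simp
      have \<rho>0: "\<rho> > 2" using e by (simp add: \<rho>_def)
      have c: "c > 0" unfolding c_def using \<rho>\<omega> \<rho>0 \<omega> by (intro cos_gt_zero_pi) (auto intro: less_le_trans[of _ 0])
      \<comment> \<open>Logarithmic coordinates, rotated so that the diagonal of the quadrant
        becomes the real axis: the sector turns into a horizontal strip and the power into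
        \<open>exp (\<rho> * u)\<close>.\<close>
      define Z where "Z u = exp (u + \<i> * of_real (pi / 4))" for u
      define u0 where "u0 = Complex (ln r) (\<phi> - pi / 4)"
      have Z: "Z u = of_real (exp (Re u)) * cis (Im u + pi / 4)" for u
        by (simp add: Z_def exp_eq_polar)
      have Zu0: "Z u0 = z" unfolding Z using r by (simp add: u0_def zr)
      have nf: "norm (f z) * exp (- 2 * \<tau> * Re z * Im z) \<le> C * exp \<kappa> * exp (\<epsilon> * exp (\<rho> * ln r))" if \<epsilon>: "\<epsilon> > 0" for \<epsilon>
      proof -
        define g where "g u = f (Z u) * exp (\<i> * of_real \<tau> * (Z u)\<^sup>2) * exp (- of_real \<epsilon> * exp (of_real \<rho> * u))" for u
        \<comment> \<open>Beyond this logarithmic radius the decay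
          \<open>\<epsilon> * c * exp (\<rho> * R)\<close> outweighs the growth
          \<open>\<kappa> * exp (2 * R)\<close>.\<close>
        obtain R0 where R0: "exp ((\<rho> - 2) * R0) = \<kappa> / (\<epsilon> * c)"
          using \<rho>0 \<epsilon> c \<kappa> by (intro that[of "ln (\<kappa> / (\<epsilon> * c)) / (\<rho> - 2)"]) simp
        define R where "R = max R0 (ln r)"
        have R: "ln r \<le> R" "0 < ln r" using r by (auto simp: R_def)
        have Rb: "\<kappa> * exp (2 * R) \<le> \<epsilon> * c * exp (\<rho> * R)"
        proof -
          have "\<kappa> / (\<epsilon> * c) \<le> exp ((\<rho> - 2) * R)"
            unfolding R0[symmetric] using \<rho>0 by (simp add: R_def)
          then have "\<kappa> \<le> \<epsilon> * c * exp ((\<rho> - 2) * R)" using \<epsilon> c by (simp add: field_simps)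
          then have "\<kappa> * exp (2 * R) \<le> \<epsilon> * c * exp ((\<rho> - 2) * R) * exp (2 * R)"
            by (intro mult_right_mono) auto
          also have "\<dots> = \<epsilon> * c * exp (\<rho> * R)" by (simp add: exp_add[symmetric] algebra_simps)
          finally show ?thesis .
        qed
        let ?S = "cbox (Complex 0 (- \<omega>)) (Complex R \<omega>)"
        have inS: "u \<in> ?S \<longleftrightarrow> 0 \<le> Re u \<and> Re u \<le> R \<and> - \<omega> \<le> Im u \<and> Im u \<le> \<omega>" for u
          by (auto simp: in_cbox_complex_iff)
        have ReZ: "0 < Re (Z u)" "0 \<le> Im (Z u)" if "u \<in> ?S" for u
        proof -
          have u: "- (pi / 4) < Im u" "Im u < pi / 4" using that \<omega> unfolding inS by auto
          show "0 < Re (Z u)" unfolding Z using u by (auto intro!: mult_pos_pos cos_gt_zero_pi)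
          have "0 \<le> sin (Im u + pi / 4)" using u by (intro sin_ge_zero) auto
          then show "0 \<le> Im (Z u)" unfolding Z by simp
        qed
        have gn: "norm (g u) = (norm (f (Z u)) * exp (- 2 * \<tau> * Re (Z u) * Im (Z u))) * exp (- \<epsilon> * exp (\<rho> * Re u) * cos (\<rho> * Im u))" for u
        proof -
          have "Re (\<i> * of_real \<tau> * (Z u)\<^sup>2) = - 2 * \<tau> * Re (Z u) * Im (Z u)" by (simp add: power2_eq_square)
          moreover have "Re (- of_real \<epsilon> * exp (of_real \<rho> * u)) = - \<epsilon> * exp (\<rho> * Re u) * cos (\<rho> * Im u)"
            by (simp add: Re_exp)
          ultimately show ?thesis by (simp only: g_def norm_mult norm_exp_eq_Re mult.assoc)
        qed
        have cosb: "c \<le> cos (\<rho> * Im u)" if "u \<in> ?S" for u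
        proof -
          have "\<rho> * \<omega> \<le> pi" using \<rho>\<omega> pi_gt_zero by linarith
          moreover have "\<bar>\<rho> * Im u\<bar> \<le> \<rho> * \<omega>"
            using that \<rho>0 unfolding inS abs_mult by (auto intro!: mult_mono)
          ultimately have "cos (\<rho> * \<omega>) \<le> cos \<bar>\<rho> * Im u\<bar>"
            by (intro cos_monotone_0_pi_le) auto
          then show ?thesis by (simp add: c_def)
        qed
        have "norm (g u0) \<le> C * exp \<kappa>"
        proof (rule maximum_modulus_frontier[of g ?S])
          have "g holomorphic_on ?S"
            unfolding g_def
          proof (intro holomorphic_intros)
            have "f \<circ> Z holomorphic_on ?S"
            proof (rule holomorphic_on_compose_gen[OF _ hol])
              show "Z holomorphic_on ?S" unfolding Z_def[abs_def] by (intro holomorphic_intros)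
              show "Z ` ?S \<subseteq> {z. Re z > -1}" using ReZ by force
            qed
            then show "(\<lambda>u. f (Z u)) holomorphic_on ?S" by (simp add: o_def)
            show "Z holomorphic_on ?S" unfolding Z_def[abs_def] by (intro holomorphic_intros)
          qed
          then show "g holomorphic_on interior ?S" "continuous_on (closure ?S) g"
            by (rule holomorphic_on_subset[OF _ interior_subset], simp add: holomorphic_on_imp_continuous_on)
          show "bounded ?S" by simp
          show "u0 \<in> ?S" unfolding inS using R mid \<phi> by (auto simp: u0_def \<omega>_def)
          fix u assume "u \<in> frontier ?S"
          then have u: "u \<in> ?S" and bd: "Re u = 0 \<or> Re u = R \<or> Im u = \<omega> \<or> Im u = - \<omega>"
            unfolding frontier_cbox inS by (auto simp: in_box_complex_iff inS)
          have small: "exp (- \<epsilon> * exp (\<rho> * Re u) * cos (\<rho> * Im u)) \<le> 1"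
            using cosb[OF u] c \<epsilon> by (simp add: mult_nonneg_nonneg)
          have bz: "norm (f (Z u)) * exp (- 2 * \<tau> * Re (Z u) * Im (Z u)) \<le> C * exp (\<kappa> * exp (2 * Re u))"
          proof -
            have "norm (f (Z u)) * exp (- 2 * \<tau> * Re (Z u) * Im (Z u)) \<le> norm (f (Z u)) * 1"
              using \<tau> ReZ[OF u] by (intro mult_left_mono) (auto intro!: mult_nonneg_nonneg)
            also have "\<dots> \<le> C * exp (\<kappa> * min ((Re (Z u))\<^sup>2) ((Im (Z u))\<^sup>2))" using b[of "Z u"] ReZ[OF u] by simp
            also have "\<dots> \<le> C * exp (\<kappa> * exp (2 * Re u))"
            proof -
              have "\<bar>Re (Z u)\<bar> \<le> exp (Re u)" using abs_Re_le_cmod[of "Z u"] by (simp add: Z_def)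
              then have "(Re (Z u))\<^sup>2 \<le> (exp (Re u))\<^sup>2" by (simp add: abs_le_square_iff[symmetric])
              also have "\<dots> = exp (2 * Re u)" by (simp add: exp_double)
              finally have "(Re (Z u))\<^sup>2 \<le> exp (2 * Re u)" .
              then show ?thesis using C \<kappa> by (intro mult_left_mono) auto
            qed
            finally show ?thesis .
          qed
          \<comment> \<open>Unit arc, far arc and the two rays: the bounds there are the crude one,
            the decay of the auxiliary factor, and the thin-sector estimate.\<close>
          consider "Re u = 0" | "Re u = R" | "Im u = \<omega> \<or> Im u = - \<omega>" using bd by blast
          then show "norm (g u) \<le> C * exp \<kappa>"
          proof cases
            case 1
            have "norm (g u) \<le> (C * exp (\<kappa> * exp (2 * Re u))) * 1"
              unfolding gn by (rule mult_mono[OF bz small]) (use C in auto)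
            then show ?thesis using 1 by simp
          next
            case 2
            have "\<epsilon> * exp (\<rho> * R) * c \<le> \<epsilon> * exp (\<rho> * R) * cos (\<rho> * Im u)"
              using cosb[OF u] \<epsilon> by (intro mult_left_mono) auto
            then have E: "exp (- \<epsilon> * exp (\<rho> * Re u) * cos (\<rho> * Im u)) \<le> exp (- (\<epsilon> * c * exp (\<rho> * R)))"
              using 2 by (simp add: mult_ac)
            have "norm (g u) \<le> (C * exp (\<kappa> * exp (2 * Re u))) * exp (- (\<epsilon> * c * exp (\<rho> * R)))"
              unfolding gn by (rule mult_mono[OF bz E]) (use C in auto)
            also have "\<dots> = C * exp (\<kappa> * exp (2 * R) - \<epsilon> * c * exp (\<rho> * R))"
              using 2 by (simp add: exp_diff exp_minus field_simps)
            also have "\<dots> \<le> C * exp \<kappa>" using Rb C \<kappa> by (intro mult_left_mono) auto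
            finally show ?thesis .
          next
            case 3
            have "norm (f (Z u)) * exp (- 2 * \<tau> * Re (Z u) * Im (Z u)) \<le> C"
            proof (rule edge[OF Z])
              show "0 \<le> Im u + pi / 4" "Im u + pi / 4 \<le> pi / 2" using u \<omega> unfolding inS by auto
              show "Im u + pi / 4 \<le> \<eta> \<or> pi / 2 - \<eta> \<le> Im u + pi / 4" using 3 by (auto simp: \<omega>_def)
            qed simp
            then have "norm (g u) \<le> C * 1"
              unfolding gn by (rule mult_mono[OF _ small]) (use C in auto)
            then show ?thesis using Ck by simp
          qed
        qed
        then have "(norm (f z) * exp (- 2 * \<tau> * Re z * Im z)) * exp (- \<epsilon> * exp (\<rho> * ln r) * cos (\<rho> * Im u0)) \<le> C * exp \<kappa>"
          unfolding gn Zu0 by (simp add: u0_def)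
        then have "((norm (f z) * exp (- 2 * \<tau> * Re z * Im z)) * exp (- \<epsilon> * exp (\<rho> * ln r) * cos (\<rho> * Im u0))) * exp (\<epsilon> * exp (\<rho> * ln r) * cos (\<rho> * Im u0))
           \<le> C * exp \<kappa> * exp (\<epsilon> * exp (\<rho> * ln r) * cos (\<rho> * Im u0))"
          by (intro mult_right_mono) auto
        then have "norm (f z) * exp (- 2 * \<tau> * Re z * Im z) \<le> C * exp \<kappa> * exp (\<epsilon> * exp (\<rho> * ln r) * cos (\<rho> * Im u0))"
          by (simp add: mult.assoc exp_minus)
        also have "\<dots> \<le> C * exp \<kappa> * exp (\<epsilon> * exp (\<rho> * ln r))"
          using C \<epsilon> by (intro mult_left_mono) auto
        finally show ?thesis .
      qed
      \<comment> \<open>The estimate holds for every positive \<open>\<epsilon>\<close> at the fixed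
        point \<open>z\<close>, so the auxiliary factor disappears in the limit.\<close>
      have "((\<lambda>\<epsilon>. C * exp \<kappa> * exp (\<epsilon> * exp (\<rho> * ln r))) \<longlongrightarrow> C * exp \<kappa> * exp (0 * exp (\<rho> * ln r))) (at_right 0)"
        by (intro tendsto_intros)
      then have "norm (f z) * exp (- 2 * \<tau> * Re z * Im z) \<le> C * exp \<kappa> * exp (0 * exp (\<rho> * ln r))"
        by (rule tendsto_lowerbound) (use nf in \<open>auto simp: eventually_at_right_less intro: eventually_at_rightI[of 0 1]\<close>)
      then show ?thesis by simp
    qed
  qed
qed

text \<open>Dividing by \<open>(z + 1 + \<i>) ^ N\<close> removes the polynomial factor: the zero of
  the divisor lies outside the quadrant, where its modulus is comparable to
  \<open>(1 + norm z) ^ N\<close>. Each direction of the comparison costs \<open>2 ^ N\<close>,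
  whence \<open>4 ^ N\<close>; letting \<open>\<tau>\<close> tend to 0 removes the auxiliary
  exponential.\<close>

lemma phragmen_lindelof_quadrant:
  fixes F :: "complex \<Rightarrow> complex"
  assumes hol: "F holomorphic_on UNIV"
    and b: "\<And>z. norm (F z) \<le> C * (1 + norm z) ^ N * exp (\<kappa> * min ((Re z)\<^sup>2) ((Im z)\<^sup>2))"
    and C: "C \<ge> 0" and \<kappa>: "\<kappa> > 0" and z: "0 \<le> Re z" "0 \<le> Im z"
  shows "norm (F z) \<le> (C * 4 ^ N * exp \<kappa>) * (1 + norm z) ^ N"
proof -
  define f where "f z = F z / (z + 1 + \<i>) ^ N" for z
  have nz: "z + 1 + \<i> \<noteq> 0" if "Re z > -1" for z using that by (auto simp: complex_eq_iff)
  have hf: "f holomorphic_on {z. Re z > -1}"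
    unfolding f_def by (intro holomorphic_intros holomorphic_on_subset[OF hol]) (use nz in auto)
  have lower: "1 + norm z \<le> 2 * norm (z + 1 + \<i>)" if "0 \<le> Re z" "0 \<le> Im z" for z
  proof (rule power2_le_imp_le)
    have "0 \<le> (1 - norm z)\<^sup>2" by simp
    then have "(1 + norm z)\<^sup>2 \<le> 2 * (1 + (norm z)\<^sup>2)" by (simp add: power2_diff power2_sum)
    also have "\<dots> \<le> (2 * norm (z + 1 + \<i>))\<^sup>2"
      using that by (simp add: power_mult_distrib cmod_power2 power2_sum)
    finally show "(1 + norm z)\<^sup>2 \<le> (2 * norm (z + 1 + \<i>))\<^sup>2" .
  qed simp
  have bf: "norm (f z) \<le> (C * 2 ^ N) * exp (\<kappa> * min ((Re z)\<^sup>2) ((Im z)\<^sup>2))" if "0 \<le> Re z" "0 \<le> Im z" for z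
  proof -
    have p: "0 < norm (z + 1 + \<i>)" using nz[of z] that by simp
    have "norm (F z) \<le> C * (2 * norm (z + 1 + \<i>)) ^ N * exp (\<kappa> * min ((Re z)\<^sup>2) ((Im z)\<^sup>2))"
      using lower[OF that] C by (intro order_trans[OF b] mult_right_mono mult_left_mono power_mono) auto
    then show ?thesis using p by (simp add: f_def norm_divide norm_power power_mult_distrib pos_divide_le_eq mult_ac)
  qed
  have "norm (f z) * exp (- 2 * \<tau> * Re z * Im z) \<le> (C * 2 ^ N) * exp \<kappa>" if "\<tau> > 0" for \<tau>
    by (rule sector_bound[OF hf bf _ \<kappa> that z]) (use C in auto)
  moreover have "((\<lambda>\<tau>. norm (f z) * exp (- 2 * \<tau> * Re z * Im z)) \<longlongrightarrow> norm (f z) * exp (- 2 * 0 * Re z * Im z)) (at_right 0)"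
    by (intro tendsto_intros)
  ultimately have "norm (f z) * exp (- 2 * 0 * Re z * Im z) \<le> (C * 2 ^ N) * exp \<kappa>"
    by (intro tendsto_upperbound[of _ _ "at_right 0"]) (auto intro: eventually_at_rightI[of 0 1])
  then have fz: "norm (f z) \<le> C * 2 ^ N * exp \<kappa>" by simp
  have "norm (z + 1 + \<i>) \<le> 2 * (1 + norm z)"
  proof -
    have "norm (z + 1 + \<i>) \<le> norm (z + 1) + 1" "norm (z + 1) \<le> norm z + 1" "0 \<le> norm z"
      using norm_triangle_ineq[of "z + 1" \<i>] norm_triangle_ineq[of z 1] by simp_all
    then have "norm (z + 1 + \<i>) \<le> 2 + 2 * norm z" by linarith
    then show ?thesis by simp
  qed
  then have "norm (f z) * norm (z + 1 + \<i>) ^ N \<le> (C * 2 ^ N * exp \<kappa>) * (2 * (1 + norm z)) ^ N"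
    using C by (intro mult_mono fz power_mono) auto
  moreover have "norm (F z) = norm (f z) * norm (z + 1 + \<i>) ^ N"
    using nz[of z] z by (simp add: f_def norm_divide norm_power)
  moreover have "(2 * (1 + norm z)) ^ N = 2 ^ N * (1 + norm z) ^ N" by (rule power_mult_distrib)
  moreover have "(4::real) ^ N = 2 ^ N * 2 ^ N" by (simp add: power_mult_distrib[symmetric])
  ultimately show ?thesis by (simp only: mult_ac)
qed

text \<open>Multiplication by \<open>\<i>\<close> exchanges the squares of real and imaginary part,
  so the minimum of the two bounds is invariant under quarter turns and one quadrant
  suffices.\<close>

lemma polynomial_of_gaussian_bounds:
  fixes F :: "complex \<Rightarrow> complex"
  assumes hol: "F holomorphic_on UNIV" and C: "C \<ge> 0" and \<kappa>: "\<kappa> > 0"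
    and im: "\<And>z. norm (F z) \<le> C * (1 + norm z) ^ N * exp (\<kappa> * (Im z)\<^sup>2)"
    and re: "\<And>z. norm (F z) \<le> C * (1 + norm z) ^ N * exp (\<kappa> * (Re z)\<^sup>2)"
  shows "\<exists>c. \<forall>z. F z = (\<Sum>k\<le>N. c k * z ^ k)"
proof -
  define K where "K = C * 4 ^ N * exp \<kappa>"
  have b: "norm (F z) \<le> C * (1 + norm z) ^ N * exp (\<kappa> * min ((Re z)\<^sup>2) ((Im z)\<^sup>2))" for z
    using im[of z] re[of z] by (cases "(Re z)\<^sup>2 \<le> (Im z)\<^sup>2") (auto simp: min_def)
  have rot: "norm (F (w * z)) \<le> K * (1 + norm z) ^ N" if w: "w \<in> {1, \<i>, -1, -\<i>}" and z: "0 \<le> Re z" "0 \<le> Im z" for w z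
    unfolding K_def
  proof (rule phragmen_lindelof_quadrant[OF _ _ C \<kappa> z])
    have "(F \<circ> (*) w) holomorphic_on UNIV"
      by (intro holomorphic_on_compose holomorphic_intros holomorphic_on_subset[OF hol]) auto
    then show "(\<lambda>z. F (w * z)) holomorphic_on UNIV" by (simp add: o_def)
    fix z
    show "norm (F (w * z)) \<le> C * (1 + norm z) ^ N * exp (\<kappa> * min ((Re z)\<^sup>2) ((Im z)\<^sup>2))"
      using b[of "w * z"] w by (auto simp: norm_mult min.commute)
  qed
  have all: "norm (F z) \<le> K * (1 + norm z) ^ N" for z
  proof -
    consider "0 \<le> Re z" "0 \<le> Im z" | "Re z \<le> 0" "0 \<le> Im z" | "Re z \<le> 0" "Im z \<le> 0" | "0 \<le> Re z" "Im z \<le> 0"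
      by linarith
    then show ?thesis
    proof cases
      case 1 then show ?thesis using rot[of 1 z] by simp
    next
      case 2 then show ?thesis using rot[of \<i> "- \<i> * z"] by (simp add: norm_mult)
    next
      case 3 then show ?thesis using rot[of "-1" "- z"] by simp
    next
      case 4 then show ?thesis using rot[of "-\<i>" "\<i> * z"] by (simp add: norm_mult)
    qed
  qed
  have K: "K \<ge> 0" using C by (simp add: K_def)
  have "norm (F z) \<le> (K * 2 ^ N) * norm z ^ N" if "1 \<le> norm z" for z
  proof -
    have "(1 + norm z) ^ N \<le> (2 * norm z) ^ N" using that by (intro power_mono) auto
    then have "norm (F z) \<le> K * (2 * norm z) ^ N" by (intro order_trans[OF all[of z]] mult_left_mono K)
    then show ?thesis by (simp add: power_mult_distrib mult_ac)
  qed
  then have "F z = (\<Sum>k\<le>N. (deriv ^^ k) F 0 / fact k * z ^ k)" for z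
    by (rule Liouville_polynomial[OF hol])
  then show ?thesis by (intro exI[of _ "\<lambda>k. (deriv ^^ k) F 0 / fact k"]) simp
qed

section \<open>Density of Gaussians\<close>

text \<open>The normal density of variance \<open>1 / (2 * a)\<close>, which concentrates at 0 as
  \<open>a\<close> grows.\<close>

definition gd :: "real \<Rightarrow> real \<Rightarrow> real" where
  "gd a u = sqrt (a / pi) * exp (- a * u\<^sup>2)"

lemma gd_nonneg: "a > 0 \<Longrightarrow> 0 \<le> gd a u"
  by (simp add: gd_def)

lemma gd_even: "gd a (- u) = gd a u"
  by (simp add: gd_def)

lemma gd_normal: "a > 0 \<Longrightarrow> gd a u = normal_density 0 (1 / sqrt (2 * a)) u"
  by (simp add: gd_def normal_density_def power_divide real_sqrt_divide real_sqrt_mult field_simps)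

lemma gd_has_integral: "a > 0 \<Longrightarrow> (gd a has_integral 1) UNIV"
proof -
  assume a: "a > 0"
  have eq: "gd a = normal_density 0 (1 / sqrt (2 * a))" using gd_normal[OF a] by auto
  show ?thesis unfolding eq
    using has_integral_integral_lborel[OF integrable_normal_density[of "1 / sqrt (2 * a)" 0]] a by simp
qed

lemma gd_continuous: "continuous_on S (gd a)"
  unfolding gd_def[abs_def] by (intro continuous_intros)

lemma gd_integrable: "gd a integrable_on {u..v}"
  by (intro integrable_continuous_interval gd_continuous)

lemma gd_integral_le_1: "a > 0 \<Longrightarrow> integral {u..v} (gd a) \<le> 1"
  using integral_subset_le[of "{u..v}" UNIV "gd a"] gd_has_integral[of a] gd_nonneg[of a] gd_integrable
  by (auto simp: has_integral_iff)

lemma gd_lipschitz: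
  assumes a: "a > 0"
  shows "\<exists>L\<ge>0. \<forall>u v. \<bar>gd a u - gd a v\<bar> \<le> L * \<bar>u - v\<bar>"
proof -
  define L where "L = sqrt (a / pi) * (2 * a) * exp ((real 1)\<^sup>2 / (4 * a))"
  have L: "L \<ge> 0" using a by (simp add: L_def)
  have "\<bar>gd a u - gd a v\<bar> \<le> L * \<bar>u - v\<bar>" for u v
  proof -
    have "norm (gd a u - gd a v) \<le> L * norm (u - v)"
    proof (rule field_differentiable_bound[of UNIV])
      fix z :: real
      show "(gd a has_field_derivative sqrt (a / pi) * (exp (- a * z\<^sup>2) * (- a * (2 * z)))) (at z within UNIV)"
        unfolding gd_def[abs_def] by (auto intro!: derivative_eq_intros)
      have "\<bar>z\<bar> * exp (- a * z\<^sup>2) \<le> (1 + \<bar>z\<bar>) ^ 1 * exp (- a * z\<^sup>2)" by simp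
      also have "\<dots> \<le> exp ((real 1)\<^sup>2 / (4 * a))" by (rule poly_gauss_bound[OF a])
      finally have "(sqrt (a / pi) * (2 * a)) * (\<bar>z\<bar> * exp (- a * z\<^sup>2)) \<le> L"
        unfolding L_def using a by (intro mult_left_mono) auto
      then show "norm (sqrt (a / pi) * (exp (- a * z\<^sup>2) * (- a * (2 * z)))) \<le> L"
        using a by (simp add: abs_mult mult_ac)
    qed auto
    then show ?thesis by simp
  qed
  with L show ?thesis by blast
qed

text \<open>The half-width is \<open>m / 2\<close> because, for
  \<open>\<bar>s\<bar> \<le> m / 2\<close>, the shifted window \<open>{- m - s..m - s}\<close>
  covered by the Riemann sum contains this interval.\<close>

lemma gd_tail:
  assumes a: "a > 0"
  shows "(\<lambda>m. 1 - integral {- (real m / 2)..real m / 2} (gd a)) \<longlonglongrightarrow> 0"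
proof (rule LIMSEQ_I)
  fix e :: real assume "e > 0"
  then obtain B where B: "B > 0" "\<And>u v. ball 0 B \<subseteq> cbox u v \<Longrightarrow> \<exists>z. (gd a has_integral z) (cbox u v) \<and> norm (z - 1) < e"
    using gd_has_integral[OF a, THEN has_integral_altD[of _ _ UNIV e]] by auto
  show "\<exists>no. \<forall>n\<ge>no. norm (1 - integral {- (real n / 2)..real n / 2} (gd a) - 0) < e"
  proof (intro exI[of _ "nat \<lceil>2 * B\<rceil>"] allI impI)
    fix n assume "n \<ge> nat \<lceil>2 * B\<rceil>"
    then have "2 * B \<le> real n" by linarith
    then have "ball 0 B \<subseteq> cbox (- (real n / 2)) (real n / 2)"
      by (auto simp: dist_norm cbox_interval)
    from B(2)[OF this] show "norm (1 - integral {- (real n / 2)..real n / 2} (gd a) - 0) < e"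
      by (auto simp: cbox_interval has_integral_iff abs_minus_commute)
  qed
qed

lemma gd_riemann:
  assumes L: "\<And>u v. \<bar>gd a u - gd a v\<bar> \<le> L * \<bar>u - v\<bar>" and \<delta>: "\<delta> \<ge> 0"
  shows "\<bar>(\<Sum>i<n. \<delta> * gd a (u + \<delta> * real i)) - integral {u..u + \<delta> * real n} (gd a)\<bar> \<le> real n * (\<delta>\<^sup>2 * L)"
proof (induction n)
  case (Suc n)
  define w where "w = u + \<delta> * real n"
  have step: "\<bar>\<delta> * gd a w - integral {w..w + \<delta>} (gd a)\<bar> \<le> \<delta>\<^sup>2 * L"
  proof -
    have L0: "L \<ge> 0" using L[of 1 0] by simp
    have c: "integral {w..w + \<delta>} (\<lambda>_. gd a w) = \<delta> * gd a w" using \<delta> by simp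
    have "norm (integral {w..w + \<delta>} (\<lambda>y. gd a w - gd a y)) \<le> integral {w..w + \<delta>} (\<lambda>_. L * \<delta>)"
    proof (rule integral_norm_bound_integral)
      show "(\<lambda>y. gd a w - gd a y) integrable_on {w..w + \<delta>}"
        by (intro integrable_diff gd_integrable integrable_const_ivl)
      show "norm (gd a w - gd a y) \<le> L * \<delta>" if "y \<in> {w..w + \<delta>}" for y
      proof -
          have "L * \<bar>w - y\<bar> \<le> L * \<delta>" using that L0 by (intro mult_left_mono) auto
          then show ?thesis using L[of w y] by simp
        qed
    qed (rule integrable_const_ivl)
    moreover have "integral {w..w + \<delta>} (\<lambda>y. gd a w - gd a y) = \<delta> * gd a w - integral {w..w + \<delta>} (gd a)"
      using c by (subst integral_diff) (auto intro: gd_integrable integrable_const_ivl)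
    ultimately show ?thesis using \<delta> by (simp add: power2_eq_square mult_ac)
  qed
  have "integral {u..w} (gd a) + integral {w..w + \<delta>} (gd a) = integral {u..w + \<delta>} (gd a)"
    using \<delta> by (intro Henstock_Kurzweil_Integration.integral_combine gd_integrable) (auto simp: w_def)
  moreover have "w + \<delta> = u + \<delta> * real (Suc n)" by (simp add: w_def algebra_simps)
  ultimately show ?case using step Suc by (simp add: w_def[symmetric] algebra_simps)
qed simp

lemma one_plus_abs_pow: "(1 + \<bar>s\<bar>) ^ A \<le> (1 + \<bar>s - y\<bar>) ^ A * (1 + \<bar>y\<bar>) ^ A" for s y :: real
  using one_plus_abs_add_le[of "s - y" y] by (simp add: power_mult_distrib[symmetric] power_mono)

definition Gd :: "real \<Rightarrow> nat \<Rightarrow> real \<Rightarrow> complex" where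
  "Gd a k u = of_real (sqrt (a / pi)) * eta k 0 (of_real a) 0 u"

lemma Gd_0: "Gd a 0 u = of_real (gd a u)"
  by (simp add: Gd_def gd_def exp_of_real[symmetric])

lemma rapid1_Gd: "a > 0 \<Longrightarrow> rapid1 (Gd a)"
  unfolding Gd_def[abs_def] by (intro rapid1_cmult rapid1_eta) simp

lemma rapid1_shift:
  assumes "rapid1 \<phi>"
  shows "rapid1 (\<lambda>k s. \<phi> k (s - y))"
  unfolding rapid1_def
proof (intro conjI allI)
  fix k s
  have "(\<phi> k \<circ> (\<lambda>s. s - y) has_vector_derivative 1 *\<^sub>R \<phi> (Suc k) (s - y)) (at s)"
    using assms unfolding rapid1_def
    by (intro vector_diff_chain_at) (auto intro!: derivative_eq_intros simp: has_vector_derivative_def)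
  then show "((\<lambda>s. \<phi> k (s - y)) has_vector_derivative \<phi> (Suc k) (s - y)) (at s)" by (simp add: o_def)
next
  fix k A
  obtain C where C: "\<And>s. (1 + \<bar>s\<bar>) ^ A * norm (\<phi> k s) \<le> C" using assms unfolding rapid1_def by blast
  have "(1 + \<bar>s\<bar>) ^ A * norm (\<phi> k (s - y)) \<le> C * (1 + \<bar>y\<bar>) ^ A" for s
  proof -
    have "(1 + \<bar>s\<bar>) ^ A * norm (\<phi> k (s - y)) \<le> ((1 + \<bar>s - y\<bar>) ^ A * (1 + \<bar>y\<bar>) ^ A) * norm (\<phi> k (s - y))"
      by (intro mult_right_mono one_plus_abs_pow) auto
    also have "\<dots> = ((1 + \<bar>s - y\<bar>) ^ A * norm (\<phi> k (s - y))) * (1 + \<bar>y\<bar>) ^ A" by simp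
    also have "\<dots> \<le> C * (1 + \<bar>y\<bar>) ^ A" by (intro mult_right_mono C) auto
    finally show ?thesis .
  qed
  then show "\<exists>C. \<forall>s. (1 + \<bar>s\<bar>) ^ A * norm (\<phi> k (s - y)) \<le> C" by blast
qed

section \<open>Moving derivatives from the kernel to the function on a grid\<close>

context frechet
begin

text \<open>The weight at \<open>s\<close> is divided between the kernel, at \<open>s - y\<close>,
  and the function, at \<open>y\<close>. The spare power in the hypothesis on \<open>h\<close>
  becomes the factor \<open>1 / (1 + \<bar>y\<bar>)\<close> that makes boundary terms small.\<close>

lemma weighted_product_bound:
  assumes G: "(1 + \<bar>s - y\<bar>) ^ A * norm g \<le> \<Gamma>" and h: "h \<in> X" "(1 + \<bar>y\<bar>) ^ Suc A * nrm M h \<le> B" and B: "B \<ge> 0"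
  shows "(1 + \<bar>s\<bar>) ^ A * nrm M (cs g h) \<le> \<Gamma> * B / (1 + \<bar>y\<bar>)"
proof -
  have "(1 + \<bar>s\<bar>) ^ A * nrm M (cs g h) \<le> ((1 + \<bar>s - y\<bar>) ^ A * (1 + \<bar>y\<bar>) ^ A) * nrm M (cs g h)"
    using h by (intro mult_right_mono one_plus_abs_pow nrm_nonneg X_cs)
  also have "\<dots> = ((1 + \<bar>s - y\<bar>) ^ A * norm g) * ((1 + \<bar>y\<bar>) ^ A * nrm M h)"
    using h by (simp add: nrm_cs)
  also have "\<dots> \<le> \<Gamma> * (B / (1 + \<bar>y\<bar>))"
  proof (rule mult_mono[OF G])
    show "(1 + \<bar>y\<bar>) ^ A * nrm M h \<le> B / (1 + \<bar>y\<bar>)"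
      using h by (simp add: pos_le_divide_eq add_pos_nonneg mult_ac)
    have "0 \<le> (1 + \<bar>s - y\<bar>) ^ A * norm g" by simp
    then show "0 \<le> \<Gamma>" using G by linarith
  qed (use h in simp)
  finally show ?thesis by simp
qed

text \<open>Abel summation: up to a Riemann sum error, derivatives move from the kernel to the function.\<close>

lemma abel_step:
  fixes H :: "nat \<Rightarrow> real \<Rightarrow> 'b" and g :: "nat \<Rightarrow> real \<Rightarrow> complex"
  assumes H: "\<And>j s. H j s \<in> X" "\<And>j s. vderiv M (H j) (H (Suc j) s) s"
    and Hb: "\<And>j s. j \<le> N + 2 \<Longrightarrow> (1 + \<bar>s\<bar>) ^ Suc A * nrm M (H j s) \<le> B"
    and g: "rapid1 g" "\<And>k s. k \<le> N + 2 \<Longrightarrow> (1 + \<bar>s\<bar>) ^ A * norm (g k s) \<le> \<Gamma>"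
    and k: "k \<le> N" "j \<le> N" and m: "m > 0"
  shows "(1 + \<bar>s\<bar>) ^ A * nrm M ((\<Sum>i<2 * m ^ 3 + 1. (1 / (real m)\<^sup>2) *\<^sub>R cs (g (Suc k) (s - (real i / (real m)\<^sup>2 - real m))) (H j (real i / (real m)\<^sup>2 - real m)))
      - (\<Sum>i<2 * m ^ 3 + 1. (1 / (real m)\<^sup>2) *\<^sub>R cs (g k (s - (real i / (real m)\<^sup>2 - real m))) (H (Suc j) (real i / (real m)\<^sup>2 - real m)))) \<le> 14 * \<Gamma> * B / real m"
proof -
  \<comment> \<open>With mesh \<open>1 / m\<^sup>2\<close> on an interval of length about
    \<open>2 * m\<close>, errors quadratic in the mesh on each of the \<open>n\<close> cells add up
    to a multiple of \<open>n * \<delta>\<^sup>2 \<le> 3 / m\<close>.\<close>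
  define \<delta> where "\<delta> = 1 / (real m)\<^sup>2"
  define n where "n = 2 * m ^ 3 + 1"
  define y where "y i = real i / (real m)\<^sup>2 - real m" for i
  define w where "w = (1 + \<bar>s\<bar>) ^ A"
  have w: "w > 0" by (simp add: w_def add_pos_nonneg)
  have \<delta>: "\<delta> > 0" using m by (simp add: \<delta>_def)
  have B: "B \<ge> 0" using Hb[of 0 0] nrm_nonneg[OF H(1), of M 0 0] by (simp del: nrm_nonneg)
  have \<Gamma>: "\<Gamma> \<ge> 0" using g(2)[of 0 0] norm_ge_zero[of "g 0 0"] by (simp del: norm_ge_zero)
  have ys: "y (Suc i) - y i = \<delta>" for i by (simp add: y_def \<delta>_def diff_divide_distrib[symmetric])
  let ?p = "\<lambda>k j y. cs (g k (s - y)) (H j y)"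
  have pX: "?p k j y \<in> X" for k j y using H by auto
  have pb: "w * nrm M (?p k j y) \<le> \<Gamma> * B / (1 + \<bar>y\<bar>)" if "k \<le> N + 2" "j \<le> N + 2" for k j y
    unfolding w_def by (rule weighted_product_bound[OF g(2)[OF that(1)] H(1) Hb[OF that(2)] B])
  have pb': "w * nrm M (?p k j y) \<le> \<Gamma> * B" if "k \<le> N + 2" "j \<le> N + 2" for k j y
  proof -
    have "\<Gamma> * B / (1 + \<bar>y\<bar>) \<le> \<Gamma> * B" using mult_nonneg_nonneg[OF \<Gamma> B] by (auto simp: divide_le_eq add_pos_nonneg mult_le_cancel_left1)
    then show ?thesis using pb[OF that, of y] by linarith
  qed
  \<comment> \<open>The grid variable reaches the kernel through \<open>s - y\<close>; the resulting
    minus sign makes the difference of the two sums a Riemann sum of a derivative.\<close>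
  have pd: "vderiv M (?p k j) (cs (- 1) (?p (Suc k) j y) + ?p k (Suc j) y) y" for k j y
  proof -
    have "(g k \<circ> (\<lambda>y. s - y) has_vector_derivative (- 1) *\<^sub>R g (Suc k) (s - y)) (at y)"
      using g(1) unfolding rapid1_def
      by (intro vector_diff_chain_at) (auto intro!: derivative_eq_intros simp: has_vector_derivative_def)
    then have "((\<lambda>y. g k (s - y)) has_vector_derivative - g (Suc k) (s - y)) (at y)" by (simp add: o_def)
    from vderiv_cs[OF H(1) H(1) H(2)[of j y] this] show ?thesis by (simp add: cs_minus_left)
  qed
  let ?f = "?p k j" and ?f' = "\<lambda>y. cs (- 1) (?p (Suc k) j y) + ?p k (Suc j) y"
  let ?f'' = "\<lambda>y. cs (- 1) (cs (- 1) (?p (Suc (Suc k)) j y) + ?p (Suc k) (Suc j) y) + (cs (- 1) (?p (Suc k) (Suc j) y) + ?p k (Suc (Suc j)) y)"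
  have d': "vderiv M ?f' (?f'' y) y" for y
  proof (rule vderiv_add)
    have "vderiv M (\<lambda>y. cs (- 1) (?p (Suc k) j y)) (cs 0 (?p (Suc k) j y) + cs (- 1) (cs (- 1) (?p (Suc (Suc k)) j y) + ?p (Suc k) (Suc j) y)) y"
      by (rule vderiv_cs[OF _ _ pd has_vector_derivative_const]) (intro X_add X_cs pX)+
    then show "vderiv M (\<lambda>y. cs (- 1) (?p (Suc k) j y)) (cs (- 1) (cs (- 1) (?p (Suc (Suc k)) j y) + ?p (Suc k) (Suc j) y)) y" by simp
  qed (intro X_add X_cs pX pd)+
  have f''b: "nrm M (?f'' y) \<le> 4 * \<Gamma> * B / w" for y
  proof -
    have "nrm M (?f'' y) \<le> nrm M (cs (- 1) (cs (- 1) (?p (Suc (Suc k)) j y) + ?p (Suc k) (Suc j) y)) + nrm M (cs (- 1) (?p (Suc k) (Suc j) y) + ?p k (Suc (Suc j)) y)"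
      by (intro nrm_add X_add X_cs pX)
    also have "nrm M (cs (- 1) (cs (- 1) (?p (Suc (Suc k)) j y) + ?p (Suc k) (Suc j) y)) = nrm M (cs (- 1) (?p (Suc (Suc k)) j y) + ?p (Suc k) (Suc j) y)"
      using nrm_cs[of "cs (- 1) (?p (Suc (Suc k)) j y) + ?p (Suc k) (Suc j) y" M "-1"] by (simp add: X_add X_cs pX)
    also have "\<dots> \<le> nrm M (cs (- 1) (?p (Suc (Suc k)) j y)) + nrm M (?p (Suc k) (Suc j) y)"
      by (intro nrm_add X_cs pX)
    also have "nrm M (cs (- 1) (?p (Suc k) (Suc j) y) + ?p k (Suc (Suc j)) y) \<le> nrm M (cs (- 1) (?p (Suc k) (Suc j) y)) + nrm M (?p k (Suc (Suc j)) y)"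
      by (intro nrm_add X_cs pX)
    finally have "nrm M (?f'' y) \<le> nrm M (?p (Suc (Suc k)) j y) + nrm M (?p (Suc k) (Suc j) y) + (nrm M (?p (Suc k) (Suc j) y) + nrm M (?p k (Suc (Suc j)) y))"
      using nrm_cs[OF pX, of M "-1"] by simp
    then have "w * nrm M (?f'' y) \<le> w * (nrm M (?p (Suc (Suc k)) j y) + nrm M (?p (Suc k) (Suc j) y) + (nrm M (?p (Suc k) (Suc j) y) + nrm M (?p k (Suc (Suc j)) y)))"
      using w by (intro mult_left_mono) auto
    also have "\<dots> \<le> 4 * \<Gamma> * B"
      using pb'[of "Suc (Suc k)" j y] pb'[of "Suc k" "Suc j" y] pb'[of k "Suc (Suc j)" y] k
      by (simp add: distrib_left)
    finally show ?thesis using w by (simp add: pos_le_divide_eq mult.commute)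
  qed
  \<comment> \<open>Remainders of the increments: the increments telescope to the two end values, so
    the Riemann sum of the derivative equals boundary terms minus remainders.\<close>
  define e where "e i = ?f (y (Suc i)) - ?f (y i) - \<delta> *\<^sub>R ?f' (y i)" for i
  have eX: "e i \<in> X" for i unfolding e_def by (intro X_diff X_scaleR X_add X_cs pX)
  have eb: "nrm M (e i) \<le> 4 * \<Gamma> * B / w * \<delta>\<^sup>2" for i
    unfolding e_def using vderiv_taylor2[OF pX _ _ pd d' f''b, where u = "y i" and v = "y (Suc i)", unfolded ys]
    by (simp add: X_add X_cs pX)
  have sum: "(\<Sum>i<n. \<delta> *\<^sub>R ?f' (y i)) = (?f (y n) - ?f (y 0)) - (\<Sum>i<n. e i)"
  proof -
    have "(\<Sum>i<n. e i) = (\<Sum>i<n. ?f (y (Suc i)) - ?f (y i)) - (\<Sum>i<n. \<delta> *\<^sub>R ?f' (y i))"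
      unfolding e_def by (rule sum_subtractf)
    also have "(\<Sum>i<n. ?f (y (Suc i)) - ?f (y i)) = ?f (y n) - ?f (y 0)"
      by (rule sum_lessThan_telescope[of "\<lambda>i. ?f (y i)"])
    finally show ?thesis by simp
  qed
  have "nrm M (\<Sum>i<n. \<delta> *\<^sub>R ?f' (y i)) \<le> nrm M (?f (y n) - ?f (y 0)) + nrm M (\<Sum>i<n. e i)"
    unfolding sum by (intro nrm_diff X_diff X_sum pX eX)
  also have "nrm M (?f (y n) - ?f (y 0)) \<le> nrm M (?f (y n)) + nrm M (?f (y 0))"
    by (intro nrm_diff pX)
  also have "nrm M (\<Sum>i<n. e i) \<le> (\<Sum>i<n. nrm M (e i))" by (intro nrm_sum eX)
  also have "\<dots> \<le> (\<Sum>i<n. 4 * \<Gamma> * B / w * \<delta>\<^sup>2)" by (intro sum_mono eb)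
  also have "\<dots> = real n * \<delta>\<^sup>2 * (4 * \<Gamma> * B) / w" by simp
  finally have "w * nrm M (\<Sum>i<n. \<delta> *\<^sub>R ?f' (y i)) \<le> w * (nrm M (?f (y n)) + nrm M (?f (y 0)) + real n * \<delta>\<^sup>2 * (4 * \<Gamma> * B) / w)"
    using w by (intro mult_left_mono) auto
  also have "\<dots> = w * nrm M (?f (y n)) + w * nrm M (?f (y 0)) + real n * \<delta>\<^sup>2 * (4 * \<Gamma> * B)"
    using w by (simp add: distrib_left)
  also have "\<dots> \<le> \<Gamma> * B / real m + \<Gamma> * B / real m + (3 / real m) * (4 * \<Gamma> * B)"
  proof (intro add_mono mult_right_mono)
    have yn: "y n = real m + \<delta>" "y 0 = - real m"
      using m by (simp_all add: y_def n_def \<delta>_def field_simps power2_eq_square power3_eq_cube)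
    have \<Gamma>B: "0 \<le> \<Gamma> * B" using \<Gamma> B by simp
    have "\<Gamma> * B / (1 + \<bar>y n\<bar>) \<le> \<Gamma> * B / real m" "\<Gamma> * B / (1 + \<bar>y 0\<bar>) \<le> \<Gamma> * B / real m"
      using m \<Gamma>B \<delta> unfolding yn by (auto intro!: divide_left_mono)
    then show "w * nrm M (?f (y n)) \<le> \<Gamma> * B / real m" "w * nrm M (?f (y 0)) \<le> \<Gamma> * B / real m"
      using pb[of k j "y n"] pb[of k j "y 0"] k by linarith+
    have "real n \<le> 3 * (real m) ^ 3" using m by (simp add: n_def)
    then have "real n * \<delta>\<^sup>2 \<le> (3 * (real m) ^ 3) * \<delta>\<^sup>2" by (intro mult_right_mono) auto
    also have "\<dots> = 3 / real m" using m by (simp add: \<delta>_def field_simps power2_eq_square power3_eq_cube)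
    finally show "real n * \<delta>\<^sup>2 \<le> 3 / real m" .
    show "0 \<le> 4 * \<Gamma> * B" using \<Gamma> B by simp
  qed
  \<comment> \<open>The constant is 1 + 1 from the two ends plus 3 * 4 from the remainders, the 4
    counting the terms of the second derivative.\<close>
  also have "\<dots> = 14 * \<Gamma> * B / real m" using m by (simp add: field_simps)
  finally have main: "w * nrm M (\<Sum>i<n. \<delta> *\<^sub>R ?f' (y i)) \<le> 14 * \<Gamma> * B / real m" .
  have "(\<Sum>i<n. \<delta> *\<^sub>R ?p (Suc k) j (y i)) - (\<Sum>i<n. \<delta> *\<^sub>R ?p k (Suc j) (y i)) = - (\<Sum>i<n. \<delta> *\<^sub>R ?f' (y i))"
    unfolding sum_subtractf[symmetric] sum_negf[symmetric]
    by (intro sum.cong refl) (simp add: cs_minus_left scaleR_diff_right)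
  then have "nrm M ((\<Sum>i<n. \<delta> *\<^sub>R ?p (Suc k) j (y i)) - (\<Sum>i<n. \<delta> *\<^sub>R ?p k (Suc j) (y i))) = nrm M (\<Sum>i<n. \<delta> *\<^sub>R ?f' (y i))"
    by (simp add: nrm_minus X_sum X_scaleR X_add X_cs pX)
  then show ?thesis using main unfolding w_def \<delta>_def n_def y_def by simp
qed

end

text \<open>One quarter of the exponent absorbs \<open>sqrt a * \<bar>u\<bar>\<close>, another
  quarter absorbs the weight, and the remaining half is again a normalised density up to
  \<open>sqrt 2\<close>. The gain \<open>1 / sqrt a\<close> is the smoothing error for a Lipschitz
  function.\<close>

lemma gd_moment:
  assumes a: "a \<ge> 1"
  shows "gd a u * (\<bar>u\<bar> * (1 + \<bar>u\<bar>) ^ A) \<le> (sqrt 2 * exp ((real A)\<^sup>2) / sqrt a) * gd (a / 2) u"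
proof -
  define t where "t = sqrt a * \<bar>u\<bar>"
  have t2: "t\<^sup>2 = a * u\<^sup>2" using a by (simp add: t_def power_mult_distrib)
  have "t \<le> 1 + t\<^sup>2 / 4" using zero_le_power2[of "t / 2 - 1"] by (simp add: power2_diff power_divide)
  also have "\<dots> \<le> exp (t\<^sup>2 / 4)" by (rule exp_ge_add_one_self)
  finally have "t * exp (- (t\<^sup>2 / 4)) \<le> exp (t\<^sup>2 / 4) * exp (- (t\<^sup>2 / 4))" by (intro mult_right_mono) auto
  then have 1: "sqrt a * \<bar>u\<bar> * exp (- (a * u\<^sup>2 / 4)) \<le> 1" by (simp add: t_def[symmetric] t2[symmetric] exp_minus)
  have "(1 + \<bar>u\<bar>) ^ A * exp (- (a * u\<^sup>2 / 4)) \<le> (1 + \<bar>u\<bar>) ^ A * exp (- (1 / 4) * u\<^sup>2)"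
    using a by (intro mult_left_mono) (auto simp: mult_le_cancel_right1 zero_le_power2 mult_right_mono[of 1 a "u\<^sup>2", simplified])
  also have "\<dots> \<le> exp ((real A)\<^sup>2)" using poly_gauss_bound[of "1/4" u A] by simp
  finally have 2: "(1 + \<bar>u\<bar>) ^ A * exp (- (a * u\<^sup>2 / 4)) \<le> exp ((real A)\<^sup>2)" .
  have "(sqrt a * \<bar>u\<bar> * exp (- (a * u\<^sup>2 / 4))) * ((1 + \<bar>u\<bar>) ^ A * exp (- (a * u\<^sup>2 / 4))) \<le> 1 * exp ((real A)\<^sup>2)"
    using a by (intro mult_mono 1 2) auto
  then have 3: "(sqrt a * (\<bar>u\<bar> * (1 + \<bar>u\<bar>) ^ A)) * exp (- (a * u\<^sup>2 / 2)) \<le> exp ((real A)\<^sup>2)"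
    by (simp add: mult_ac exp_add[symmetric])
  have e: "exp (- a * u\<^sup>2) = exp (- (a * u\<^sup>2 / 2)) * exp (- (a / 2) * u\<^sup>2)" by (simp add: exp_add[symmetric])
  have s: "sqrt (a / pi) = sqrt 2 * sqrt (a / 2 / pi)" using a by (simp add: real_sqrt_mult[symmetric])
  have sa: "sqrt a > 0" using a by simp
  have "sqrt a * (gd a u * (\<bar>u\<bar> * (1 + \<bar>u\<bar>) ^ A)) = ((sqrt a * (\<bar>u\<bar> * (1 + \<bar>u\<bar>) ^ A)) * exp (- (a * u\<^sup>2 / 2))) * (sqrt 2 * gd (a / 2) u)"
    unfolding gd_def e s by (simp add: mult_ac)
  also have "\<dots> \<le> exp ((real A)\<^sup>2) * (sqrt 2 * gd (a / 2) u)"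
    using a gd_nonneg[of "a / 2" u] by (intro mult_right_mono 3) auto
  finally show ?thesis using sa by (simp add: field_simps)
qed

context frechet
begin

text \<open>Width and grid are fixed before \<open>H\<close>, with an error linear in
  \<open>c\<close>. This uniformity lets one Riemann sum serve all values of the other coordinates,
  which enter only through \<open>H\<close> and \<open>c\<close>. The width \<open>a\<close> is
  chosen to make the smoothing error small, and \<open>m\<close>, depending on \<open>a\<close>, to
  control the discretisation.\<close>

lemma approx_1d:
  assumes \<epsilon>: "\<epsilon> > 0" and C0: "C0 \<ge> 0"
  shows "\<exists>a>0. \<exists>m. \<forall>c H. 0 \<le> c \<longrightarrow> (\<forall>j s. H j s \<in> X) \<longrightarrow> (\<forall>j s. vderiv M (H j) (H (Suc j) s) s) \<longrightarrow>
     (\<forall>j\<le>N + 2. \<forall>s. (1 + \<bar>s\<bar>) ^ Suc A * nrm M (H j s) \<le> C0 * c) \<longrightarrow>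
     (\<forall>b\<le>N. \<forall>s. (1 + \<bar>s\<bar>) ^ A * nrm M (H b s - (\<Sum>i<2 * m ^ 3 + 1. (1 / (real m)\<^sup>2) *\<^sub>R
        cs (Gd a b (s - (real i / (real m)\<^sup>2 - real m))) (H 0 (real i / (real m)\<^sup>2 - real m)))) \<le> \<epsilon> * c)"
proof -
  define D where "D = sqrt 2 * exp ((real A)\<^sup>2)"
  have D: "D \<ge> 0" by (simp add: D_def)
  \<comment> \<open>The square root of \<open>a\<close>; the summand 1 makes
    \<open>C0 * (D / sqrt a)\<close> strictly less than \<open>\<epsilon>\<close> and ensures
    \<open>a \<ge> 1\<close>.\<close>
  define ra where "ra = C0 * D / \<epsilon> + 1"
  define a where "a = ra\<^sup>2"
  have ra: "ra \<ge> 1" using C0 D \<epsilon> by (simp add: ra_def)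
  have sa: "sqrt a = ra" using ra by (simp add: a_def)
  have a: "a \<ge> 1" using ra by (simp add: a_def)
  then have a0: "a > 0" "a / 2 > 0" by auto
  have aD: "C0 * (D / sqrt a) < \<epsilon>"
    unfolding sa using ra \<epsilon> by (simp add: pos_divide_less_eq) (simp add: ra_def field_simps)
  obtain \<Gamma> where \<Gamma>: "\<Gamma> \<ge> 0" "\<forall>k\<le>N + 2. \<forall>s. (1 + \<bar>s\<bar>) ^ A * norm (Gd a k s) \<le> \<Gamma>"
    using rapid1_bound_upto[OF rapid1_Gd[OF a0(1)]] by blast
  obtain L where L: "L \<ge> 0" "\<And>u v. \<bar>gd a u - gd a v\<bar> \<le> L * \<bar>u - v\<bar>" using gd_lipschitz[OF a0(1)] by blast
  obtain L' where L': "L' \<ge> 0" "\<And>u v. \<bar>gd (a / 2) u - gd (a / 2) v\<bar> \<le> L' * \<bar>u - v\<bar>" using gd_lipschitz[OF a0(2)] by blast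
  define \<tau> where "\<tau> m = 1 - integral {- (real m / 2)..real m / 2} (gd a)" for m :: nat
  \<comment> \<open>The contributions are the Abel summation error, the smoothing error times the
    discrete mass, and the missing mass of the kernel, the latter with separate terms for
    \<open>s\<close> near and far from the origin.\<close>
  define E where "E m = C0 * (real N * (14 * \<Gamma>) / real m + (D / sqrt a * (1 + 3 * L' / real m)
     + (\<tau> m + 3 * L / real m + 2 / real m * (1 + 3 * L / real m))))" for m :: nat
  have \<tau>0: "\<tau> m \<ge> 0" for m using gd_integral_le_1[OF a0(1)] by (simp add: \<tau>_def)
  have "E \<longlonglongrightarrow> C0 * (0 + (D / sqrt a * (1 + 0) + (0 + 0 + 0 * (1 + 0))))"
    unfolding E_def[abs_def] \<tau>_def[abs_def]
    by (intro tendsto_intros gd_tail a0 lim_const_over_n)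
  then have "E \<longlonglongrightarrow> C0 * (D / sqrt a)" by simp
  then have "\<forall>\<^sub>F m in sequentially. E m < \<epsilon>" using aD by (rule order_tendstoD(2))
  then obtain m where m: "m > 0" "E m < \<epsilon>"
    using eventually_conj[OF eventually_gt_at_top[of 0]] by (metis (mono_tags, lifting) eventually_sequentially order_refl)
  define \<delta> where "\<delta> = 1 / (real m)\<^sup>2"
  define n where "n = 2 * m ^ 3 + 1"
  define y where "y i = real i / (real m)\<^sup>2 - real m" for i
  have \<delta>: "\<delta> > 0" using m by (simp add: \<delta>_def)
  have n\<delta>: "real n * \<delta>\<^sup>2 \<le> 3 / real m" "\<delta> * real n = 2 * real m + \<delta>"
  proof -
    have "real n \<le> 3 * (real m) ^ 3" using m by (simp add: n_def)
    then have "real n * \<delta>\<^sup>2 \<le> (3 * (real m) ^ 3) * \<delta>\<^sup>2" by (intro mult_right_mono) auto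
    also have "\<dots> = 3 / real m" using m by (simp add: \<delta>_def field_simps power2_eq_square power3_eq_cube)
    finally show "real n * \<delta>\<^sup>2 \<le> 3 / real m" .
    show "\<delta> * real n = 2 * real m + \<delta>"
      using m by (simp add: n_def \<delta>_def field_simps power2_eq_square power3_eq_cube)
  qed
  have riemann: "\<bar>(\<Sum>i<n. \<delta> * gd a' (s - y i)) - integral {- real m - s..real m + \<delta> - s} (gd a')\<bar> \<le> 3 * L'' / real m"
    if L: "\<And>u v. \<bar>gd a' u - gd a' v\<bar> \<le> L'' * \<bar>u - v\<bar>" for a' L'' s
  proof -
    have L0: "L'' \<ge> 0" using L[of 1 0] by simp
    have e1: "gd a' (s - y i) = gd a' ((- real m - s) + \<delta> * real i)" for i
      using gd_even[of a' "s - y i"] by (simp add: y_def \<delta>_def algebra_simps)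
    have e2: "(- real m - s) + \<delta> * real n = real m + \<delta> - s" using n\<delta>(2) by simp
    have "\<bar>(\<Sum>i<n. \<delta> * gd a' (s - y i)) - integral {- real m - s..real m + \<delta> - s} (gd a')\<bar> \<le> real n * (\<delta>\<^sup>2 * L'')"
      unfolding e1 e2[symmetric] using gd_riemann[OF L, of \<delta> "- real m - s" n] \<delta> by simp
    also have "\<dots> \<le> 3 / real m * L''" using mult_right_mono[OF n\<delta>(1) L0] by (simp add: mult_ac)
    finally show ?thesis by simp
  qed
  have concl: "(1 + \<bar>s\<bar>) ^ A * nrm M (H b s - (\<Sum>i<n. \<delta> *\<^sub>R cs (Gd a b (s - y i)) (H 0 (y i)))) \<le> \<epsilon> * c"
    if c: "0 \<le> c" and H: "\<And>j s. H j s \<in> X" "\<And>j s. vderiv M (H j) (H (Suc j) s) s"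
      and Hb: "\<And>j s. j \<le> N + 2 \<Longrightarrow> (1 + \<bar>s\<bar>) ^ Suc A * nrm M (H j s) \<le> C0 * c" and b: "b \<le> N"
    for c H b s
  proof -
    define B where "B = C0 * c"
    define w where "w = (1 + \<bar>s\<bar>) ^ A"
    have B: "B \<ge> 0" using C0 c by (simp add: B_def)
    have w: "w > 0" by (simp add: w_def add_pos_nonneg)
    define S where "S k j = (\<Sum>i<n. \<delta> *\<^sub>R cs (Gd a k (s - y i)) (H j (y i)))" for k j
    have SX: "S k j \<in> X" for k j unfolding S_def by (intro X_sum X_scaleR X_cs H)
    have step: "w * nrm M (S (Suc k) j - S k (Suc j)) \<le> 14 * \<Gamma> * B / real m" if "k \<le> N" "j \<le> N" for k j
      unfolding S_def w_def B_def n_def \<delta>_def y_def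
    proof (rule abel_step[where N = N and H = H and g = "Gd a" and \<Gamma> = \<Gamma>])
      show "(1 + \<bar>s\<bar>) ^ Suc A * nrm M (H j s) \<le> C0 * c" if "j \<le> N + 2" for j s by (rule Hb[OF that])
      show "(1 + \<bar>s\<bar>) ^ A * norm (Gd a k s) \<le> \<Gamma>" if "k \<le> N + 2" for k s using \<Gamma>(2) that by blast
    qed (use H that m rapid1_Gd[OF a0(1)] in auto)
    \<comment> \<open>The \<open>b\<close> derivatives are transferred one at a time from the kernel
      to \<open>H\<close>.\<close>
    have tele: "i \<le> b \<Longrightarrow> w * nrm M (S b 0 - S (b - i) i) \<le> real i * (14 * \<Gamma> * B / real m)" for i
    proof (induction i)
      case (Suc i)
      have "nrm M (S b 0 - S (b - Suc i) (Suc i)) \<le> nrm M (S b 0 - S (b - i) i) + nrm M (S (b - i) i - S (b - Suc i) (Suc i))"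
        by (intro nrm_triangle SX)
      then have "w * nrm M (S b 0 - S (b - Suc i) (Suc i)) \<le> w * nrm M (S b 0 - S (b - i) i) + w * nrm M (S (b - i) i - S (b - Suc i) (Suc i))"
        using w by (simp add: distrib_left[symmetric])
      moreover have "w * nrm M (S (b - i) i - S (b - Suc i) (Suc i)) \<le> 14 * \<Gamma> * B / real m"
        using step[of "b - Suc i" i] Suc.prems b by (simp add: Suc_diff_Suc)
      moreover have "w * nrm M (S b 0 - S (b - i) i) \<le> real i * (14 * \<Gamma> * B / real m)" using Suc by simp
      moreover have "real (Suc i) * (14 * \<Gamma> * B / real m) = real i * (14 * \<Gamma> * B / real m) + 14 * \<Gamma> * B / real m"
        by (simp only: of_nat_Suc distrib_right mult_1_left)
      ultimately show ?case by linarith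
    qed simp
    have 1: "w * nrm M (S b 0 - S 0 b) \<le> real N * (14 * \<Gamma>) / real m * B"
    proof -
      have "w * nrm M (S b 0 - S 0 b) \<le> real b * (14 * \<Gamma> * B / real m)" using tele[of b] by simp
      also have "\<dots> \<le> real N * (14 * \<Gamma> * B / real m)" using b \<Gamma> B by (intro mult_right_mono) auto
      finally show ?thesis by (simp add: mult_ac)
    qed
    define q where "q i = \<delta> * gd a (s - y i)" for i
    have q0: "q i \<ge> 0" for i using \<delta> gd_nonneg[OF a0(1)] by (simp add: q_def)
    have S0: "S 0 b = (\<Sum>i<n. q i *\<^sub>R H b (y i))"
      by (simp add: S_def q_def Gd_0 cs_of_real)
    \<comment> \<open>Inserting \<open>H b s\<close> times the discrete mass separates the defect of
      mass from an average of increments of \<open>H b\<close>.\<close>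
    have eq: "H b s - S 0 b = (1 - sum q {..<n}) *\<^sub>R H b s + (\<Sum>i<n. q i *\<^sub>R (H b s - H b (y i)))"
      unfolding S0 by (simp add: scaleR_diff_right scaleR_diff_left sum_subtractf scaleR_sum_left)
    have lip: "w * nrm M (H b s - H b u) \<le> B * (\<bar>s - u\<bar> * (1 + \<bar>s - u\<bar>) ^ A)" for u
    proof -
      have "nrm M (H b s - H b u) \<le> (B * (1 + \<bar>s - u\<bar>) ^ A / w) * \<bar>s - u\<bar>"
      proof (rule vderiv_mvt[OF H(1) H(1) H(2)])
        fix v assume v: "v \<in> closed_segment u s"
        have sv: "\<bar>s - v\<bar> \<le> \<bar>s - u\<bar>" using v by (auto simp: closed_segment_eq_real_ivl split: if_splits)
        have "w * nrm M (H (Suc b) v) \<le> ((1 + \<bar>s - v\<bar>) ^ A * (1 + \<bar>v\<bar>) ^ A) * nrm M (H (Suc b) v)"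
          unfolding w_def using H by (intro mult_right_mono one_plus_abs_pow) auto
        also have "\<dots> = (1 + \<bar>s - v\<bar>) ^ A * ((1 + \<bar>v\<bar>) ^ A * nrm M (H (Suc b) v))" by simp
        also have "\<dots> \<le> (1 + \<bar>s - u\<bar>) ^ A * B"
        proof (intro mult_mono power_mono)
          have "(1 + \<bar>v\<bar>) ^ A * nrm M (H (Suc b) v) \<le> (1 + \<bar>v\<bar>) ^ Suc A * nrm M (H (Suc b) v)"
            using H by (intro mult_right_mono power_increasing) auto
          also have "\<dots> \<le> B" unfolding B_def using b by (intro Hb) simp
          finally show "(1 + \<bar>v\<bar>) ^ A * nrm M (H (Suc b) v) \<le> B" .
        qed (use sv H in auto)
        finally show "nrm M (H (Suc b) v) \<le> B * (1 + \<bar>s - u\<bar>) ^ A / w"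
          using w by (simp add: pos_le_divide_eq mult_ac)
      qed
      then have "w * nrm M (H b s - H b u) \<le> w * ((B * (1 + \<bar>s - u\<bar>) ^ A / w) * \<bar>s - u\<bar>)"
        using w by (intro mult_left_mono) auto
      then show ?thesis using w by (simp add: mult_ac)
    qed
    have 2: "w * nrm M (\<Sum>i<n. q i *\<^sub>R (H b s - H b (y i))) \<le> B * (D / sqrt a * (1 + 3 * L' / real m))"
    proof -
      have "nrm M (\<Sum>i<n. q i *\<^sub>R (H b s - H b (y i))) \<le> (\<Sum>i<n. nrm M (q i *\<^sub>R (H b s - H b (y i))))"
        by (intro nrm_sum X_scaleR X_diff H)
      also have "\<dots> = (\<Sum>i<n. q i * nrm M (H b s - H b (y i)))"
        using q0 by (simp add: nrm_scaleR X_diff H)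
      finally have "w * nrm M (\<Sum>i<n. q i *\<^sub>R (H b s - H b (y i))) \<le> w * (\<Sum>i<n. q i * nrm M (H b s - H b (y i)))"
        using w by (intro mult_left_mono) auto
      also have "\<dots> = (\<Sum>i<n. q i * (w * nrm M (H b s - H b (y i))))" by (simp add: sum_distrib_left mult_ac)
      also have "\<dots> \<le> (\<Sum>i<n. q i * (B * (\<bar>s - y i\<bar> * (1 + \<bar>s - y i\<bar>) ^ A)))"
        using q0 by (intro sum_mono mult_left_mono lip) auto
      also have "\<dots> \<le> (\<Sum>i<n. B * (D / sqrt a) * (\<delta> * gd (a / 2) (s - y i)))"
      proof (rule sum_mono)
        fix i
        have "(B * \<delta>) * (gd a (s - y i) * (\<bar>s - y i\<bar> * (1 + \<bar>s - y i\<bar>) ^ A)) \<le> (B * \<delta>) * ((sqrt 2 * exp ((real A)\<^sup>2) / sqrt a) * gd (a / 2) (s - y i))"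
          using B \<delta> by (intro mult_left_mono gd_moment a) auto
        then show "q i * (B * (\<bar>s - y i\<bar> * (1 + \<bar>s - y i\<bar>) ^ A)) \<le> B * (D / sqrt a) * (\<delta> * gd (a / 2) (s - y i))"
          by (simp add: q_def D_def mult_ac)
      qed
      also have "\<dots> = B * (D / sqrt a) * (\<Sum>i<n. \<delta> * gd (a / 2) (s - y i))" by (simp add: sum_distrib_left)
      also have "\<dots> \<le> B * (D / sqrt a) * (1 + 3 * L' / real m)"
      proof (intro mult_left_mono)
        show "(\<Sum>i<n. \<delta> * gd (a / 2) (s - y i)) \<le> 1 + 3 * L' / real m"
          using riemann[OF L'(2), of s] gd_integral_le_1[OF a0(2), of "- real m - s" "real m + \<delta> - s"] by linarith
        show "0 \<le> B * (D / sqrt a)" using B D a by simp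
      qed
      finally show ?thesis by (simp add: mult_ac)
    qed
    have 3: "w * nrm M ((1 - sum q {..<n}) *\<^sub>R H b s) \<le> B * (\<tau> m + 3 * L / real m + 2 / real m * (1 + 3 * L / real m))"
    proof -
      let ?I = "integral {- real m - s..real m + \<delta> - s} (gd a)"
      have qI: "\<bar>sum q {..<n} - ?I\<bar> \<le> 3 * L / real m" unfolding q_def by (rule riemann[OF L(2)])
      have I1: "?I \<le> 1" by (rule gd_integral_le_1[OF a0(1)])
      have I0: "0 \<le> ?I" by (intro integral_nonneg gd_integrable) (simp add: gd_nonneg[OF a0(1)])
      have wb: "w * nrm M (H b s) \<le> B / (1 + \<bar>s\<bar>)"
        using Hb[of b s] b by (simp add: B_def w_def pos_le_divide_eq add_pos_nonneg mult_ac)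
      have eq: "w * nrm M ((1 - sum q {..<n}) *\<^sub>R H b s) = \<bar>1 - sum q {..<n}\<bar> * (w * nrm M (H b s))"
        by (simp add: nrm_scaleR H)
      have wn: "0 \<le> w * nrm M (H b s)" using w H by simp
      have L0: "0 \<le> 3 * L / real m" using L by simp
      show ?thesis
      \<comment> \<open>Near the origin the grid window catches almost all of the mass; far away
        \<open>H b s\<close> itself is small, of weighted size \<open>2 * B / m\<close>, thanks to
        the spare weight.\<close>
      proof (cases "\<bar>s\<bar> \<le> real m / 2")
        case True
        have "integral {- (real m / 2)..real m / 2} (gd a) \<le> ?I"
          using True \<delta> by (intro integral_subset_le gd_integrable) (auto simp: gd_nonneg[OF a0(1)])
        then have "\<bar>1 - sum q {..<n}\<bar> \<le> \<tau> m + 3 * L / real m" using qI I1 by (simp add: \<tau>_def)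
        moreover have "w * nrm M (H b s) \<le> B"
        proof -
          have "B / (1 + \<bar>s\<bar>) \<le> B / 1" using B by (intro divide_left_mono) auto
          then show ?thesis using wb by simp
        qed
        ultimately have "\<bar>1 - sum q {..<n}\<bar> * (w * nrm M (H b s)) \<le> (\<tau> m + 3 * L / real m) * B"
          using wn \<tau>0[of m] L0 by (intro mult_mono) auto
        also have "\<dots> \<le> B * (\<tau> m + 3 * L / real m + 2 / real m * (1 + 3 * L / real m))"
        proof -
          have "B * (\<tau> m + 3 * L / real m + 0) \<le> B * (\<tau> m + 3 * L / real m + 2 / real m * (1 + 3 * L / real m))"
            using B L0 by (intro mult_left_mono add_mono mult_nonneg_nonneg) auto
          then show ?thesis by (simp add: mult.commute)
        qed
        finally show ?thesis unfolding eq .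
      next
        case False
        have "\<bar>1 - sum q {..<n}\<bar> \<le> 1 + 3 * L / real m" using qI I1 I0 by linarith
        moreover have "w * nrm M (H b s) \<le> B * (2 / real m)"
        proof -
          have "B / (1 + \<bar>s\<bar>) \<le> B / (real m / 2)" using B False m by (intro divide_left_mono) auto
          then show ?thesis using wb by simp
        qed
        ultimately have "\<bar>1 - sum q {..<n}\<bar> * (w * nrm M (H b s)) \<le> (1 + 3 * L / real m) * (B * (2 / real m))"
          by (rule mult_mono) (use wn L0 in auto)
        also have "\<dots> = B * (0 + 0 + 2 / real m * (1 + 3 * L / real m))" by (simp add: mult_ac)
        also have "\<dots> \<le> B * (\<tau> m + 3 * L / real m + 2 / real m * (1 + 3 * L / real m))"
          using B L0 \<tau>0[of m] by (intro mult_left_mono add_mono) auto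
        finally show ?thesis unfolding eq .
      qed
    qed
    have "nrm M (H b s - S 0 b) \<le> nrm M ((1 - sum q {..<n}) *\<^sub>R H b s) + nrm M (\<Sum>i<n. q i *\<^sub>R (H b s - H b (y i)))"
      unfolding eq by (intro nrm_add X_sum X_scaleR X_diff H)
    moreover have "nrm M (H b s - S b 0) \<le> nrm M (H b s - S 0 b) + nrm M (S b 0 - S 0 b)"
      using nrm_triangle[of "H b s" "S 0 b" "S b 0" M] nrm_minus_commute[OF SX SX, of M 0 b b 0] by (simp add: SX H)
    ultimately have "nrm M (H b s - S b 0) \<le> nrm M (S b 0 - S 0 b) + (nrm M (\<Sum>i<n. q i *\<^sub>R (H b s - H b (y i))) + nrm M ((1 - sum q {..<n}) *\<^sub>R H b s))"
      by simp
    then have "w * nrm M (H b s - S b 0) \<le> w * (nrm M (S b 0 - S 0 b) + (nrm M (\<Sum>i<n. q i *\<^sub>R (H b s - H b (y i))) + nrm M ((1 - sum q {..<n}) *\<^sub>R H b s)))"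
      using w by (intro mult_left_mono) auto
    also have "\<dots> = w * nrm M (S b 0 - S 0 b) + (w * nrm M (\<Sum>i<n. q i *\<^sub>R (H b s - H b (y i))) + w * nrm M ((1 - sum q {..<n}) *\<^sub>R H b s))"
      by (simp add: distrib_left)
    also have "\<dots> \<le> real N * (14 * \<Gamma>) / real m * B + (B * (D / sqrt a * (1 + 3 * L' / real m))
        + B * (\<tau> m + 3 * L / real m + 2 / real m * (1 + 3 * L / real m)))"
      by (intro add_mono 1 2 3)
    also have "\<dots> = E m * c" by (simp add: E_def B_def algebra_simps)
    also have "\<dots> \<le> \<epsilon> * c" using m c by (intro mult_right_mono) auto
    finally show ?thesis by (simp add: w_def S_def)
  qed
  show ?thesis
    using a0(1) concl unfolding n_def \<delta>_def y_def
    by (intro exI[of _ a] exI[of _ m] conjI allI impI) simp_all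
qed


section \<open>From one coordinate to all: functionals that annihilate Gaussians\<close>

lemma derivs_ok_sum:
  fixes f :: "'i \<Rightarrow> real^'n::finite \<Rightarrow> 'b"
  assumes "\<And>k. k \<in> S \<Longrightarrow> derivs_ok Xs nrm (f k) (D k)"
  shows "derivs_ok Xs nrm (\<lambda>x. \<Sum>k\<in>S. f k x) (\<lambda>\<beta> x. \<Sum>k\<in>S. D k \<beta> x)"
  using assms
proof (induction S rule: infinite_finite_induct)
  case (insert a S)
  then show ?case using derivs_ok_add[of "f a" "D a" "\<lambda>x. \<Sum>k\<in>S. f k x" "\<lambda>\<beta> x. \<Sum>k\<in>S. D k \<beta> x"] by simp
qed (auto intro!: derivs_okI simp: vderiv_const)

lemma derivs_ok_diff:
  fixes f g :: "real^'n::finite \<Rightarrow> 'b"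
  assumes "derivs_ok Xs nrm f D" "derivs_ok Xs nrm g E"
  shows "derivs_ok Xs nrm (\<lambda>x. f x - g x) (\<lambda>\<beta> x. D \<beta> x - E \<beta> x)"
  using derivs_ok_add[OF assms(1) derivs_ok_cs[OF assms(2), of "-1"]] by (simp add: cs_minus_left)

lemma derivs_ok_scaleR:
  fixes f :: "real^'n::finite \<Rightarrow> 'b"
  assumes "derivs_ok Xs nrm f D"
  shows "derivs_ok Xs nrm (\<lambda>x. r *\<^sub>R f x) (\<lambda>\<beta> x. r *\<^sub>R D \<beta> x)"
  using derivs_ok_cs[OF assms, of "of_real r"] by (simp add: cs_of_real)

text \<open>A functional vanishing on all slices in coordinate \<open>i\<close> vanishes on Riemann
  sums of slices, and these approximate \<open>h\<close> in the seminorms that control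
  \<open>\<Theta>\<close>. The one-dimensional approximation is applied on every line in direction
  \<open>i\<close> with the same grid.\<close>

lemma density_coordinate:
  fixes \<Theta> :: "(real^'n::finite \<Rightarrow> 'b) \<Rightarrow> complex"
  assumes \<Theta>: "sdist \<Theta>" and h: "schwartzX Xs nrm h"
    and z: "\<And>a y y'. a > 0 \<Longrightarrow> \<Theta> (\<lambda>x. cs (Gd a 0 (x $ i - y)) (h (vupd x i y'))) = 0"
  shows "\<Theta> h = 0"
proof -
  obtain D where D: "derivs_ok Xs nrm h D" "rapid D" using h unfolding schwartzX_iff_rapid by blast
  obtain M N A K where K: "K \<ge> 0" "\<And>f D C. derivs_ok Xs nrm f D \<Longrightarrow> rapid D \<Longrightarrow> 0 \<le> C \<Longrightarrow>
        (\<forall>\<beta>\<in>multi_idx N. \<forall>x. W A x * nrm M (D \<beta> x) \<le> C) \<Longrightarrow> norm (\<Theta> f) \<le> K * C"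
    using sdist_bound[OF \<Theta>] by blast
  have "\<forall>\<beta>. \<exists>C. \<forall>x. W (Suc A) x * nrm M (D \<beta> x) \<le> C" using D(2) unfolding rapid_def by blast
  then obtain Cf where Cf: "\<And>\<beta> x. W (Suc A) x * nrm M (D \<beta> x) \<le> Cf \<beta>" by metis
  have Cf0: "Cf \<beta> \<ge> 0" for \<beta>
  proof -
    have "0 \<le> W (Suc A) (0::real^'n) * nrm M (D \<beta> 0)" by (simp add: derivs_okD(2)[OF D(1)])
    then show ?thesis using Cf[of 0 \<beta>] by linarith
  qed
  \<comment> \<open>A box of multi-indices rather than \<open>multi_idx\<close>: the entry in
    direction \<open>i\<close> is replaced by values up to \<open>N + 2\<close> while the others
    stay at most \<open>N\<close>.\<close>
  define BB where "BB = (Pi\<^sub>E UNIV (\<lambda>_. {..N + 2}) :: ('n \<Rightarrow> nat) set)"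
  have fin: "finite BB" unfolding BB_def by (intro finite_PiE) auto
  define C0 where "C0 = sum Cf BB"
  have C0: "C0 \<ge> 0" unfolding C0_def using Cf0 by (intro sum_nonneg) auto
  have C0b: "W (Suc A) x * nrm M (D \<beta> x) \<le> C0" if "\<And>j. \<beta> j \<le> N + 2" for \<beta> x
  proof -
    have "\<beta> \<in> BB" using that by (auto simp: BB_def)
    then have "Cf \<beta> \<le> C0" unfolding C0_def using fin Cf0 by (intro member_le_sum) auto
    then show ?thesis using Cf[of x \<beta>] by linarith
  qed
  have "norm (\<Theta> h) \<le> K * \<epsilon>" if \<epsilon>: "\<epsilon> > 0" for \<epsilon>
  proof -
    obtain a m where a: "a > 0" and ap: "\<forall>c H. 0 \<le> c \<longrightarrow> (\<forall>j s. H j s \<in> X) \<longrightarrow> (\<forall>j s. vderiv M (H j) (H (Suc j) s) s) \<longrightarrow>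
     (\<forall>j\<le>N + 2. \<forall>s. (1 + \<bar>s\<bar>) ^ Suc A * nrm M (H j s) \<le> C0 * c) \<longrightarrow>
     (\<forall>b\<le>N. \<forall>s. (1 + \<bar>s\<bar>) ^ A * nrm M (H b s - (\<Sum>i<2 * m ^ 3 + 1. (1 / (real m)\<^sup>2) *\<^sub>R
        cs (Gd a b (s - (real i / (real m)\<^sup>2 - real m))) (H 0 (real i / (real m)\<^sup>2 - real m)))) \<le> \<epsilon> * c)"
      using approx_1d[OF \<epsilon> C0, where N = N and A = A and M = M] by (elim exE conjE)
    define y where "y l = real l / (real m)\<^sup>2 - real m" for l
    define \<delta> where "\<delta> = 1 / (real m)\<^sup>2"
    define n where "n = 2 * m ^ 3 + 1"
    let ?f = "\<lambda>l x. cs (Gd a 0 (x $ i - y l)) (h (vupd x i (y l)))"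
    let ?Df = "\<lambda>l \<beta> x. cs (Gd a (\<beta> i) (x $ i - y l)) (D (\<beta>(i := 0)) (vupd x i (y l)))"
    have f: "derivs_ok Xs nrm (?f l) (?Df l)" and fs: "schwartzX Xs nrm (?f l)" for l
    proof -
      note r = rapid1_shift[OF rapid1_Gd[OF a], of "y l"]
      show 1: "derivs_ok Xs nrm (?f l) (?Df l)" by (rule slice_derivs_ok[OF r D(1)])
      show "schwartzX Xs nrm (?f l)" by (rule rapid_schwartz[OF 1 slice_rapid[OF r D]])
    qed
    have fs': "schwartzX Xs nrm (\<lambda>x. \<delta> *\<^sub>R ?f l x)" for l
      using schwartz_cs[OF fs, of "of_real \<delta>" l] by (simp add: cs_of_real)
    define T where "T = (\<lambda>x. \<Sum>l<n. \<delta> *\<^sub>R ?f l x)"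
    define DT where "DT = (\<lambda>\<beta> x. \<Sum>l<n. \<delta> *\<^sub>R ?Df l \<beta> x)"
    have T: "derivs_ok Xs nrm T DT" unfolding T_def DT_def by (intro derivs_ok_sum derivs_ok_scaleR f)
    have Ts: "schwartzX Xs nrm T" unfolding T_def by (intro schwartz_sum fs')
    have d: "derivs_ok Xs nrm (\<lambda>x. h x - T x) (\<lambda>\<beta> x. D \<beta> x - DT \<beta> x)" by (rule derivs_ok_diff[OF D(1) T])
    have r: "rapid (\<lambda>\<beta> x. D \<beta> x - DT \<beta> x)" by (rule schwartz_rapid[OF schwartz_diff[OF h Ts] d])
    have "\<Theta> T = (\<Sum>l<n. \<Theta> (\<lambda>x. \<delta> *\<^sub>R ?f l x))" unfolding T_def by (intro sdist_sum[OF \<Theta>] fs')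
    also have "\<dots> = 0" using sdist_scaleR[OF \<Theta> fs] z[OF a] by simp
    finally have T0: "\<Theta> T = 0" .
    have "norm (\<Theta> (\<lambda>x. h x - T x)) \<le> K * \<epsilon>"
    proof (rule K(2)[OF d r])
      show "\<forall>\<beta>\<in>multi_idx N. \<forall>x. W A x * nrm M (D \<beta> x - DT \<beta> x) \<le> \<epsilon>"
      proof (intro ballI allI)
        fix \<beta> :: "'n \<Rightarrow> nat" and x :: "real^'n" assume "\<beta> \<in> multi_idx N"
        then have \<beta>: "\<beta> j \<le> N" for j using member_le_sum[of j UNIV \<beta>] by (simp add: multi_idx_def)
        define W' where "W' = (\<Prod>j\<in>UNIV - {i}. (1 + \<bar>x $ j\<bar>) ^ A)"
        have W': "W' > 0" unfolding W'_def by (intro prod_pos) (simp add: add_pos_nonneg)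
        define H where "H j s = D (\<beta>(i := j)) (vupd x i s)" for j s
        have "(1 + \<bar>x $ i\<bar>) ^ A * nrm M (H (\<beta> i) (x $ i) - (\<Sum>i'<2 * m ^ 3 + 1. (1 / (real m)\<^sup>2) *\<^sub>R
          cs (Gd a (\<beta> i) (x $ i - (real i' / (real m)\<^sup>2 - real m))) (H 0 (real i' / (real m)\<^sup>2 - real m)))) \<le> \<epsilon> * (1 / W')"
        proof (rule ap[rule_format])
          show "0 \<le> 1 / W'" using W' by simp
          show "H j s \<in> X" for j s unfolding H_def by (rule derivs_okD(2)[OF D(1)])
          show "vderiv M (H j) (H (Suc j) s) s" for j s
            using derivs_okD(3)[OF D(1), of M "\<beta>(i := j)" x i s] unfolding H_def[abs_def] by simp
          show "\<beta> i \<le> N" by (rule \<beta>)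
          fix j s assume j: "j \<le> N + 2"
          have "W' \<le> (\<Prod>j\<in>UNIV - {i}. (1 + \<bar>x $ j\<bar>) ^ Suc A)"
            unfolding W'_def by (intro prod_mono conjI power_increasing) auto
          then have "(1 + \<bar>s\<bar>) ^ Suc A * W' \<le> (1 + \<bar>s\<bar>) ^ Suc A * (\<Prod>j\<in>UNIV - {i}. (1 + \<bar>x $ j\<bar>) ^ Suc A)"
            by (intro mult_left_mono) auto
          also have "\<dots> = W (Suc A) (vupd x i s)"
            unfolding W_def by (subst (2) prod.remove[of _ i]) auto
          finally have "((1 + \<bar>s\<bar>) ^ Suc A * W') * nrm M (H j s) \<le> W (Suc A) (vupd x i s) * nrm M (H j s)"
            by (intro mult_right_mono) (simp_all add: H_def derivs_okD(2)[OF D(1)])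
          also have "\<dots> \<le> C0" unfolding H_def
          proof (rule C0b)
            show "(\<beta>(i := j)) j' \<le> N + 2" for j' using j \<beta>[of j'] by (cases "j' = i") auto
          qed
          finally show "(1 + \<bar>s\<bar>) ^ Suc A * nrm M (H j s) \<le> C0 * (1 / W')"
            using W' by (simp add: pos_le_divide_eq mult_ac)
        qed
        moreover have "H (\<beta> i) (x $ i) = D \<beta> x" by (simp add: H_def)
        moreover have "(\<Sum>i'<2 * m ^ 3 + 1. (1 / (real m)\<^sup>2) *\<^sub>R cs (Gd a (\<beta> i) (x $ i - (real i' / (real m)\<^sup>2 - real m))) (H 0 (real i' / (real m)\<^sup>2 - real m))) = DT \<beta> x"
          by (simp add: DT_def H_def y_def \<delta>_def n_def)
        ultimately have "(1 + \<bar>x $ i\<bar>) ^ A * nrm M (D \<beta> x - DT \<beta> x) \<le> \<epsilon> / W'" by simp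
        then have "((1 + \<bar>x $ i\<bar>) ^ A * W') * nrm M (D \<beta> x - DT \<beta> x) \<le> \<epsilon>"
          using W' by (simp add: pos_le_divide_eq mult_ac)
        moreover have "W A x = (1 + \<bar>x $ i\<bar>) ^ A * W'"
          unfolding W_def W'_def by (subst prod.remove[of _ i]) auto
        ultimately show "W A x * nrm M (D \<beta> x - DT \<beta> x) \<le> \<epsilon>" by simp
      qed
    qed (use \<epsilon> in simp)
    then show ?thesis using sdist_diff[OF \<Theta> h Ts] T0 by simp
  qed
  then have "norm (\<Theta> h) \<le> 0 + e" if "e > 0" for e
  proof -
    have "K * (e / (K + 1)) \<le> e" using K(1) that by (simp add: field_simps)
    moreover have "e / (K + 1) > 0" using K(1) that by simp
    ultimately show ?thesis using \<open>\<And>\<epsilon>. \<epsilon> > 0 \<Longrightarrow> norm (\<Theta> h) \<le> K * \<epsilon>\<close>[of "e / (K + 1)"] by linarith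
  qed
  then have "norm (\<Theta> h) \<le> 0" by (rule field_le_epsilon)
  then show ?thesis by simp
qed

text \<open>Interpolates between \<open>h\<close>, for empty \<open>I\<close>, and a tensor of
  shifted Gaussians with the constant vector \<open>h\<close> at \<open>y'\<close>, for full
  \<open>I\<close>.\<close>

definition slc :: "'n set \<Rightarrow> ('n \<Rightarrow> real) \<Rightarrow> ('n \<Rightarrow> real) \<Rightarrow> ('n \<Rightarrow> real) \<Rightarrow> (real^'n::finite \<Rightarrow> 'b) \<Rightarrow> real^'n \<Rightarrow> 'b" where
  "slc I a y y' h = (\<lambda>x. cs (\<Prod>i\<in>I. Gd (a i) 0 (x $ i - y i)) (h (\<chi> j. if j \<in> I then y' j else x $ j)))"

lemma slc_insert:
  assumes "i \<notin> I" "finite I"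
  shows "slc (insert i I) a y y' h = (\<lambda>x. cs (Gd (a i) 0 (x $ i - y i)) (slc I a y y' h (vupd x i (y' i))))"
proof
  fix x
  have "(\<Prod>j\<in>I. Gd (a j) 0 (vupd x i (y' i) $ j - y j)) = (\<Prod>j\<in>I. Gd (a j) 0 (x $ j - y j))"
    using assms by (intro prod.cong) auto
  moreover have "(\<chi> j. if j \<in> insert i I then y' j else x $ j) = (\<chi> j. if j \<in> I then y' j else vupd x i (y' i) $ j)"
    by (auto simp: vec_eq_iff)
  ultimately show "slc (insert i I) a y y' h x = cs (Gd (a i) 0 (x $ i - y i)) (slc I a y y' h (vupd x i (y' i)))"
    using assms by (simp add: slc_def cs_mult)
qed

lemma schwartz_slc:
  assumes "finite I" "\<And>i. a i > 0" "schwartzX Xs nrm h"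
  shows "schwartzX Xs nrm (slc I a y y' h)"
  using assms(1)
proof (induction I rule: finite_induct)
  case empty
  show ?case using assms(3) by (simp add: slc_def)
next
  case (insert i I)
  obtain D where D: "derivs_ok Xs nrm (slc I a y y' h) D" "rapid D"
    using insert.IH unfolding schwartzX_iff_rapid by blast
  note r = rapid1_shift[OF rapid1_Gd[OF assms(2)[of i]], of "y i"]
  show ?case unfolding slc_insert[OF insert(2,1)]
    by (rule rapid_schwartz[OF slice_derivs_ok[OF r D(1)] slice_rapid[OF r D]])
qed

text \<open>\<open>J\<close> is the set of released coordinates. For empty \<open>J\<close> the
  function is fully sliced and the hypothesis applies; each step uses the one-coordinate result to
  let one more variable of \<open>h\<close> vary freely.\<close>

lemma density:
  fixes \<Theta> :: "(real^'n::finite \<Rightarrow> 'b) \<Rightarrow> complex"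
  assumes \<Theta>: "sdist \<Theta>" and h: "schwartzX Xs nrm h"
    and z: "\<And>a y v. (\<And>i. a i > 0) \<Longrightarrow> v \<in> X \<Longrightarrow> \<Theta> (tens (\<lambda>i k s. Gd (a i) k (s - y i)) v) = 0"
  shows "\<Theta> h = 0"
proof -
  have "\<Theta> (slc (UNIV - J) a y y' h) = 0" if "finite J" "\<And>i. a i > 0" for J a y y'
    using that
  proof (induction J arbitrary: a y y' rule: finite_induct)
    case empty
    have "slc (UNIV - {}) a y y' h = tens (\<lambda>i k s. Gd (a i) k (s - y i)) (h (\<chi> j. y' j))"
      by (simp add: slc_def tens_def)
    then show ?case using z[OF empty schwartz_X[OF h]] by simp
  next
    case (insert i J)
    define I where "I = UNIV - insert i J"
    have I: "i \<notin> I" "finite I" "UNIV - J = insert i I" using insert by (auto simp: I_def)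
    show ?case unfolding I_def[symmetric]
    proof (rule density_coordinate[OF \<Theta> schwartz_slc[OF I(2) insert.prems h]])
      fix a0 y0 y0' :: real assume a0: "a0 > 0"
      let ?a = "a(i := a0)" and ?y = "y(i := y0)" and ?y' = "y'(i := y0')"
      \<comment> \<open>For \<open>i\<close> outside \<open>I\<close> the slice ignores the entries
        of \<open>a\<close>, \<open>y\<close> and \<open>y'\<close> at \<open>i\<close>, so they can
        be overwritten to match the induction hypothesis, which is general in them.\<close>
      have "slc I a y y' h = slc I ?a ?y ?y' h"
      proof
        fix x
        have "(\<Prod>j\<in>I. Gd (?a j) 0 (x $ j - ?y j)) = (\<Prod>j\<in>I. Gd (a j) 0 (x $ j - y j))"
          using I by (intro prod.cong) auto
        moreover have "(\<chi> j. if j \<in> I then ?y' j else x $ j) = (\<chi> j. if j \<in> I then y' j else x $ j)"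
          using I by (auto simp: vec_eq_iff)
        ultimately show "slc I a y y' h x = slc I ?a ?y ?y' h x" by (simp add: slc_def)
      qed
      then have "(\<lambda>x. cs (Gd a0 0 (x $ i - y0)) (slc I a y y' h (vupd x i y0'))) = slc (UNIV - J) ?a ?y ?y' h"
        unfolding I(3) slc_insert[OF I(1,2)] by simp
      then show "\<Theta> (\<lambda>x. cs (Gd a0 0 (x $ i - y0)) (slc I a y y' h (vupd x i y0'))) = 0"
        by (simp only:) (rule insert.IH, use insert.prems a0 in simp)
    qed
  qed
  from this[of UNIV "\<lambda>_. 1" "\<lambda>_. 0" "\<lambda>_. 0"] show ?thesis by (simp add: slc_def)
qed

text \<open>Differentiating an identity valid for all real \<open>y\<close> with respect to
  \<open>y i\<close> brings down a power of \<open>x $ i\<close>; the induction is on the total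
  degree of the monomial.\<close>

lemma gau_zero_moments:
  fixes \<Theta> :: "(real^'n::finite \<Rightarrow> 'b) \<Rightarrow> complex"
  assumes \<Theta>: "sdist \<Theta>" and v: "v \<in> X" and a: "\<And>i. Re (a i) > 0"
    and z: "\<And>y. \<Theta> (gau (\<lambda>_. 0) a (\<lambda>i. of_real (y i)) v) = 0"
  shows "\<Theta> (gau m a (\<lambda>i. of_real (y i)) v) = 0"
proof (induction "sum m UNIV" arbitrary: m y)
  case 0
  then have "m = (\<lambda>_. 0)" by auto
  then show ?case using z by simp
next
  case (Suc n)
  then have "sum m UNIV \<noteq> 0" by linarith
  then obtain i where "m i \<noteq> 0" by (rule sum.not_neutral_contains_not_neutral)
  define m0 where "m0 = m(i := m i - 1)"
  have m: "m = m0(i := Suc (m0 i))" using \<open>m i \<noteq> 0\<close> by (auto simp: m0_def)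
  have "sum m UNIV = Suc (sum m0 UNIV)"
    unfolding m by (subst (1 2) sum.remove[of _ i]) auto
  then have n: "n = sum m0 UNIV" using Suc by simp
  let ?z = "\<lambda>i. complex_of_real (y i)"
  let ?f = "\<lambda>s. \<Theta> (gau m0 a (?z(i := s)) v)"
  have "(?f has_field_derivative \<Theta> (gau m a (?z(i := ?z i)) v)) (at (?z i))"
    using gau_z_derivative[OF \<Theta> v a, where m = m0 and z = ?z and i = i and s = "?z i"] unfolding m[symmetric] .
  from has_vector_derivative_real_field[OF this]
  have "(?f \<circ> of_real has_vector_derivative \<Theta> (gau m a (?z(i := ?z i)) v)) (at (y i))" by (simp add: o_def)
  moreover have "(?f \<circ> of_real) = (\<lambda>r. 0)"
  proof
    fix r
    have "?z(i := complex_of_real r) = (\<lambda>j. of_real ((y(i := r)) j))" by auto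
    then show "(?f \<circ> of_real) r = 0" using Suc.hyps(1)[OF n, of "y(i := r)"] by simp
  qed
  ultimately have "((\<lambda>r::real. 0) has_vector_derivative \<Theta> (gau m a (?z(i := ?z i)) v)) (at (y i))" by simp
  then have "\<Theta> (gau m a (?z(i := ?z i)) v) = 0"
    using vector_derivative_unique_at[OF _ has_vector_derivative_const] by blast
  moreover have "?z(i := ?z i) = ?z" by auto
  ultimately show ?case by (simp only:)
qed

text \<open>As a function of one width parameter the pairing is holomorphic in the right half-plane,
  and its derivatives are, up to sign, pairings with \<open>m i\<close> raised by even numbers. All
  of them vanish at \<open>a i\<close>, so the identity theorem applies.\<close>

lemma gau_zero_a:
  fixes \<Theta> :: "(real^'n::finite \<Rightarrow> 'b) \<Rightarrow> complex"
  assumes \<Theta>: "sdist \<Theta>" and v: "v \<in> X" and a: "\<And>i. Re (a i) > 0" and s: "Re s > 0"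
    and z: "\<And>m. \<Theta> (gau m a z v) = 0"
  shows "\<Theta> (gau m (a(i := s)) z v) = 0"
proof -
  define H where "H m s = \<Theta> (gau m (a(i := s)) z v)" for m s
  define S where "S = {s. Re s > 0}"
  have S: "open S" "connected S" unfolding S_def
    by (auto intro: open_halfspace_Re_gt convex_connected convex_halfspace_Re_gt)
  have d: "(H m has_field_derivative - H (m(i := Suc (Suc (m i)))) s) (at s)" if "s \<in> S" for m s
    unfolding H_def using that by (intro gau_a_derivative[OF \<Theta> v a]) (simp add: S_def)
  have hd: "(deriv ^^ k) (H m) s = (-1) ^ k * H (m(i := m i + 2 * k)) s" if "s \<in> S" for k m s
    using that
  proof (induction k arbitrary: s)
    case (Suc k)
    let ?m = "m(i := m i + 2 * k)"
    have "((\<lambda>s. (-1) ^ k * H ?m s) has_field_derivative (-1) ^ k * - H (?m(i := Suc (Suc (?m i)))) s) (at s)"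
      by (intro DERIV_cmult d Suc.prems)
    then have "((deriv ^^ k) (H m) has_field_derivative (-1) ^ k * - H (?m(i := Suc (Suc (?m i)))) s) (at s)"
      by (rule has_field_derivative_transform_within_open[OF _ S(1) Suc.prems]) (rule Suc.IH[symmetric])
    moreover have "?m(i := Suc (Suc (?m i))) = m(i := m i + 2 * Suc k)" by auto
    ultimately have "deriv ((deriv ^^ k) (H m)) s = (-1) ^ k * - H (m(i := m i + 2 * Suc k)) s"
      by (metis DERIV_imp_deriv)
    then show ?case by (simp only: funpow.simps o_apply power_Suc mult_minus_left mult_minus_right mult_1)
  qed simp
  have "H m s = 0"
  proof (rule holomorphic_fun_eq_0_on_connected[where f = "H m" and z = "a i" and w = s, OF _ S])
    show "H m holomorphic_on S"
      unfolding holomorphic_on_open[OF S(1)] using d by blast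
    show "a i \<in> S" "s \<in> S" using a s by (auto simp: S_def)
    then show "(deriv ^^ n) (H m) (a i) = 0" for n
      using hd[of "a i" n m] z by (simp add: H_def)
  qed
  then show ?thesis by (simp add: H_def)
qed

lemma gau_zero:
  fixes \<Theta> :: "(real^'n::finite \<Rightarrow> 'b) \<Rightarrow> complex"
  assumes \<Theta>: "sdist \<Theta>" and v: "v \<in> X" and \<alpha>: "\<alpha> > 0" and a: "\<And>i. a i > 0"
    and z: "\<And>y. \<Theta> (gau0 \<alpha> (\<lambda>i. of_real (y i)) v) = 0"
  shows "\<Theta> (gau m (\<lambda>i. of_real (a i)) (\<lambda>i. of_real (y i)) v) = 0"
proof -
  have "\<Theta> (gau m (\<lambda>i. if i \<in> I then of_real (a i) else of_real \<alpha>) (\<lambda>i. of_real (y i)) v) = 0" if "finite I" for I m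
    using that
  proof (induction I arbitrary: m rule: finite_induct)
    case empty
    show ?case using gau_zero_moments[OF \<Theta> v _ z] \<alpha> by simp
  next
    case (insert i I)
    have "\<Theta> (gau m ((\<lambda>i. if i \<in> I then of_real (a i) else of_real \<alpha>)(i := of_real (a i))) (\<lambda>i. of_real (y i)) v) = 0"
      by (rule gau_zero_a[OF \<Theta> v _ _ insert.IH]) (use a \<alpha> in auto)
    moreover have "(\<lambda>i. if i \<in> I then complex_of_real (a i) else of_real \<alpha>)(i := of_real (a i)) = (\<lambda>j. if j \<in> insert i I then of_real (a j) else of_real \<alpha>)"
      by auto
    ultimately show ?case by simp
  qed
  from this[of UNIV] show ?thesis by simp
qed

text \<open>A shifted Gaussian \<open>exp (- a * (s - y)\<^sup>2)\<close> is a constant multiple of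
  a centred one with linear term \<open>2 * a * y\<close>, so the translates demanded by density are
  among the Gaussians already annihilated.\<close>

lemma sdist_zeroI:
  fixes \<Theta> :: "(real^'n::finite \<Rightarrow> 'b) \<Rightarrow> complex"
  assumes \<Theta>: "sdist \<Theta>" and \<alpha>: "\<alpha> > 0" and h: "schwartzX Xs nrm h"
    and z: "\<And>y v. v \<in> X \<Longrightarrow> \<Theta> (gau0 \<alpha> (\<lambda>i. of_real (y i)) v) = 0"
  shows "\<Theta> h = 0"
proof (rule density[OF \<Theta> h])
  fix a y :: "'n \<Rightarrow> real" and v assume a: "\<And>i. a i > 0" and v: "v \<in> X"
  let ?g = "gau (\<lambda>_. 0) (\<lambda>i. of_real (a i)) (\<lambda>i. of_real (2 * a i * y i)) v"
  define c where "c = (\<Prod>i\<in>UNIV. complex_of_real (sqrt (a i / pi) * exp (- a i * (y i)\<^sup>2)))"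
  have "Gd (a i) 0 (s - y i) = of_real (sqrt (a i / pi) * exp (- a i * (y i)\<^sup>2)) * eta 0 0 (of_real (a i)) (of_real (2 * a i * y i)) s" for i s
  proof -
    have "exp (- a i * (s - y i)\<^sup>2) = exp (- a i * (y i)\<^sup>2) * exp (2 * a i * y i * s - a i * s\<^sup>2)"
      by (simp add: exp_add[symmetric] power2_eq_square algebra_simps)
    moreover have "eta 0 0 (of_real (a i)) (of_real (2 * a i * y i)) s = of_real (exp (2 * a i * y i * s - a i * s\<^sup>2))"
      by (simp add: exp_of_real[symmetric])
    ultimately show ?thesis by (simp add: Gd_0 gd_def)
  qed
  then have "tens (\<lambda>i k s. Gd (a i) k (s - y i)) v = (\<lambda>x. cs c (?g x))"
    unfolding gau_def tens_def c_def by (simp add: prod.distrib cs_mult[symmetric])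
  moreover have "schwartzX Xs nrm ?g" using a by (intro schwartz_gau v) simp
  ultimately show "\<Theta> (tens (\<lambda>i k s. Gd (a i) k (s - y i)) v) = 0"
    using sdist_cs[OF \<Theta>, of ?g c] gau_zero[OF \<Theta> v \<alpha> a z[OF v], where m = "\<lambda>_. 0" and y = "\<lambda>i. 2 * a i * y i"] by simp
qed

end

section \<open>Gaussian moments and interpolation\<close>

text \<open>The real part of \<open>w\<close> is removed by a real translation, and its imaginary
  part is handled by the characteristic function of the standard normal distribution.\<close>

lemma gauss_fourier:
  fixes w :: complex
  assumes b: "b > 0"
  shows "(\<integral>x. eta 0 0 (of_real b) w x \<partial>lborel) = of_real (sqrt (pi / b)) * exp (w\<^sup>2 / (4 * of_real b))"
proof -
  define p q where "p = Re w" and "q = Im w"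
  have wpq: "w = of_real p + \<i> * of_real q" by (simp add: p_def q_def complex_eq)
  define c where "c = 1 / sqrt (2 * b)"
  have c: "c > 0" "2 * b * c\<^sup>2 = 1" using b by (simp_all add: c_def power_divide)
  define u where "u = p / (2 * b)"
  define e where "e = exp (of_real (p\<^sup>2 / (4 * b)) + \<i> * of_real (q * u))"
  have eq: "eta 0 0 (of_real b) w (u + c * s) = e * of_real (sqrt (2 * pi)) * (std_normal_density s *\<^sub>R iexp (q * c * s))" for s
  proof -
    have "p * (u + c * s) - b * (u + c * s)\<^sup>2 = p\<^sup>2 / (4 * b) - s\<^sup>2 / 2"
    proof -
      have "p * (u + c * s) - b * (u + c * s)\<^sup>2 = (p * u - b * u\<^sup>2) + (p - 2 * b * u) * (c * s) - (2 * b * c\<^sup>2) * s\<^sup>2 / 2"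
        by (simp add: power2_eq_square algebra_simps)
      also have "p - 2 * b * u = 0" using b by (simp add: u_def)
      also have "p * u - b * u\<^sup>2 = p\<^sup>2 / (4 * b)" using b by (simp add: u_def power2_eq_square field_simps)
      finally show ?thesis using c by simp
    qed
    then have "w * of_real (u + c * s) - of_real b * (of_real (u + c * s))\<^sup>2 =
       (of_real (p\<^sup>2 / (4 * b)) + \<i> * of_real (q * u)) + (of_real (- (s\<^sup>2 / 2)) + \<i> * of_real (q * c * s))"
      unfolding wpq by (auto simp: complex_eq_iff power2_eq_square algebra_simps)
    then have "eta 0 0 (of_real b) w (u + c * s) = e * (exp (of_real (- (s\<^sup>2 / 2))) * iexp (q * c * s))"
      by (simp only: eta.simps power_0 mult_1 exp_add e_def)
    also have "exp (of_real (- (s\<^sup>2 / 2))) = (of_real (sqrt (2 * pi) * std_normal_density s) :: complex)"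
      unfolding exp_of_real by (simp add: std_normal_density_def)
    finally show ?thesis by (simp add: scaleR_conv_of_real)
  qed
  have "(\<integral>s. std_normal_density s *\<^sub>R iexp (q * c * s) \<partial>lborel) = char std_normal_distribution (q * c)"
    unfolding char_def by (subst integral_density) auto
  also have "\<dots> = of_real (exp (- (q * c)\<^sup>2 / 2))" by (simp add: char_std_normal_distribution)
  finally have ch: "(\<integral>s. std_normal_density s *\<^sub>R iexp (q * c * s) \<partial>lborel) = exp (of_real (- (q * c)\<^sup>2 / 2))"
    by (simp only: exp_of_real)
  have "(\<integral>x. eta 0 0 (of_real b) w x \<partial>lborel) = c *\<^sub>R (\<integral>s. eta 0 0 (of_real b) w (u + c * s) \<partial>lborel)"
    using lborel_integral_real_affine[of c "eta 0 0 (of_real b) w" u] c by simp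
  also have "\<dots> = c *\<^sub>R (e * of_real (sqrt (2 * pi)) * exp (of_real (- (q * c)\<^sup>2 / 2)))"
    unfolding eq by (simp only: integral_mult_right_zero ch)
  also have "\<dots> = of_real (c * sqrt (2 * pi)) * (e * exp (of_real (- (q * c)\<^sup>2 / 2)))"
    by (simp add: scaleR_conv_of_real)
  also have "c * sqrt (2 * pi) = sqrt (pi / b)" using b by (simp add: c_def real_sqrt_mult real_sqrt_divide)
  also have "e * exp (of_real (- (q * c)\<^sup>2 / 2)) = exp (w\<^sup>2 / (4 * of_real b))"
  proof -
    have "c\<^sup>2 = 1 / (2 * b)" using c b by (simp add: field_simps)
    then have "of_real (p\<^sup>2 / (4 * b)) + \<i> * of_real (q * u) + of_real (- (q * c)\<^sup>2 / 2) = w\<^sup>2 / (4 * of_real b)"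
      using b unfolding wpq u_def
      by (simp add: power_mult_distrib complex_eq_iff power2_eq_square field_simps)
    then show ?thesis unfolding e_def exp_add[symmetric] by simp
  qed
  finally show ?thesis .
qed

lemma rapid1_integrable:
  assumes "rapid1 \<phi>"
  shows "integrable lborel (\<phi> k)"
proof -
  obtain C where C: "\<And>s. (1 + \<bar>s\<bar>) ^ 2 * norm (\<phi> k s) \<le> C" using assms unfolding rapid1_def by blast
  have le: "norm (\<phi> k s) \<le> C * inverse ((1 + \<bar>s\<bar>)\<^sup>2)" for s
    using C[of s] by (simp add: divide_inverse[symmetric] pos_le_divide_eq add_pos_nonneg mult.commute)
  have "continuous_on UNIV (\<phi> k)"
    using assms unfolding rapid1_def
    by (intro continuous_at_imp_continuous_on ballI has_vector_derivative_continuous) blast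
  then have "\<phi> k \<in> borel_measurable borel" by (rule borel_measurable_continuous_onI)
  then show ?thesis
    by (intro Bochner_Integration.integrable_bound[OF integrable_mult_right[OF integrable_inverse_one_plus_abs_sq, of C]])
       (auto intro: order_trans[OF le abs_ge_self])
qed

lemma integrable_eta: "Re a > 0 \<Longrightarrow> integrable lborel (eta 0 m a z)"
  using rapid1_integrable[OF rapid1_eta] .

text \<open>The factor in front cancels the growth of the Gaussian integral, so that what remains is
  a polynomial of degree \<open>j\<close> in \<open>s\<close>.\<close>

definition gmom :: "real \<Rightarrow> nat \<Rightarrow> real \<Rightarrow> complex" where
  "gmom r j s = exp (- of_real (s\<^sup>2 / (4 * r))) * (\<integral>x. eta 0 j (of_real r) (of_real s) x \<partial>lborel)"

text \<open>Translation to the peak \<open>s / (2 * r)\<close> of the Gaussian, followed by the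
  binomial theorem.\<close>

lemma gmom_poly:
  assumes r: "r > 0"
  shows "gmom r j s = (\<Sum>l\<le>j. of_nat (j choose l) * (\<integral>x. eta 0 l (of_real r) 0 x \<partial>lborel) * of_real (s / (2 * r)) ^ (j - l))"
proof -
  have i: "integrable lborel (eta 0 l (of_real r) 0)" for l using r by (intro integrable_eta) simp
  have "(\<integral>x. eta 0 j (of_real r) (of_real s) x \<partial>lborel) = (\<integral>x. eta 0 j (of_real r) (of_real s) (s / (2 * r) + 1 * x) \<partial>lborel)"
    using lborel_integral_real_affine[of 1 "eta 0 j (of_real r) (of_real s)" "s / (2 * r)"] by simp
  also have "\<dots> = (\<integral>x. (\<Sum>l\<le>j. exp (of_real (s\<^sup>2 / (4 * r))) * (of_nat (j choose l) * of_real (s / (2 * r)) ^ (j - l)) * eta 0 l (of_real r) 0 x) \<partial>lborel)"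
  proof (rule Bochner_Integration.integral_cong[OF refl])
    fix x :: real
    have "s * (s / (2 * r) + x) - r * (s / (2 * r) + x)\<^sup>2 = s\<^sup>2 / (4 * r) - r * x\<^sup>2"
      using r by (simp add: power2_eq_square field_simps)
    then have "complex_of_real (s * (s / (2 * r) + x) - r * (s / (2 * r) + x)\<^sup>2) = of_real (s\<^sup>2 / (4 * r) - r * x\<^sup>2)"
      by (rule arg_cong)
    then have "of_real s * of_real (s / (2 * r) + x) - of_real r * (of_real (s / (2 * r) + x))\<^sup>2 = complex_of_real (s\<^sup>2 / (4 * r)) - of_real r * (of_real x)\<^sup>2"
      by (simp only: of_real_diff of_real_mult of_real_power)
    then have "eta 0 j (of_real r) (of_real s) (s / (2 * r) + 1 * x)
      = (of_real x + of_real (s / (2 * r))) ^ j * (exp (of_real (s\<^sup>2 / (4 * r))) * exp (- (of_real r * (of_real x)\<^sup>2)))"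
      by (simp add: exp_add[symmetric] add.commute[of "of_real x"])
    also have "\<dots> = (\<Sum>l\<le>j. exp (of_real (s\<^sup>2 / (4 * r))) * (of_nat (j choose l) * of_real (s / (2 * r)) ^ (j - l)) * eta 0 l (of_real r) 0 x)"
      unfolding binomial_ring sum_distrib_right by (intro sum.cong) (auto simp: mult_ac)
    finally show "eta 0 j (of_real r) (of_real s) (s / (2 * r) + 1 * x) = \<dots>" .
  qed
  also have "\<dots> = (\<Sum>l\<le>j. exp (of_real (s\<^sup>2 / (4 * r))) * (of_nat (j choose l) * of_real (s / (2 * r)) ^ (j - l)) * (\<integral>x. eta 0 l (of_real r) 0 x \<partial>lborel))"
    by (subst Bochner_Integration.integral_sum) (auto intro!: integrable_mult_right i simp del: eta.simps)
  also have "\<dots> = exp (of_real (s\<^sup>2 / (4 * r))) * (\<Sum>l\<le>j. of_nat (j choose l) * (\<integral>x. eta 0 l (of_real r) 0 x \<partial>lborel) * of_real (s / (2 * r)) ^ (j - l))"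
    by (simp add: sum_distrib_left mult_ac del: eta.simps)
  finally show ?thesis unfolding gmom_def by (simp add: exp_minus del: eta.simps)
qed

section \<open>Polynomials as combinations of Gaussian moments\<close>

definition gspan :: "real \<Rightarrow> nat \<Rightarrow> (real \<Rightarrow> complex) \<Rightarrow> bool" where
  "gspan r P f \<longleftrightarrow> (\<exists>\<mu>. \<forall>s. f s = (\<Sum>j\<le>P. \<mu> j * gmom r j s))"

lemma gspan_gmom: "j \<le> P \<Longrightarrow> gspan r P (gmom r j)"
proof -
  assume "j \<le> P"
  have "(\<Sum>l\<le>P. (if l = j then 1 else 0) * gmom r l s) = (\<Sum>l\<le>P. if l = j then gmom r l s else 0)" for s
    by (intro sum.cong) auto
  with \<open>j \<le> P\<close> show ?thesis
    unfolding gspan_def by (intro exI[of _ "\<lambda>l. if l = j then 1 else 0"]) simp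
qed

lemma gspan_add:
  assumes "gspan r P f" "gspan r P g"
  shows "gspan r P (\<lambda>s. f s + g s)"
proof -
  obtain \<mu> \<nu> where "\<And>s. f s = (\<Sum>j\<le>P. \<mu> j * gmom r j s)" "\<And>s. g s = (\<Sum>j\<le>P. \<nu> j * gmom r j s)"
    using assms unfolding gspan_def by blast
  then show ?thesis unfolding gspan_def
    by (intro exI[of _ "\<lambda>j. \<mu> j + \<nu> j"]) (simp add: distrib_right sum.distrib)
qed

lemma gspan_cmult:
  assumes "gspan r P f"
  shows "gspan r P (\<lambda>s. c * f s)"
proof -
  obtain \<mu> where "\<And>s. f s = (\<Sum>j\<le>P. \<mu> j * gmom r j s)"
    using assms unfolding gspan_def by blast
  then show ?thesis unfolding gspan_def
    by (intro exI[of _ "\<lambda>j. c * \<mu> j"]) (simp add: sum_distrib_left mult.assoc)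
qed

lemma gspan_sum:
  assumes "\<And>k. k \<in> S \<Longrightarrow> gspan r P (f k)"
  shows "gspan r P (\<lambda>s. \<Sum>k\<in>S. f k s)"
  using assms
proof (induction S rule: infinite_finite_induct)
  case (insert a S)
  then show ?case using gspan_add[of r P "f a" "\<lambda>s. \<Sum>k\<in>S. f k s"] by simp
qed (auto simp: gspan_def intro!: exI[of _ "\<lambda>_. 0"])

text \<open>The Gaussian moments form a triangular system with nonzero diagonal.\<close>

lemma gspan_power:
  assumes r: "r > 0"
  shows "j \<le> P \<Longrightarrow> gspan r P (\<lambda>s. of_real s ^ j)"
proof (induction j rule: less_induct)
  case (less j)
  define m0 where "m0 = (\<integral>x. eta 0 0 (of_real r) 0 x \<partial>lborel)"
  have m0: "m0 \<noteq> 0" unfolding m0_def gauss_fourier[OF r] using r by simp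
  define c where "c l = of_nat (j choose l) * (\<integral>x. eta 0 l (of_real r) 0 x \<partial>lborel) / (2 * of_real r) ^ (j - l)" for l
  have c0: "c 0 \<noteq> 0" using m0 r unfolding c_def m0_def[symmetric] by simp
  have "gmom r j s = (\<Sum>l\<le>j. c l * of_real s ^ (j - l))" for s
    unfolding gmom_poly[OF r] c_def by (simp add: power_divide)
  also have "(\<Sum>l\<le>j. c l * of_real s ^ (j - l)) = c 0 * of_real s ^ j + (\<Sum>l\<in>{1..j}. c l * of_real s ^ (j - l))" for s :: real
  proof -
    have "{..j} = insert 0 {1..j}" by auto
    then show ?thesis by simp
  qed
  finally have eq: "of_real s ^ j = (1 / c 0) * (gmom r j s + (-1) * (\<Sum>l\<in>{1..j}. c l * of_real s ^ (j - l)))" for s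
    using c0 by (simp add: field_simps)
  have "gspan r P (\<lambda>s. (1 / c 0) * (gmom r j s + (-1) * (\<Sum>l\<in>{1..j}. c l * of_real s ^ (j - l))))"
    by (intro gspan_cmult gspan_add gspan_sum gspan_gmom less.prems less.IH) (use less.prems in auto)
  then show ?case by (simp only: eq)
qed

section \<open>Lagrange interpolation at the nodes 0, ..., P\<close>

definition lag :: "nat \<Rightarrow> nat \<Rightarrow> complex poly" where
  "lag P k = smult (inverse (\<Prod>j\<in>{..P} - {k}. of_nat k - of_nat j)) (\<Prod>j\<in>{..P} - {k}. [:- of_nat j, 1:])"

lemma poly_lag:
  assumes "k \<le> P" "l \<le> P"
  shows "poly (lag P k) (of_nat l) = (if l = k then 1 else 0)"
proof (cases "l = k")
  case True
  have "(\<Prod>j\<in>{..P} - {k}. of_nat k - of_nat j) \<noteq> (0 :: complex)" by simp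
  then show ?thesis using True by (simp add: lag_def poly_prod)
next
  case False
  have "(\<Prod>j\<in>{..P} - {k}. of_nat l - of_nat j) = (0 :: complex)"
    using False assms by (intro prod_zero) auto
  then show ?thesis using False by (simp add: lag_def poly_prod)
qed

lemma degree_lag:
  assumes "k \<le> P"
  shows "degree (lag P k) \<le> P"
proof -
  have "degree (\<Prod>j\<in>{..P} - {k}. [:- of_nat j, 1 :: complex:]) \<le> (\<Sum>j\<in>{..P} - {k}. (degree \<circ> (\<lambda>j. [:- of_nat j, 1 :: complex:])) j)"
    by (rule degree_prod_sum_le) simp
  also have "\<dots> = P" using assms by simp
  finally show ?thesis unfolding lag_def by (intro order_trans[OF degree_smult_le])
qed

lemma lagrange_1d:
  fixes c :: "nat \<Rightarrow> complex"
  shows "(\<Sum>l\<le>P. c l * z ^ l) = (\<Sum>k\<le>P. (\<Sum>l\<le>P. c l * of_nat k ^ l) * poly (lag P k) z)"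
proof -
  define p where "p = (\<Sum>l\<le>P. monom (c l) l)"
  have p: "poly p z = (\<Sum>l\<le>P. c l * z ^ l)" for z by (simp add: p_def poly_sum poly_monom)
  define q where "q = (\<Sum>k\<le>P. smult (poly p (of_nat k)) (lag P k))"
  have "p = q"
  proof (rule poly_eqI_degree[of "of_nat ` {..P}"])
    have card: "card ((of_nat :: nat \<Rightarrow> complex) ` {..P}) = P + 1"
      by (subst card_image) (auto simp: inj_on_def)
    have "degree p \<le> P" unfolding p_def
      by (intro degree_sum_le) (auto intro: order_trans[OF degree_monom_le])
    then show "degree p < card ((of_nat :: nat \<Rightarrow> complex) ` {..P})" by (simp add: card)
    have "degree q \<le> P" unfolding q_def
      by (intro degree_sum_le) (auto intro!: order_trans[OF degree_smult_le] degree_lag)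
    then show "degree q < card ((of_nat :: nat \<Rightarrow> complex) ` {..P})" by (simp add: card)
    fix x :: complex assume "x \<in> of_nat ` {..P}"
    then obtain l where l: "x = of_nat l" "l \<le> P" by auto
    have "poly q x = (\<Sum>k\<le>P. poly p (of_nat k) * (if l = k then 1 else 0))"
      unfolding q_def l(1) poly_sum poly_smult using l(2) by (intro sum.cong refl) (simp add: poly_lag)
    also have "\<dots> = poly p x" using l by (simp add: if_distrib cong: if_cong)
    finally show "poly p x = poly q x" by simp
  qed
  then have "poly p z = poly q z" by simp
  then show ?thesis unfolding p by (simp add: q_def p poly_sum)
qed

text \<open>Polynomiality is assumed only separately, with coefficients depending arbitrarily on the
  other variables; interpolating one coordinate at a time still reaches the full grid of integer
  nodes.\<close>

lemma lagrange_multi: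
  fixes G :: "('n::finite \<Rightarrow> real) \<Rightarrow> complex"
  assumes G: "\<And>i y. \<exists>c. \<forall>s. G (y(i := s)) = (\<Sum>l\<le>P. c l * of_real s ^ l)"
  shows "G y = (\<Sum>k\<in>Pi\<^sub>E UNIV (\<lambda>_. {..P}). G (\<lambda>i. real (k i)) * (\<Prod>i\<in>UNIV. poly (lag P (k i)) (of_real (y i))))"
proof -
  have "G y = (\<Sum>k\<in>Pi\<^sub>E I (\<lambda>_. {..P}). G (\<lambda>i. if i \<in> I then real (k i) else y i) * (\<Prod>i\<in>I. poly (lag P (k i)) (of_real (y i))))"
    if "finite I" for I
    using that
  proof (induction I rule: finite_induct)
    case (insert i I)
    let ?y = "\<lambda>k. (\<lambda>j. if j \<in> I then real (k j) else y j)"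
    let ?y' = "\<lambda>k. (\<lambda>j. if j \<in> insert i I then real (k j) else y j)"
    have 1: "G (?y k) = (\<Sum>l\<le>P. G ((?y k)(i := real l)) * poly (lag P l) (of_real (y i)))" for k
    proof -
      obtain c where c: "\<And>s. G ((?y k)(i := s)) = (\<Sum>l\<le>P. c l * of_real s ^ l)" using G by blast
      have "G (?y k) = G ((?y k)(i := y i))" using insert(2) by (intro arg_cong[where f = G]) auto
      also have "\<dots> = (\<Sum>l\<le>P. (\<Sum>m\<le>P. c m * of_nat l ^ m) * poly (lag P l) (of_real (y i)))"
        unfolding c by (rule lagrange_1d)
      finally show ?thesis by (simp add: c)
    qed
    have "G y = (\<Sum>k\<in>Pi\<^sub>E I (\<lambda>_. {..P}). \<Sum>l\<le>P. G ((?y k)(i := real l)) * (poly (lag P l) (of_real (y i)) * (\<Prod>i\<in>I. poly (lag P (k i)) (of_real (y i)))))"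
      unfolding insert.IH by (subst 1) (simp add: sum_distrib_right mult.assoc)
    also have "\<dots> = (\<Sum>(l, k)\<in>{..P} \<times> Pi\<^sub>E I (\<lambda>_. {..P}). G ((?y k)(i := real l)) * (poly (lag P l) (of_real (y i)) * (\<Prod>i\<in>I. poly (lag P (k i)) (of_real (y i)))))"
      by (subst sum.swap, subst sum.cartesian_product) simp
    also have "\<dots> = (\<Sum>k\<in>Pi\<^sub>E (insert i I) (\<lambda>_. {..P}). G (?y' k) * (\<Prod>i\<in>insert i I. poly (lag P (k i)) (of_real (y i))))"
    proof -
      have inj: "inj_on (\<lambda>(l, k). k(i := l)) ({..P} \<times> Pi\<^sub>E I (\<lambda>_. {..P}))"
        using inj_combinator[OF insert(2), of "\<lambda>_. {..P}"] by simp
      show ?thesis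
        unfolding PiE_insert_eq sum.reindex[OF inj]
      proof (rule sum.cong[OF refl])
        fix u assume "u \<in> {..P} \<times> Pi\<^sub>E I (\<lambda>_. {..P})"
        obtain l k where u: "u = (l, k)" by fastforce
        have "(?y k)(i := real l) = ?y' (k(i := l))" using insert(2) by auto
        moreover have "(\<Prod>j\<in>I. poly (lag P ((k(i := l)) j)) (of_real (y j))) = (\<Prod>j\<in>I. poly (lag P (k j)) (of_real (y j)))"
          using insert(2) by (intro prod.cong) auto
        ultimately show "(case u of (l, k) \<Rightarrow> G ((?y k)(i := real l)) * (poly (lag P l) (of_real (y i)) * (\<Prod>i\<in>I. poly (lag P (k i)) (of_real (y i)))))
          = ((\<lambda>k. G (?y' k) * (\<Prod>i\<in>insert i I. poly (lag P (k i)) (of_real (y i)))) \<circ> (\<lambda>(l, k). k(i := l))) u"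
          unfolding u o_apply case_prod_conv using insert(1,2) by simp
      qed
    qed
    finally show ?case .
  qed simp
  from this[of UNIV] show ?thesis by simp
qed

text \<open>Rewriting the Lagrange basis in moments fixes the scalars once and for all, so the same
  \<open>\<mu>\<close> serves every vector \<open>v\<close> and the coefficients become linear in
  \<open>v\<close>.\<close>

lemma lag_gmom:
  assumes r: "r > 0"
  shows "\<exists>\<mu>. \<forall>k\<le>P. \<forall>s. poly (lag P k) (of_real s) = (\<Sum>j\<le>P. \<mu> k j * gmom r j s)"
proof -
  have "\<exists>\<mu>. \<forall>s. poly (lag P k) (of_real s) = (\<Sum>j\<le>P. \<mu> j * gmom r j s)" if "k \<le> P" for k
  proof -
    have "gspan r P (\<lambda>s. \<Sum>l\<le>degree (lag P k). coeff (lag P k) l * of_real s ^ l)"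
      using degree_lag[OF that] by (intro gspan_sum gspan_cmult gspan_power[OF r]) auto
    then show ?thesis by (simp add: gspan_def poly_altdef)
  qed
  then have "\<forall>k. \<exists>\<mu>. k \<le> P \<longrightarrow> (\<forall>s. poly (lag P k) (of_real s) = (\<Sum>j\<le>P. \<mu> j * gmom r j s))" by blast
  from choice[OF this] show ?thesis by blast
qed

section \<open>The theorem\<close>

lemma exp_norm_prod: "exp (- (\<beta> * (norm x)\<^sup>2)) = (\<Prod>i\<in>UNIV. exp (- (\<beta> * (x $ i)\<^sup>2)))" for x :: "real^'n::finite"
proof -
  have "(norm x)\<^sup>2 = (\<Sum>i\<in>UNIV. (x $ i)\<^sup>2)"
    unfolding power2_norm_eq_inner inner_vec_def by (simp add: power2_eq_square)
  then show ?thesis by (simp add: exp_sum[symmetric] sum_distrib_left sum_negf)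
qed

context frechet
begin

section \<open>The analytic kernel: growth, Fourier duality and polynomiality\<close>

lemma gau_eq: "gau m a z v = (\<lambda>x. cs (\<Prod>i\<in>UNIV. eta 0 (m i) (a i) (z i) (x $ i)) v)"
  by (simp add: gau_def tens_def)

text \<open>Width parameters add, so the Gaussian weight of a hypothesis turns \<open>pi * t\<close>
  into \<open>2 * (pi * t)\<close>, and \<open>pi / t\<close> into
  \<open>2 * (pi / t)\<close>.\<close>

lemma gau_mult_gauss:
  fixes w :: "'n::finite \<Rightarrow> complex"
  shows "(\<lambda>x. exp (- (\<beta> * (norm x)\<^sup>2)) *\<^sub>R gau0 \<alpha> w v x) = gau0 (\<alpha> + \<beta>) w v"
proof
  fix x :: "real^'n"
  have "complex_of_real (exp (- (\<beta> * (norm x)\<^sup>2))) * (\<Prod>i\<in>UNIV. eta 0 0 (of_real \<alpha>) (w i) (x $ i)) =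
    (\<Prod>i\<in>UNIV. of_real (exp (- (\<beta> * (x $ i)\<^sup>2))) * eta 0 0 (of_real \<alpha>) (w i) (x $ i))"
    unfolding exp_norm_prod prod.distrib by simp
  also have "\<dots> = (\<Prod>i\<in>UNIV. eta 0 0 (of_real (\<alpha> + \<beta>)) (w i) (x $ i))"
    by (intro prod.cong refl) (simp add: exp_of_real[symmetric] exp_add[symmetric] algebra_simps)
  finally show "exp (- (\<beta> * (norm x)\<^sup>2)) *\<^sub>R gau0 \<alpha> w v x = gau0 (\<alpha> + \<beta>) w v x"
    unfolding gau_eq cs_of_real_mult[symmetric] by simp
qed

text \<open>The exponent \<open>P\<close> depends only on the order and weight of the bound for
  \<open>\<Theta>\<close>, and \<open>v\<close> enters only through \<open>nrm M v\<close>; this is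
  why a single degree works for all vectors.\<close>

lemma gau_growth:
  fixes \<Theta> :: "(real^'n::finite \<Rightarrow> 'b) \<Rightarrow> complex"
  assumes \<Theta>: "sdist \<Theta>" and \<alpha>: "\<alpha> > 0"
  shows "\<exists>P M K. K \<ge> 0 \<and> (\<forall>v\<in>X. \<forall>z. norm (\<Theta> (gau0 \<alpha> z v)) \<le>
     K * (\<Prod>j\<in>UNIV. (1 + norm (z j)) ^ P * exp ((Re (z j))\<^sup>2 / (4 * \<alpha>))) * nrm M v)"
proof -
  obtain N A M K where K0: "K \<ge> 0" and K1: "\<forall>v \<phi> C. v \<in> X \<longrightarrow> (\<forall>i. rapid1 (\<phi> i)) \<longrightarrow>
      (\<forall>i. \<forall>k\<le>N. \<forall>s. (1 + \<bar>s\<bar>) ^ A * norm (\<phi> i k s) \<le> C i) \<longrightarrow>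
      norm (\<Theta> (tens \<phi> v)) \<le> K * (\<Prod>i\<in>UNIV. C i) * nrm M v"
    using sdist_tens_bound[OF \<Theta>] by (elim exE conjE)
  have "\<forall>k. \<exists>C\<ge>0. \<forall>z x. (1 + \<bar>x\<bar>) ^ A * norm (eta k 0 (of_real \<alpha>) z x) \<le> C * (1 + norm z) ^ (2 * k + A) * exp ((Re z)\<^sup>2 / (4 * \<alpha>))"
    using eta_growth[OF \<alpha>] by blast
  then obtain C where C: "\<And>k. C k \<ge> 0" "\<And>k z x. (1 + \<bar>x\<bar>) ^ A * norm (eta k 0 (of_real \<alpha>) z x) \<le> C k * (1 + norm z) ^ (2 * k + A) * exp ((Re z)\<^sup>2 / (4 * \<alpha>))"
    by metis
  define Cm where "Cm = sum C {..N}"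
  have Cm: "Cm \<ge> 0" unfolding Cm_def by (intro sum_nonneg C)
  define E where "E z = (1 + norm z) ^ (2 * N + A) * exp ((Re z)\<^sup>2 / (4 * \<alpha>))" for z :: complex
  have "norm (\<Theta> (gau0 \<alpha> z v)) \<le> (K * Cm ^ CARD('n)) * (\<Prod>j\<in>UNIV. E (z j)) * nrm M v"
    if v: "v \<in> X" for z v
  proof -
    have "norm (\<Theta> (tens (\<lambda>i k. eta k 0 (of_real \<alpha>) (z i)) v)) \<le> K * (\<Prod>i\<in>UNIV. Cm * E (z i)) * nrm M v"
    proof (rule K1[rule_format, OF v])
      show "rapid1 (\<lambda>k. eta k 0 (of_real \<alpha>) (z i))" for i using \<alpha> by (intro rapid1_eta) simp
      fix i k x assume k: "k \<le> N"
      have "(1 + \<bar>x\<bar>) ^ A * norm (eta k 0 (of_real \<alpha>) (z i) x) \<le> C k * (1 + norm (z i)) ^ (2 * k + A) * exp ((Re (z i))\<^sup>2 / (4 * \<alpha>))"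
        by (rule C)
      also have "\<dots> \<le> Cm * (1 + norm (z i)) ^ (2 * N + A) * exp ((Re (z i))\<^sup>2 / (4 * \<alpha>))"
      proof (intro mult_right_mono mult_mono power_increasing)
        show "C k \<le> Cm" unfolding Cm_def using k C by (intro member_le_sum) auto
      qed (use k Cm in auto)
      finally show "(1 + \<bar>x\<bar>) ^ A * norm (eta k 0 (of_real \<alpha>) (z i) x) \<le> Cm * E (z i)" by (simp add: E_def)
    qed
    then show ?thesis by (simp add: gau_def prod.distrib mult_ac)
  qed
  moreover have "K * Cm ^ CARD('n) \<ge> 0" using K0 Cm by simp
  ultimately show ?thesis unfolding E_def
    by (intro exI[of _ "2 * N + A"] exI[of _ M] exI[of _ "K * Cm ^ CARD('n)"]) simp
qed

text \<open>For a fixed Gaussian the pairing is linear in \<open>v\<close> and bounded by a multiple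
  of \<open>nrm M v\<close>, with the same \<open>M\<close> for all nodes, so finite combinations
  stay in the dual.\<close>

lemma dualX_gau_sum:
  fixes \<Theta> :: "(real^'n::finite \<Rightarrow> 'b) \<Rightarrow> complex"
  assumes \<Theta>: "sdist \<Theta>" and \<alpha>: "\<alpha> > 0"
  shows "dualX Xs nrm J (\<lambda>v. \<Sum>k\<in>S. \<Theta> (gau0 \<alpha> (z k) v) * c k)"
proof -
  let ?g = "\<lambda>k v. gau0 \<alpha> (z k) v"
  obtain P M K where K: "K \<ge> 0" "\<And>v z. v \<in> X \<Longrightarrow> norm (\<Theta> (gau0 \<alpha> z v)) \<le>
     K * (\<Prod>j\<in>UNIV. (1 + norm (z j)) ^ P * exp ((Re (z j))\<^sup>2 / (4 * \<alpha>))) * nrm M v"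
    using gau_growth[OF \<Theta> \<alpha>] by (elim exE conjE) blast
  have s: "schwartzX Xs nrm (?g k v)" if "v \<in> X" for k v using that \<alpha> by (intro schwartz_gau) auto
  have add: "\<Theta> (?g k (v + w)) = \<Theta> (?g k v) + \<Theta> (?g k w)" if "v \<in> X" "w \<in> X" for k v w
    using sdist_add[OF \<Theta> s[OF that(1)] s[OF that(2)]] by (simp add: gau_eq cs_add_right)
  have mult: "\<Theta> (?g k (cs d v)) = d * \<Theta> (?g k v)" if "v \<in> X" for k v d
    using sdist_cs[OF \<Theta> s[OF that], of d] by (simp add: gau_eq cs_mult[symmetric] mult.commute del: eta.simps)
  define B where "B = (\<Sum>k\<in>S. K * (\<Prod>j\<in>UNIV. (1 + norm (z k j)) ^ P * exp ((Re (z k j))\<^sup>2 / (4 * \<alpha>))) * norm (c k))"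
  have "norm (\<Sum>k\<in>S. \<Theta> (?g k v) * c k) \<le> B * nrm M v" if v: "v \<in> X" for v
  proof -
    have "norm (\<Sum>k\<in>S. \<Theta> (?g k v) * c k) \<le> (\<Sum>k\<in>S. norm (\<Theta> (?g k v)) * norm (c k))"
      by (intro order_trans[OF norm_sum]) (simp add: norm_mult)
    also have "\<dots> \<le> (\<Sum>k\<in>S. (K * (\<Prod>j\<in>UNIV. (1 + norm (z k j)) ^ P * exp ((Re (z k j))\<^sup>2 / (4 * \<alpha>))) * nrm M v) * norm (c k))"
      by (intro sum_mono mult_right_mono K v) auto
    also have "\<dots> = B * nrm M v" unfolding B_def sum_distrib_right by (intro sum.cong refl) (simp only: mult_ac)
    finally show ?thesis .
  qed
  then have "\<exists>M c'. \<forall>v\<in>X. norm (\<Sum>k\<in>S. \<Theta> (?g k v) * c k) \<le> c' * nrm M v" by blast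
  then show ?thesis unfolding dualX_def
    by (intro conjI ballI allI) (simp_all add: add mult distrib_right sum.distrib sum_distrib_left mult.assoc)
qed

text \<open>The integrand is a scalar function times the fixed vector \<open>v\<close>, so the
  integral in the ambient space is a bounded linear image of a scalar integral, which factors over
  the coordinates.\<close>

lemma fourier_gau:
  fixes w :: "'n::finite \<Rightarrow> complex"
  assumes b: "b > 0"
  shows "fourierX J (gau0 b w v) =
    (\<lambda>\<xi>. cs (\<Prod>j\<in>UNIV. of_real (sqrt (pi / b)) * exp ((w j - 2 * of_real pi * \<i> * of_real (\<xi> $ j))\<^sup>2 / (4 * of_real b))) v)"
proof
  fix \<xi> :: "real^'n"
  let ?u = "\<lambda>j. w j - 2 * of_real pi * \<i> * of_real (\<xi> $ j)"
  let ?\<phi> = "\<lambda>x::real^'n. \<Prod>j\<in>UNIV. eta 0 0 (of_real b) (?u j) (x $ j)"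
  have eq: "cs (cis (- 2 * pi * (\<xi> \<bullet> x))) (gau0 b w v x) = cs (?\<phi> x) v" for x
  proof -
    have "cis (- 2 * pi * (\<xi> \<bullet> x)) = exp (\<Sum>j\<in>UNIV. - 2 * of_real pi * \<i> * of_real (\<xi> $ j) * of_real (x $ j))"
      unfolding cis_conv_exp inner_vec_def by (simp add: sum_distrib_left mult_ac)
    also have "\<dots> = (\<Prod>j\<in>UNIV. exp (- 2 * of_real pi * \<i> * of_real (\<xi> $ j) * of_real (x $ j)))"
      by (simp add: exp_sum)
    finally have "cis (- 2 * pi * (\<xi> \<bullet> x)) * (\<Prod>j\<in>UNIV. eta 0 0 (of_real b) (w j) (x $ j))
       = (\<Prod>j\<in>UNIV. exp (- 2 * of_real pi * \<i> * of_real (\<xi> $ j) * of_real (x $ j)) * eta 0 0 (of_real b) (w j) (x $ j))"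
      by (simp only: prod.distrib)
    also have "\<dots> = ?\<phi> x"
      by (intro prod.cong refl) (simp add: exp_add[symmetric] algebra_simps)
    finally show ?thesis unfolding gau_eq cs_mult[symmetric] by simp
  qed
  have i: "integrable lborel (eta 0 0 (of_real b) (?u j))" for j using b by (intro integrable_eta) simp
  have "(?\<phi> has_integral (\<integral>x. ?\<phi> x \<partial>lborel)) UNIV"
    by (intro has_integral_integral_lborel has_bochner_integral_prod_vec(1) i)
  moreover have "bounded_linear (\<lambda>c. cs c v)"
  proof (rule bounded_linear_intro[of _ "norm v"])
    show "norm (cs c v) \<le> norm c * norm v" for c
      using family by (simp add: frechet_family_def complex_banach_structure_def)
  qed (auto simp: cs_add_left cs_scaleR_left)
  ultimately have "((\<lambda>x. cs (?\<phi> x) v) has_integral cs (\<integral>x. ?\<phi> x \<partial>lborel) v) UNIV"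
    using has_integral_linear[of ?\<phi> _ UNIV "\<lambda>c. cs c v"] by (simp add: o_def)
  then have "integral UNIV (\<lambda>x. cs (?\<phi> x) v) = cs (\<integral>x. ?\<phi> x \<partial>lborel) v" by (rule integral_unique)
  also have "(\<integral>x. ?\<phi> x \<partial>lborel) = (\<Prod>j\<in>UNIV. of_real (sqrt (pi / b)) * exp ((?u j)\<^sup>2 / (4 * of_real b)))"
    by (simp only: has_bochner_integral_prod_vec(2)[OF i] gauss_fourier[OF b])
  finally show "fourierX J (gau0 b w v) \<xi> = cs (\<Prod>j\<in>UNIV. of_real (sqrt (pi / b)) * exp ((?u j)\<^sup>2 / (4 * of_real b))) v"
    unfolding fourierX_def eq .
qed

text \<open>The linear term \<open>\<i> * z j / t\<close> is chosen so that the transform has linear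
  term \<open>z j\<close>. The parameter \<open>pi / t\<close> becomes \<open>pi * t\<close>, and
  expanding the square leaves the factor
  \<open>exp (- (z j)\<^sup>2 / (4 * pi * t))\<close>.\<close>

lemma fourier_gau_dual:
  fixes z :: "'n::finite \<Rightarrow> complex"
  assumes t: "t > 0"
  shows "fourierX J (gau0 (pi / t) (\<lambda>j. \<i> * z j / of_real t) v) =
    (\<lambda>\<xi>. cs (\<Prod>j\<in>UNIV. of_real (sqrt t) * exp (- (z j)\<^sup>2 / (4 * of_real (pi * t)))) (gau0 (pi * t) z v \<xi>))"
proof
  fix \<xi> :: "real^'n"
  have b: "pi / t > 0" using t by simp
  have E: "of_real (sqrt (pi / (pi / t))) * exp ((\<i> * z j / of_real t - 2 * of_real pi * \<i> * of_real (\<xi> $ j))\<^sup>2 / (4 * of_real (pi / t)))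
     = of_real (sqrt t) * exp (- (z j)\<^sup>2 / (4 * of_real (pi * t))) * eta 0 0 (of_real (pi * t)) (z j) (\<xi> $ j)" for j
  proof -
    have Q: "(\<i> * z j / of_real t - 2 * of_real pi * \<i> * of_real (\<xi> $ j))\<^sup>2 / (4 * of_real (pi / t))
      = - (z j)\<^sup>2 / (4 * of_real (pi * t)) + (z j * of_real (\<xi> $ j) - of_real (pi * t) * (of_real (\<xi> $ j))\<^sup>2)"
    proof -
      have "\<i> * z j / of_real t - 2 * of_real pi * \<i> * of_real (\<xi> $ j) = \<i> * (z j / of_real t - 2 * of_real pi * of_real (\<xi> $ j))"
        by (simp add: algebra_simps)
      then show ?thesis using t by (simp add: power_mult_distrib power2_diff field_simps power2_eq_square)
    qed
    show ?thesis unfolding Q exp_add using t by (simp add: mult.assoc)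
  qed
  show "fourierX J (gau0 (pi / t) (\<lambda>j. \<i> * z j / of_real t) v) \<xi> =
    cs (\<Prod>j\<in>UNIV. of_real (sqrt t) * exp (- (z j)\<^sup>2 / (4 * of_real (pi * t)))) (gau0 (pi * t) z v \<xi>)"
    unfolding fourier_gau[OF b] unfolding gau_eq cs_mult[symmetric] prod.distrib[symmetric] E ..
qed

text \<open>Through \<open>\<Psi>1\<close> the exponent is
  \<open>(Re z)\<^sup>2 / (8 * pi * t)\<close>, and the correction has modulus exponent
  \<open>(Im z)\<^sup>2 - (Re z)\<^sup>2\<close> over \<open>8 * pi * t\<close>, which leaves the
  imaginary part. Through \<open>\<Psi>2\<close> the linear term has real part
  \<open>- Im z / t\<close>, so the exponent is \<open>(Im z)\<^sup>2 / (8 * pi * t)\<close>, and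
  the Fourier factor reverses the sign of the correction, which leaves the real part.\<close>

lemma hardy_kernel_bounds:
  fixes \<Phi> \<Psi>1 \<Psi>2 :: "(real^'n::finite \<Rightarrow> 'b) \<Rightarrow> complex"
  assumes t: "t > 0" and \<Phi>: "sdist \<Phi>" and \<Psi>1: "sdist \<Psi>1" and \<Psi>2: "sdist \<Psi>2"
    and h1: "\<And>g. schwartzX Xs nrm g \<Longrightarrow> \<Phi> g = \<Psi>1 (\<lambda>x. exp (- (t * pi * (norm x)\<^sup>2)) *\<^sub>R g x)"
    and h2: "\<And>g. schwartzX Xs nrm g \<Longrightarrow> \<Phi> (fourierX J g) = \<Psi>2 (\<lambda>x. exp (- (pi / t * (norm x)\<^sup>2)) *\<^sub>R g x)"
  defines "G \<equiv> \<lambda>v z. \<Phi> (gau0 (pi * t) z v) * (\<Prod>j\<in>UNIV. exp (- (z j)\<^sup>2 / (8 * of_real (pi * t))))"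
  shows "\<exists>P. \<forall>v\<in>X. \<exists>K\<ge>0. \<forall>z. norm (G v z) \<le> K * (\<Prod>j\<in>UNIV. (1 + norm (z j)) ^ P * exp (1 / (8 * pi * t) * (Im (z j))\<^sup>2))
      \<and> norm (G v z) \<le> K * (\<Prod>j\<in>UNIV. (1 + norm (z j)) ^ P * exp (1 / (8 * pi * t) * (Re (z j))\<^sup>2))"
proof -
  let ?k = "1 / (8 * pi * t)"
  have a1: "2 * (pi * t) > 0" and a2: "2 * (pi / t) > 0" using t by auto
  obtain P1 M1 K1 where K1: "K1 \<ge> 0" "\<And>v z. v \<in> X \<Longrightarrow> norm (\<Psi>1 (gau0 (2 * (pi * t)) z v)) \<le>
     K1 * (\<Prod>j\<in>UNIV. (1 + norm (z j)) ^ P1 * exp ((Re (z j))\<^sup>2 / (4 * (2 * (pi * t))))) * nrm M1 v"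
    using gau_growth[OF \<Psi>1 a1] by (elim exE conjE) blast
  obtain P2 M2 K2 where K2: "K2 \<ge> 0" "\<And>v z. v \<in> X \<Longrightarrow> norm (\<Psi>2 (gau0 (2 * (pi / t)) z v)) \<le>
     K2 * (\<Prod>j\<in>UNIV. (1 + norm (z j)) ^ P2 * exp ((Re (z j))\<^sup>2 / (4 * (2 * (pi / t))))) * nrm M2 v"
    using gau_growth[OF \<Psi>2 a2] by (elim exE conjE) blast
  define P where "P = max P1 P2"
  have Re2: "Re (w\<^sup>2) = (Re w)\<^sup>2 - (Im w)\<^sup>2" for w :: complex by (simp add: power2_eq_square)
  have nexp: "norm (exp (w\<^sup>2 / (8 * of_real (pi * t)))) = exp (?k * ((Re w)\<^sup>2 - (Im w)\<^sup>2))" for w :: complex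
  proof -
    have "w\<^sup>2 / (8 * of_real (pi * t)) = w\<^sup>2 / of_real (8 * pi * t)" by simp
    then show ?thesis unfolding norm_exp_eq_Re Re2[symmetric] by (simp only: Re_divide_of_real) simp
  qed
  have gs: "schwartzX Xs nrm (gau0 r z v)" if "r > 0" "v \<in> X" for r v and z :: "'n \<Rightarrow> complex"
    using that by (intro schwartz_gau) auto
  have im: "norm (G v z) \<le> K1 * nrm M1 v * (\<Prod>j\<in>UNIV. (1 + norm (z j)) ^ P * exp (?k * (Im (z j))\<^sup>2))" if v: "v \<in> X" for v z
  proof -
    have "pi * t > 0" using t by simp
    have "\<Phi> (gau0 (pi * t) z v) = \<Psi>1 (gau0 (pi * t + t * pi) z v)"
      unfolding h1[OF gs[OF \<open>pi * t > 0\<close> v]] by (simp only: gau_mult_gauss)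
    also have "pi * t + t * pi = 2 * (pi * t)" by simp
    finally have "norm (G v z) = norm (\<Psi>1 (gau0 (2 * (pi * t)) z v)) * (\<Prod>j\<in>UNIV. exp (- (?k * ((Re (z j))\<^sup>2 - (Im (z j))\<^sup>2))))"
      unfolding G_def norm_mult prod_norm[symmetric] exp_minus norm_inverse nexp[symmetric] minus_divide_left[symmetric]
      by simp
    also have "\<dots> \<le> (K1 * (\<Prod>j\<in>UNIV. (1 + norm (z j)) ^ P1 * exp ((Re (z j))\<^sup>2 / (4 * (2 * (pi * t))))) * nrm M1 v) * (\<Prod>j\<in>UNIV. exp (- (?k * ((Re (z j))\<^sup>2 - (Im (z j))\<^sup>2))))"
      by (intro mult_right_mono K1 v prod_nonneg) auto
    also have "\<dots> = K1 * nrm M1 v * (\<Prod>j\<in>UNIV. ((1 + norm (z j)) ^ P1 * exp ((Re (z j))\<^sup>2 / (4 * (2 * (pi * t))))) * exp (- (?k * ((Re (z j))\<^sup>2 - (Im (z j))\<^sup>2))))"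
      by (simp only: prod.distrib mult_ac)
    also have "\<dots> \<le> K1 * nrm M1 v * (\<Prod>j\<in>UNIV. (1 + norm (z j)) ^ P * exp (?k * (Im (z j))\<^sup>2))"
    proof (intro mult_left_mono prod_mono conjI)
      fix j
      have "(Re (z j))\<^sup>2 / (4 * (2 * (pi * t))) + - (?k * ((Re (z j))\<^sup>2 - (Im (z j))\<^sup>2)) = ?k * (Im (z j))\<^sup>2"
        using t by (simp add: field_simps)
      then have "((1 + norm (z j)) ^ P1 * exp ((Re (z j))\<^sup>2 / (4 * (2 * (pi * t))))) * exp (- (?k * ((Re (z j))\<^sup>2 - (Im (z j))\<^sup>2))) = (1 + norm (z j)) ^ P1 * exp (?k * (Im (z j))\<^sup>2)"
        by (simp only: mult.assoc exp_add[symmetric])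
      also have "\<dots> \<le> (1 + norm (z j)) ^ P * exp (?k * (Im (z j))\<^sup>2)"
        by (intro mult_right_mono power_increasing) (auto simp: P_def)
      finally show "((1 + norm (z j)) ^ P1 * exp ((Re (z j))\<^sup>2 / (4 * (2 * (pi * t))))) * exp (- (?k * ((Re (z j))\<^sup>2 - (Im (z j))\<^sup>2))) \<le> (1 + norm (z j)) ^ P * exp (?k * (Im (z j))\<^sup>2)" .
    qed (use K1 v in auto)
    finally show ?thesis .
  qed
  \<comment> \<open>Per coordinate, \<open>1 / sqrt t\<close> comes from the Fourier normalisation
    and \<open>(1 + 1 / t) ^ P2\<close> from replacing the argument \<open>\<i> * z j / t\<close> by
    \<open>z j\<close> in the polynomial factor.\<close>
  define c where "c = (1 + 1 / t) ^ P2 / sqrt t"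
  have c: "c \<ge> 0" using t by (simp add: c_def)
  have re: "norm (G v z) \<le> K2 * nrm M2 v * c ^ CARD('n) * (\<Prod>j\<in>UNIV. (1 + norm (z j)) ^ P * exp (?k * (Re (z j))\<^sup>2))" if v: "v \<in> X" for v z
  proof -
    define w where "w j = \<i> * z j / of_real t" for j
    have pt: "pi * t > 0" "pi / t > 0" using t by auto
    let ?q = "\<Prod>j\<in>UNIV. complex_of_real (sqrt t) * exp (- (z j)\<^sup>2 / (4 * of_real (pi * t)))"
    have "\<Phi> (fourierX J (gau0 (pi / t) w v)) = ?q * \<Phi> (gau0 (pi * t) z v)"
      unfolding w_def fourier_gau_dual[OF t] by (rule sdist_cs[OF \<Phi> gs[OF pt(1) v]])
    moreover have "\<Phi> (fourierX J (gau0 (pi / t) w v)) = \<Psi>2 (gau0 (pi / t + pi / t) w v)"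
      unfolding h2[OF gs[OF pt(2) v]] by (simp only: gau_mult_gauss)
    moreover have "pi / t + pi / t = 2 * (pi / t)" by simp
    ultimately have e: "?q * \<Phi> (gau0 (pi * t) z v) = \<Psi>2 (gau0 (2 * (pi / t)) w v)"
      by simp
    \<comment> \<open>Splitting off the Fourier factor leaves
      \<open>exp ((z j)\<^sup>2 / (8 * pi * t))\<close>: the reversed sign is what exchanges the
      roles of real and imaginary part.\<close>
    have "exp (- (z j)\<^sup>2 / (8 * of_real (pi * t))) = (complex_of_real (sqrt t) * exp (- (z j)\<^sup>2 / (4 * of_real (pi * t)))) * (of_real (1 / sqrt t) * exp ((z j)\<^sup>2 / (8 * of_real (pi * t))))" for j
    proof -
      have "- (z j)\<^sup>2 / (8 * of_real (pi * t)) = - (z j)\<^sup>2 / (4 * of_real (pi * t)) + (z j)\<^sup>2 / (8 * of_real (pi * t))"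
        using t by (simp add: field_simps)
      then have E1: "exp (- (z j)\<^sup>2 / (8 * of_real (pi * t))) = exp (- (z j)\<^sup>2 / (4 * of_real (pi * t))) * exp ((z j)\<^sup>2 / (8 * of_real (pi * t)))"
        by (simp only: exp_add[symmetric])
      have E2: "complex_of_real (sqrt t) * of_real (1 / sqrt t) = 1"
        unfolding of_real_mult[symmetric] using t by simp
      have E3: "(s * u) * (s' * u') = (s * s') * (u * u')" for s s' u u' :: complex by (simp only: mult_ac)
      show ?thesis by (simp only: E3 E2 E1 mult_1)
    qed
    then have "G v z = \<Psi>2 (gau0 (2 * (pi / t)) w v) * (\<Prod>j\<in>UNIV. of_real (1 / sqrt t) * exp ((z j)\<^sup>2 / (8 * of_real (pi * t))))"
      unfolding G_def e[symmetric] by (simp only: prod.distrib mult_ac)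
    then have "norm (G v z) = norm (\<Psi>2 (gau0 (2 * (pi / t)) w v)) * (\<Prod>j\<in>UNIV. 1 / sqrt t * exp (?k * ((Re (z j))\<^sup>2 - (Im (z j))\<^sup>2)))"
    proof -
      have n1: "norm (complex_of_real (1 / sqrt t)) = 1 / sqrt t" unfolding norm_of_real using t by simp
      have "norm (\<Prod>j\<in>UNIV. of_real (1 / sqrt t) * exp ((z j)\<^sup>2 / (8 * of_real (pi * t)))) = (\<Prod>j\<in>UNIV. 1 / sqrt t * exp (?k * ((Re (z j))\<^sup>2 - (Im (z j))\<^sup>2)))"
        by (simp only: prod_norm[symmetric] norm_mult nexp n1)
      with \<open>G v z = _\<close> show ?thesis by (simp only: norm_mult)
    qed
    also have "\<dots> \<le> (K2 * (\<Prod>j\<in>UNIV. (1 + norm (w j)) ^ P2 * exp ((Re (w j))\<^sup>2 / (4 * (2 * (pi / t))))) * nrm M2 v) * (\<Prod>j\<in>UNIV. 1 / sqrt t * exp (?k * ((Re (z j))\<^sup>2 - (Im (z j))\<^sup>2)))"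
      using t by (intro mult_right_mono K2 v prod_nonneg) auto
    also have "\<dots> = K2 * nrm M2 v * (\<Prod>j\<in>UNIV. ((1 + norm (w j)) ^ P2 * exp ((Re (w j))\<^sup>2 / (4 * (2 * (pi / t))))) * (1 / sqrt t * exp (?k * ((Re (z j))\<^sup>2 - (Im (z j))\<^sup>2))))"
      by (simp only: prod.distrib mult_ac)
    also have "\<dots> \<le> K2 * nrm M2 v * (\<Prod>j\<in>UNIV. c * ((1 + norm (z j)) ^ P * exp (?k * (Re (z j))\<^sup>2)))"
    proof (intro mult_left_mono prod_mono conjI)
      fix j
      have "Re (w j) = - Im (z j) / t" unfolding w_def by (simp add: Re_divide_of_real)
      then have w2: "(Re (w j))\<^sup>2 = (Im (z j))\<^sup>2 / t\<^sup>2" by (simp add: power_divide)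
      have "(Re (w j))\<^sup>2 / (4 * (2 * (pi / t))) + ?k * ((Re (z j))\<^sup>2 - (Im (z j))\<^sup>2) = ?k * (Re (z j))\<^sup>2"
        unfolding w2 using t by (simp add: field_simps power2_eq_square)
      then have "((1 + norm (w j)) ^ P2 * exp ((Re (w j))\<^sup>2 / (4 * (2 * (pi / t))))) * (1 / sqrt t * exp (?k * ((Re (z j))\<^sup>2 - (Im (z j))\<^sup>2)))
         = (1 + norm (w j)) ^ P2 * (1 / sqrt t * exp (?k * (Re (z j))\<^sup>2))"
        by (simp only: mult.assoc mult.left_commute[of "exp _"] exp_add[symmetric])
      also have "\<dots> \<le> ((1 + 1 / t) ^ P2 * (1 + norm (z j)) ^ P) * (1 / sqrt t * exp (?k * (Re (z j))\<^sup>2))"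
      proof (intro mult_right_mono)
        have nw: "norm (w j) = norm (z j) / t" using t by (simp add: w_def norm_mult norm_divide)
        have "1 + norm (w j) \<le> (1 + 1 / t) * (1 + norm (z j))" using t unfolding nw by (simp add: field_simps)
        then have "(1 + norm (w j)) ^ P2 \<le> ((1 + 1 / t) * (1 + norm (z j))) ^ P2" by (intro power_mono) auto
        also have "\<dots> = (1 + 1 / t) ^ P2 * (1 + norm (z j)) ^ P2" by (rule power_mult_distrib)
        also have "\<dots> \<le> (1 + 1 / t) ^ P2 * (1 + norm (z j)) ^ P"
          using t by (intro mult_left_mono power_increasing) (auto simp: P_def)
        finally show "(1 + norm (w j)) ^ P2 \<le> (1 + 1 / t) ^ P2 * (1 + norm (z j)) ^ P" .
      qed (use t in auto)
      also have "\<dots> = c * ((1 + norm (z j)) ^ P * exp (?k * (Re (z j))\<^sup>2))" by (simp add: c_def)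
      finally show "((1 + norm (w j)) ^ P2 * exp ((Re (w j))\<^sup>2 / (4 * (2 * (pi / t))))) * (1 / sqrt t * exp (?k * ((Re (z j))\<^sup>2 - (Im (z j))\<^sup>2))) \<le> c * ((1 + norm (z j)) ^ P * exp (?k * (Re (z j))\<^sup>2))" .
    qed (use K2 v t in auto)
    also have "\<dots> = K2 * nrm M2 v * c ^ CARD('n) * (\<Prod>j\<in>UNIV. (1 + norm (z j)) ^ P * exp (?k * (Re (z j))\<^sup>2))"
      unfolding prod.distrib[of "\<lambda>_. c"] by simp
    finally show ?thesis .
  qed
  show ?thesis
  proof (intro exI[of _ P] ballI)
    fix v assume v: "v \<in> X"
    define K where "K = K1 * nrm M1 v + K2 * nrm M2 v * c ^ CARD('n)"
    have pos: "0 \<le> K1 * nrm M1 v" "0 \<le> K2 * nrm M2 v * c ^ CARD('n)" using K1 K2 v c by auto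
    have le: "K1 * nrm M1 v \<le> K" "K2 * nrm M2 v * c ^ CARD('n) \<le> K" using pos by (auto simp: K_def)
    show "\<exists>K\<ge>0. \<forall>z. norm (G v z) \<le> K * (\<Prod>j\<in>UNIV. (1 + norm (z j)) ^ P * exp (?k * (Im (z j))\<^sup>2))
      \<and> norm (G v z) \<le> K * (\<Prod>j\<in>UNIV. (1 + norm (z j)) ^ P * exp (?k * (Re (z j))\<^sup>2))"
    proof (intro exI[of _ K] conjI allI)
      show "0 \<le> K" using pos by (simp add: K_def)
      fix z
      show "norm (G v z) \<le> K * (\<Prod>j\<in>UNIV. (1 + norm (z j)) ^ P * exp (?k * (Im (z j))\<^sup>2))"
        by (intro order_trans[OF im[OF v]] mult_right_mono le prod_nonneg) auto
      show "norm (G v z) \<le> K * (\<Prod>j\<in>UNIV. (1 + norm (z j)) ^ P * exp (?k * (Re (z j))\<^sup>2))"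
        by (intro order_trans[OF re[OF v]] mult_right_mono le prod_nonneg) auto
    qed
  qed
qed

text \<open>All variables but one are frozen; their weights become constants and do not alter the
  exponent \<open>P\<close>. The sum \<open>R Im + R Re\<close> is a single constant valid in both
  estimates.\<close>

lemma hardy_kernel_polynomial:
  fixes \<Phi> :: "(real^'n::finite \<Rightarrow> 'b) \<Rightarrow> complex"
  assumes t: "t > 0" and \<Phi>: "sdist \<Phi>" and v: "v \<in> X"
  defines "G \<equiv> \<lambda>z. \<Phi> (gau0 (pi * t) z v) * (\<Prod>j\<in>UNIV. exp (- (z j)\<^sup>2 / (8 * of_real (pi * t))))"
  assumes K: "K \<ge> 0"
    and im: "\<And>z. norm (G z) \<le> K * (\<Prod>j\<in>UNIV. (1 + norm (z j)) ^ P * exp (1 / (8 * pi * t) * (Im (z j))\<^sup>2))"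
    and re: "\<And>z. norm (G z) \<le> K * (\<Prod>j\<in>UNIV. (1 + norm (z j)) ^ P * exp (1 / (8 * pi * t) * (Re (z j))\<^sup>2))"
  shows "\<exists>c. \<forall>s. G (z(i := s)) = (\<Sum>k\<le>P. c k * s ^ k)"
proof -
  let ?k = "1 / (8 * pi * t)"
  define R where "R h = (\<Prod>j\<in>UNIV - {i}. (1 + norm (z j)) ^ P * exp (?k * (h (z j))\<^sup>2))" for h :: "complex \<Rightarrow> real"
  have R0: "0 \<le> R h" for h unfolding R_def by (intro prod_nonneg) auto
  have split: "(\<Prod>j\<in>UNIV. (1 + norm ((z(i := s)) j)) ^ P * exp (?k * (h ((z(i := s)) j))\<^sup>2)) = (1 + norm s) ^ P * exp (?k * (h s)\<^sup>2) * R h" for s h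
    unfolding R_def by (subst prod.remove[of _ i]) (auto intro!: arg_cong2[where f = "(*)"] prod.cong)
  show ?thesis
  proof (rule polynomial_of_gaussian_bounds)
    show "0 \<le> K * (R Im + R Re)" using K R0 by simp
    show "?k > 0" using t by simp
    define E where "E = (\<Prod>j\<in>UNIV - {i}. exp (- (z j)\<^sup>2 / (8 * of_real (pi * t))))"
    have "(\<Prod>j\<in>UNIV. exp (- ((z(i := s)) j)\<^sup>2 / (8 * of_real (pi * t)))) = exp (- s\<^sup>2 / (8 * of_real (pi * t))) * E" for s
      unfolding E_def by (subst prod.remove[of _ i]) (auto intro!: arg_cong2[where f = "(*)"] prod.cong)
    then have Gs: "G (z(i := s)) = \<Phi> (gau0 (pi * t) (z(i := s)) v) * (exp (- s\<^sup>2 / (8 * of_real (pi * t))) * E)" for s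
      by (simp add: G_def)
    have "Re (complex_of_real (pi * t)) > 0" using t by simp
    then have "(\<lambda>s. \<Phi> (gau0 (pi * t) (z(i := s)) v)) holomorphic_on UNIV"
      unfolding holomorphic_on_open[OF open_UNIV] using gau_z_derivative[OF \<Phi> v, of "\<lambda>_. of_real (pi * t)"] by blast
    then show "(\<lambda>s. G (z(i := s))) holomorphic_on UNIV"
      unfolding Gs by (intro holomorphic_intros) (use t in auto)
    fix s
    have "K * ((1 + norm s) ^ P * exp (?k * (h s)\<^sup>2) * R h) \<le> K * (R Im + R Re) * (1 + norm s) ^ P * exp (?k * (h s)\<^sup>2)"
      if "h = Im \<or> h = Re" for h
    proof -
      have "R h \<le> R Im + R Re" using that R0 by auto
      then have "(K * (1 + norm s) ^ P * exp (?k * (h s)\<^sup>2)) * R h \<le> (K * (1 + norm s) ^ P * exp (?k * (h s)\<^sup>2)) * (R Im + R Re)"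
        using K by (intro mult_left_mono) auto
      then show ?thesis by (simp only: mult_ac)
    qed
    then show "norm (G (z(i := s))) \<le> K * (R Im + R Re) * (1 + norm s) ^ P * exp (?k * (Im s)\<^sup>2)"
      "norm (G (z(i := s))) \<le> K * (R Im + R Re) * (1 + norm s) ^ P * exp (?k * (Re s)\<^sup>2)"
      by (auto intro: order_trans[OF im[of "z(i := s)", unfolded split[of _ Im]]] order_trans[OF re[of "z(i := s)", unfolded split[of _ Re]]])
  qed
qed

lemma kernel_bounded:
  assumes t: "t > 0"
  shows "\<exists>B. \<forall>x::real^'n::finite. norm (complex_of_real (xpow x \<alpha> * exp (- t * pi * (norm x)\<^sup>2))) \<le> B"
proof -
  have "norm (complex_of_real (xpow x \<alpha> * exp (- t * pi * (norm x)\<^sup>2))) \<le> (\<Prod>i\<in>UNIV. exp ((real (\<alpha> i))\<^sup>2 / (4 * (t * pi))))" for x :: "real^'n"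
  proof -
    have "exp (- t * pi * (norm x)\<^sup>2) = (\<Prod>i\<in>UNIV. exp (- (t * pi * (x $ i)\<^sup>2)))"
      using exp_norm_prod[of "t * pi" x] by simp
    then have "norm (complex_of_real (xpow x \<alpha> * exp (- t * pi * (norm x)\<^sup>2))) = (\<Prod>i\<in>UNIV. \<bar>x $ i\<bar> ^ \<alpha> i * exp (- (t * pi * (x $ i)\<^sup>2)))"
      unfolding norm_of_real by (simp add: xpow_def abs_mult abs_prod power_abs prod.distrib)
    also have "\<dots> \<le> (\<Prod>i\<in>UNIV. exp ((real (\<alpha> i))\<^sup>2 / (4 * (t * pi))))"
    proof (intro prod_mono conjI)
      fix i
      have "\<bar>x $ i\<bar> ^ \<alpha> i * exp (- (t * pi * (x $ i)\<^sup>2)) \<le> (1 + \<bar>x $ i\<bar>) ^ \<alpha> i * exp (- (t * pi) * (x $ i)\<^sup>2)"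
        by (simp add: mult_right_mono power_mono)
      also have "\<dots> \<le> exp ((real (\<alpha> i))\<^sup>2 / (4 * (t * pi)))" using t by (intro poly_gauss_bound) simp
      finally show "\<bar>x $ i\<bar> ^ \<alpha> i * exp (- (t * pi * (x $ i)\<^sup>2)) \<le> exp ((real (\<alpha> i))\<^sup>2 / (4 * (t * pi)))" .
    qed auto
    finally show ?thesis .
  qed
  then show ?thesis by blast
qed

text \<open>Two Gaussians with parameter \<open>pi * t\<close> multiply to one with
  \<open>2 * pi * t\<close>, so each coordinate contributes a Gaussian moment before normalisation.
  The factor \<open>exp ((y i)\<^sup>2 / (8 * pi * t))\<close> is the inverse of the correction in
  the kernel at real points.\<close>

lemma integral_gau:
  fixes y :: "'n::finite \<Rightarrow> real"
  assumes t: "t > 0" and C: "dualX Xs nrm J C" and v: "v \<in> X"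
  shows "(\<integral>x. C (gau0 (pi * t) (\<lambda>i. of_real (y i)) v x) * complex_of_real (xpow x \<alpha> * exp (- t * pi * (norm x)\<^sup>2)) \<partial>lborel)
    = C v * (\<Prod>i\<in>UNIV. exp (of_real ((y i)\<^sup>2 / (4 * (2 * pi * t)))) * gmom (2 * pi * t) (\<alpha> i) (y i))"
proof -
  let ?e = "\<lambda>i. eta 0 (\<alpha> i) (of_real (2 * pi * t)) (of_real (y i))"
  have "C (gau0 (pi * t) (\<lambda>i. of_real (y i)) v x) * complex_of_real (xpow x \<alpha> * exp (- t * pi * (norm x)\<^sup>2)) = C v * (\<Prod>i\<in>UNIV. ?e i (x $ i))" for x
  proof -
    have "exp (- t * pi * (norm x)\<^sup>2) = (\<Prod>i\<in>UNIV. exp (- (t * pi * (x $ i)\<^sup>2)))"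
      using exp_norm_prod[of "t * pi" x] by simp
    then have "complex_of_real (xpow x \<alpha> * exp (- t * pi * (norm x)\<^sup>2)) = (\<Prod>i\<in>UNIV. of_real ((x $ i) ^ \<alpha> i * exp (- (t * pi * (x $ i)\<^sup>2))))"
      by (simp add: xpow_def prod.distrib)
    then have "(\<Prod>i\<in>UNIV. eta 0 0 (of_real (pi * t)) (of_real (y i)) (x $ i)) * complex_of_real (xpow x \<alpha> * exp (- t * pi * (norm x)\<^sup>2))
      = (\<Prod>i\<in>UNIV. eta 0 0 (of_real (pi * t)) (of_real (y i)) (x $ i) * of_real ((x $ i) ^ \<alpha> i * exp (- (t * pi * (x $ i)\<^sup>2))))"
      by (simp only: prod.distrib)
    also have "\<dots> = (\<Prod>i\<in>UNIV. ?e i (x $ i))"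
    proof (intro prod.cong refl)
      fix i
      have "exp (of_real (y i) * of_real (x $ i) - of_real (pi * t) * (of_real (x $ i))\<^sup>2) * exp (of_real (- (t * pi * (x $ i)\<^sup>2)))
         = exp (of_real (y i) * of_real (x $ i) - complex_of_real (2 * pi * t) * (of_real (x $ i))\<^sup>2)"
        unfolding exp_add[symmetric] by (simp add: algebra_simps)
      moreover have "eta 0 0 (of_real (pi * t)) (of_real (y i)) (x $ i) * of_real ((x $ i) ^ \<alpha> i * exp (- (t * pi * (x $ i)\<^sup>2)))
        = of_real (x $ i) ^ \<alpha> i * (exp (of_real (y i) * of_real (x $ i) - of_real (pi * t) * (of_real (x $ i))\<^sup>2) * exp (of_real (- (t * pi * (x $ i)\<^sup>2))))"
        by (simp add: exp_of_real[symmetric])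
      ultimately show "eta 0 0 (of_real (pi * t)) (of_real (y i)) (x $ i) * of_real ((x $ i) ^ \<alpha> i * exp (- (t * pi * (x $ i)\<^sup>2))) = ?e i (x $ i)"
        by (simp only: eta.simps)
    qed
    finally show ?thesis unfolding gau_eq dualXD(2)[OF C v] by (simp only: mult_ac)
  qed
  moreover have "integrable lborel (?e i)" for i using t by (intro integrable_eta) simp
  ultimately have "(\<integral>x. C (gau0 (pi * t) (\<lambda>i. of_real (y i)) v x) * complex_of_real (xpow x \<alpha> * exp (- t * pi * (norm x)\<^sup>2)) \<partial>lborel)
     = C v * (\<Prod>i\<in>UNIV. integral\<^sup>L lborel (?e i))"
    using has_bochner_integral_prod_vec(2)[of ?e] by (simp only: integral_mult_right_zero)
  moreover have "integral\<^sup>L lborel (?e i) = exp (of_real ((y i)\<^sup>2 / (4 * (2 * pi * t)))) * gmom (2 * pi * t) (\<alpha> i) (y i)" for i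
    unfolding gmom_def by (simp only: mult.assoc[symmetric] exp_add[symmetric] add.right_inverse exp_zero mult_1)
  ultimately show ?thesis by (simp only:)
qed

lemma hardy_frechet:
  fixes \<Phi> \<Psi>1 \<Psi>2 :: "(real^'n::finite \<Rightarrow> 'b) \<Rightarrow> complex"
  assumes t: "t > 0" and \<Phi>: "sdist \<Phi>" and \<Psi>1: "sdist \<Psi>1" and \<Psi>2: "sdist \<Psi>2"
    and h1: "\<And>g. schwartzX Xs nrm g \<Longrightarrow> \<Phi> g = \<Psi>1 (\<lambda>x. exp (- (t * pi * (norm x)\<^sup>2)) *\<^sub>R g x)"
    and h2: "\<And>g. schwartzX Xs nrm g \<Longrightarrow> \<Phi> (fourierX J g) = \<Psi>2 (\<lambda>x. exp (- (pi / t * (norm x)\<^sup>2)) *\<^sub>R g x)"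
  shows "\<exists>N C. (\<forall>\<alpha>\<in>multi_idx N. dualX Xs nrm J (C \<alpha>)) \<and>
           (\<forall>g. schwartzX Xs nrm g \<longrightarrow>
              \<Phi> g = (\<Sum>\<alpha>\<in>multi_idx N.
                       \<integral>y. C \<alpha> (g y) * complex_of_real (xpow y \<alpha> * exp (- t * pi * (norm y)\<^sup>2)) \<partial>lborel))"
proof -
  let ?a = "pi * t" and ?r = "2 * pi * t"
  let ?g = "\<lambda>z v. gau0 ?a z v :: real^'n \<Rightarrow> 'b"
  define e where "e z = (\<Prod>j\<in>UNIV. exp (- (z j)\<^sup>2 / (8 * of_real ?a)))" for z :: "'n \<Rightarrow> complex"
  define G where "G v z = \<Phi> (?g z v) * e z" for v z
  have a: "?a > 0" and r: "?r > 0" using t by auto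
  have "\<exists>P. \<forall>v\<in>X. \<exists>K\<ge>0. \<forall>z. norm (G v z) \<le> K * (\<Prod>j\<in>UNIV. (1 + norm (z j)) ^ P * exp (1 / (8 * pi * t) * (Im (z j))\<^sup>2))
      \<and> norm (G v z) \<le> K * (\<Prod>j\<in>UNIV. (1 + norm (z j)) ^ P * exp (1 / (8 * pi * t) * (Re (z j))\<^sup>2))"
    unfolding G_def e_def by (rule hardy_kernel_bounds[OF t \<Phi> \<Psi>1 \<Psi>2 h1 h2])
  then obtain P where P: "\<forall>v\<in>X. \<exists>K\<ge>0. \<forall>z. norm (G v z) \<le> K * (\<Prod>j\<in>UNIV. (1 + norm (z j)) ^ P * exp (1 / (8 * pi * t) * (Im (z j))\<^sup>2))
      \<and> norm (G v z) \<le> K * (\<Prod>j\<in>UNIV. (1 + norm (z j)) ^ P * exp (1 / (8 * pi * t) * (Re (z j))\<^sup>2))"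
    by (elim exE)
  define Box where "Box = (Pi\<^sub>E UNIV (\<lambda>_. {..P}) :: ('n \<Rightarrow> nat) set)"
  have fin: "finite Box" unfolding Box_def by (intro finite_PiE) auto
  obtain \<mu> where \<mu>: "\<And>k s. k \<le> P \<Longrightarrow> poly (lag P k) (of_real s) = (\<Sum>j\<le>P. \<mu> k j * gmom ?r j s)"
    using lag_gmom[OF r] by blast
  define nz where "nz k = (\<lambda>i. complex_of_real (real (k i)))" for k :: "'n \<Rightarrow> nat"
  \<comment> \<open>Kernel values at integer nodes times the moment coefficients of the Lagrange
    basis. The empty sum makes \<open>C \<alpha>\<close> vanish outside \<open>Box\<close>, since
    the conclusion sums over the larger set \<open>multi_idx N\<close>.\<close>
  define C where "C \<alpha> v = (\<Sum>k\<in>(if \<alpha> \<in> Box then Box else {}). \<Phi> (?g (nz k) v) * (e (nz k) * (\<Prod>i\<in>UNIV. \<mu> (k i) (\<alpha> i))))" for \<alpha> v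
  have dual: "dualX Xs nrm J (C \<alpha>)" for \<alpha> unfolding C_def[abs_def] by (rule dualX_gau_sum[OF \<Phi> a])
  \<comment> \<open>Degree at most \<open>P\<close> in each of the \<open>CARD('n)\<close>
    variables.\<close>
  define N where "N = P * CARD('n)"
  have Box_sub: "Box \<subseteq> multi_idx N"
  proof
    fix k assume "k \<in> Box"
    then have "sum k UNIV \<le> (\<Sum>i\<in>(UNIV :: 'n set). P)" by (intro sum_mono) (auto simp: Box_def)
    then show "k \<in> multi_idx N" by (simp add: multi_idx_def N_def mult.commute)
  qed
  have C_expand: "G v (\<lambda>i. of_real (y i)) = (\<Sum>\<alpha>\<in>Box. C \<alpha> v * (\<Prod>i\<in>UNIV. gmom ?r (\<alpha> i) (y i)))"
    if v: "v \<in> X" for v and y :: "'n \<Rightarrow> real"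
  proof -
    obtain K where K: "K \<ge> 0" "\<And>z. norm (G v z) \<le> K * (\<Prod>j\<in>UNIV. (1 + norm (z j)) ^ P * exp (1 / (8 * pi * t) * (Im (z j))\<^sup>2))"
      "\<And>z. norm (G v z) \<le> K * (\<Prod>j\<in>UNIV. (1 + norm (z j)) ^ P * exp (1 / (8 * pi * t) * (Re (z j))\<^sup>2))"
      using bspec[OF P v] by blast
    have "\<exists>c. \<forall>s. G v (\<lambda>j. of_real ((y(i := s)) j)) = (\<Sum>l\<le>P. c l * of_real s ^ l)" for i and y :: "'n \<Rightarrow> real"
    proof -
      obtain c where "\<forall>s. G v ((\<lambda>j. of_real (y j))(i := s)) = (\<Sum>k\<le>P. c k * s ^ k)"
        using hardy_kernel_polynomial[OF t \<Phi> v K(1) K(2,3)[unfolded G_def e_def], of "\<lambda>j. of_real (y j)" i]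
        unfolding G_def e_def by blast
      moreover have "(\<lambda>j. complex_of_real ((y(i := s)) j)) = (\<lambda>j. of_real (y j))(i := of_real s)" for s by auto
      ultimately show ?thesis by auto
    qed
    then have "G v (\<lambda>i. of_real (y i)) = (\<Sum>k\<in>Box. G v (nz k) * (\<Prod>i\<in>UNIV. poly (lag P (k i)) (of_real (y i))))"
      unfolding Box_def nz_def by (rule lagrange_multi[of "\<lambda>y. G v (\<lambda>i. of_real (y i))"])
    also have "\<dots> = (\<Sum>k\<in>Box. G v (nz k) * (\<Prod>i\<in>UNIV. \<Sum>j\<le>P. \<mu> (k i) j * gmom ?r j (y i)))"
      by (intro sum.cong refl arg_cong2[where f = "(*)"] prod.cong \<mu>) (auto simp: Box_def)
    \<comment> \<open>A product of sums over \<open>{..P}\<close> is a sum over exponents in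
      \<open>Box\<close>; exchanging it with the sum over nodes collects the coefficient of each
      moment product into \<open>C \<alpha>\<close>.\<close>
    also have "\<dots> = (\<Sum>k\<in>Box. \<Sum>\<alpha>\<in>Box. G v (nz k) * (\<Prod>i\<in>UNIV. \<mu> (k i) (\<alpha> i) * gmom ?r (\<alpha> i) (y i)))"
      unfolding Box_def by (subst prod_sum_PiE) (auto simp: sum_distrib_left)
    also have "\<dots> = (\<Sum>\<alpha>\<in>Box. \<Sum>k\<in>Box. G v (nz k) * (\<Prod>i\<in>UNIV. \<mu> (k i) (\<alpha> i) * gmom ?r (\<alpha> i) (y i)))"
      by (rule sum.swap)
    also have "\<dots> = (\<Sum>\<alpha>\<in>Box. C \<alpha> v * (\<Prod>i\<in>UNIV. gmom ?r (\<alpha> i) (y i)))"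
      by (intro sum.cong refl) (simp add: C_def G_def sum_distrib_right prod.distrib mult.assoc)
    finally show ?thesis .
  qed
  define I where "I \<alpha> g = (\<integral>y. C \<alpha> (g y) * complex_of_real (xpow y \<alpha> * exp (- t * pi * (norm y)\<^sup>2)) \<partial>lborel)" for \<alpha> and g :: "real^'n \<Rightarrow> 'b"
  have sI: "sdist (I \<alpha>)" for \<alpha>
  proof -
    obtain B where B: "\<And>x::real^'n. norm (complex_of_real (xpow x \<alpha> * exp (- t * pi * (norm x)\<^sup>2))) \<le> B"
      using kernel_bounded[OF t] by blast
    have "continuous_on UNIV (\<lambda>x::real^'n. complex_of_real (xpow x \<alpha> * exp (- t * pi * (norm x)\<^sup>2)))"
      unfolding xpow_def by (intro continuous_intros)
    from sdist_integral(1)[OF dual this B] show ?thesis unfolding I_def[abs_def] .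
  qed
  define \<Theta> where "\<Theta> g = \<Phi> g - (\<Sum>\<alpha>\<in>multi_idx N. I \<alpha> g)" for g
  have s\<Theta>: "sdist \<Theta>" unfolding \<Theta>_def[abs_def] by (rule sdist_minus_sum[OF \<Phi> sI])
  have zero: "\<Theta> (?g (\<lambda>i. of_real (y i)) v) = 0" if v: "v \<in> X" for y v
  proof -
    let ?E = "\<Prod>i\<in>UNIV. exp (complex_of_real ((y i)\<^sup>2 / (4 * ?r)))"
    have "(\<Sum>\<alpha>\<in>multi_idx N. I \<alpha> (?g (\<lambda>i. of_real (y i)) v)) = (\<Sum>\<alpha>\<in>multi_idx N. C \<alpha> v * (\<Prod>i\<in>UNIV. gmom ?r (\<alpha> i) (y i)) * ?E)"
      unfolding I_def integral_gau[OF t dual v] by (simp only: prod.distrib mult_ac)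
    also have "\<dots> = (\<Sum>\<alpha>\<in>Box. C \<alpha> v * (\<Prod>i\<in>UNIV. gmom ?r (\<alpha> i) (y i)) * ?E)"
      by (rule sum.mono_neutral_right[OF finite_multi_idx Box_sub]) (simp add: C_def)
    also have "\<dots> = G v (\<lambda>i. of_real (y i)) * ?E"
      unfolding C_expand[OF v] sum_distrib_right ..
    also have "\<dots> = \<Phi> (?g (\<lambda>i. of_real (y i)) v)"
    proof -
      \<comment> \<open>The correction in the kernel cancels the Gaussian factor of the moments
        because \<open>4 * ?r = 8 * ?a\<close>.\<close>
      have "e (\<lambda>i. of_real (y i)) * ?E = 1"
        unfolding e_def prod.distrib[symmetric] exp_add[symmetric] by (intro prod.neutral) simp
      then show ?thesis unfolding G_def by (simp only: mult.assoc mult_1_right)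
    qed
    finally show ?thesis by (simp add: \<Theta>_def)
  qed
  have "\<Phi> g = (\<Sum>\<alpha>\<in>multi_idx N. I \<alpha> g)" if g: "schwartzX Xs nrm g" for g
    using sdist_zeroI[OF s\<Theta> a g zero] by (simp add: \<Theta>_def)
  then show ?thesis using dual unfolding I_def by (intro exI[of _ N] exI[of _ C]) blast
qed

end

theorem theorem4:
  fixes Xs :: "nat \<Rightarrow> 'b::{real_normed_vector,banach} set"
    and J :: "'b \<Rightarrow> 'b"
    and nrm :: "nat \<Rightarrow> 'b \<Rightarrow> real"
    and t :: real
    and \<Phi> \<Psi>1 \<Psi>2 :: "(real^'n::finite \<Rightarrow> 'b) \<Rightarrow> complex"
  assumes "t > 0"
    and "frechet_family Xs nrm J"
    and "tdistX Xs nrm J \<Phi>"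
    and "tdistX Xs nrm J \<Psi>1" and "tdistX Xs nrm J \<Psi>2"
    and "\<forall>g. schwartzX Xs nrm g \<longrightarrow>
           \<Phi> g = \<Psi>1 (\<lambda>x. exp (- t * pi * (norm x)\<^sup>2) *\<^sub>R g x)"
    and "\<forall>g. schwartzX Xs nrm g \<longrightarrow>
           \<Phi> (fourierX J g) = \<Psi>2 (\<lambda>x. exp (- (pi / t) * (norm x)\<^sup>2) *\<^sub>R g x)"
  shows "\<exists>N C. (\<forall>\<alpha>\<in>multi_idx N. dualX Xs nrm J (C \<alpha>)) \<and>
           (\<forall>g. schwartzX Xs nrm g \<longrightarrow>
              \<Phi> g = (\<Sum>\<alpha>\<in>multi_idx N.
                       \<integral>y. C \<alpha> (g y) * complex_of_real (xpow y \<alpha> * exp (- t * pi * (norm y)\<^sup>2)) \<partial>lborel))"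
proof -
  interpret frechet Xs nrm J by unfold_locales fact
  show ?thesis
    by (rule hardy_frechet[OF assms(1) tdist_sdist[OF assms(3)] tdist_sdist[OF assms(4)] tdist_sdist[OF assms(5)]])
       (use assms(6,7) in simp_all)
qed

end
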